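(* Let $\mathbb{K}$ be an algebraically closed field of characteristic zero, let $S_1$ be a $\mathbb{K}$-vector space with $\dim S_1=3$, and let $S_5=\operatorname{Sym}^5 S_1$ be the space of ternary quintic forms. Then every $f\in S_5$ satisfies $\operatorname{rk} f\le 10$.
   Context: For a form $f\in\operatorname{Sym}^d S_1$, the (Waring) rank $\operatorname{rk} f$ is the least integer $r\ge 0$ such that $f$ is a sum $f=v_1^d+\cdots+v_r^d$ of $r$ $d$-th powers of linear forms $v_1,\dots,v_r\in S_1$. *)

theory Defs
  imports
    "HOL-Computational_Algebra.Polynomial"
    "HOL-Library.Poly_Mapping"
    "HOL-Library.Extended_Nat"
begin

text \<open>
  The symmetric algebra of a vector space \<open>V\<close> over \<open>\<K>\<close> (scalar multiplication \<open>scale\<close>) is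
  built as the quotient of the free commutative \<open>\<K>\<close>-algebra on the underlying set of \<open>V\<close>, i.e.
  the polynomial ring with one indeterminate \<open>[v]\<close> for every vector \<open>v\<close>, by the ideal that makes
  \<open>v \<mapsto> [v]\<close> linear. The indeterminates are all the vectors of \<open>V\<close>, not a chosen basis.
\<close>

type_synonym ('v, 'k) free_alg = "('v \<Rightarrow>\<^sub>0 nat) \<Rightarrow>\<^sub>0 'k"

definition gen :: "'v \<Rightarrow> ('v, 'k::zero_neq_one) free_alg"
  where "gen v = Poly_Mapping.single (Poly_Mapping.single v 1) 1"

definition const :: "'k::zero \<Rightarrow> ('v, 'k) free_alg"
  where "const c = Poly_Mapping.single 0 c"

definition sym_relations ::
    "('k::field \<Rightarrow> 'v::ab_group_add \<Rightarrow> 'v) \<Rightarrow> ('v, 'k) free_alg set"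
  where "sym_relations scale =
    {gen (u + v) - (gen u + gen v) | u v. True} \<union>
    {gen (scale c v) - const c * gen v | c v. True}"

text \<open>The span of a set in a commutative ring, viewed as a module over itself, is the ideal it
  generates.\<close>

definition sym_ideal ::
    "('k::field \<Rightarrow> 'v::ab_group_add \<Rightarrow> 'v) \<Rightarrow> ('v, 'k) free_alg set"
  where "sym_ideal scale = module.span (*) (sym_relations scale)"

definition sym_class ::
    "('k::field \<Rightarrow> 'v::ab_group_add \<Rightarrow> 'v) \<Rightarrow> ('v, 'k) free_alg \<Rightarrow> ('v, 'k) free_alg set"
  where "sym_class scale p = {q. q - p \<in> sym_ideal scale}"

definition homogeneous :: "nat \<Rightarrow> ('v, 'k::zero) free_alg \<Rightarrow> bool"
  where "homogeneous d p \<longleftrightarrow>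
    (\<forall>m \<in> Poly_Mapping.keys p. (\<Sum>v \<in> Poly_Mapping.keys m. Poly_Mapping.lookup m v) = d)"

text \<open>\<open>Sym\<^sup>d V\<close>, the degree \<open>d\<close> component of the symmetric algebra. The relations are homogeneous
  of degree 1, so the grading descends to the quotient.\<close>

definition sym_power ::
    "('k::field \<Rightarrow> 'v::ab_group_add \<Rightarrow> 'v) \<Rightarrow> nat \<Rightarrow> ('v, 'k) free_alg set set"
  where "sym_power scale d = sym_class scale ` {p. homogeneous d p}"

text \<open>The class of \<open>\<Sum> [v]\<^sup>d\<close> is the sum of the \<open>d\<close>-th powers of the linear forms \<open>v\<close> in the
  quotient ring. The value is \<open>\<infinity>\<close> if no decomposition exists.\<close>

definition waring_rank ::
    "('k::field \<Rightarrow> 'v::ab_group_add \<Rightarrow> 'v) \<Rightarrow> nat \<Rightarrow> ('v, 'k) free_alg set \<Rightarrow> enat"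
  where "waring_rank scale d f =
    Inf {enat (length vs) | vs. f = sym_class scale (\<Sum>v\<leftarrow>vs. gen v ^ d)}"

end

theory Submission
  imports Defs "HOL-Library.Product_Plus" "HOL-Library.FuncSet"
begin

text \<open>Why four lines and a pencil: f is sought as a sum of binary quintics \<open>S z\<close>
  on lines of slope z, so its moment \<open>m b c\<close> must be the sum of z^b
  \<open>S z c\<close>. For c = 0 and c = 1 this system has two equations and one equation too many;
  a quartic with roots z makes them consistent exactly under three linear conditions, which leaves
  two of its five coefficients. For c = 2 the system is square, and for c = 3, 4, 5 it leaves 1, 2
  and 3 free parameters. They are spent on making the ranks 2+2+3+3, 1+3+3+3 or 1+1+4+4; if one line
  drops out, on 4+4+1, 2+4+4 or 3+3+4. A second obstruction besides a common double root is that all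
  but one of the four lines have zero moment for c = 0. Then f restricted to the plane is a fifth
  power, and this again produces a bad point. Three directions suffice because badness of a point
  with vanishing polar gradient says that a quadratic form on a two-dimensional quotient has an
  isotropic vector, and three isotropic lines make it zero.\<close>

text \<open>
  A quintic form is a symmetric 5-linear form \<open>M\<close> on the dual space \<open>K\<^sup>3\<close>. Let \<open>U\<close> be a plane in
  \<open>K\<^sup>3\<close>. The polars \<open>M \<mu>\<^sup>4\<close> with \<open>\<mu> \<in> U\<close> span at most three dimensions, so there is a pencil of
  quartics on \<open>U\<close> that annihilate them. If one of these quartics has four distinct roots, \<open>f\<close> is
  a sum of four binary quintics on lines through a common point. There is some freedom in this
  splitting, and it can be used to make the ranks of the four summands add up to at most 10.

  Otherwise the pencil has a common double root, that is, a bad point \<open>\<mu>\<close> on \<open>U\<close>. Bad points are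
  zeros of the Hessian determinant of \<open>f\<close>. If every plane contains one and the Hessian does not
  vanish identically, counting the bad points on lines gives infinitely many points that are bad for
  three directions and hence for all of them. This forces \<open>f\<close> into normal forms that are sums of two
  binary quintics (each of rank at most 5) up to a change of coordinates. If the Hessian vanishes
  identically, \<open>f\<close> is a binary quintic by the theorem of Gordan and Noether, or again all points are
  bad for all directions.
\<close>

subsection \<open>Pencils of univariate polynomials\<close>

text \<open>Stated by divisibility instead of order, so that every r is a double root of 0 and the
  absence of double roots includes p being nonzero.\<close>

definition double_root :: "'k::field poly \<Rightarrow> 'k \<Rightarrow> bool"
  where "double_root p r \<longleftrightarrow> [:-r, 1:]^2 dvd p"

lemma double_root_mult_left: "double_root p r \<Longrightarrow> double_root (q * p) r"
  by (simp add: double_root_def)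

lemma double_root_0 [simp]: "double_root 0 r"
  by (simp add: double_root_def)

lemma linear_dvd_cancel:
  fixes p :: "'k::field poly"
  shows "[:-r, 1:] * q dvd [:-r, 1:] * p \<longleftrightarrow> q dvd p"
  by (subst dvd_mult_cancel_left) simp

lemma double_root_linear_mult:
  "double_root ([:-a, 1:] * p) r \<Longrightarrow> double_root p r \<or> (r = a \<and> poly p a = 0)"
proof -
  assume d: "double_root ([:-a, 1:] * p) r"
  show ?thesis
  proof (cases "r = a")
    case True
    then have "[:-a, 1:] * [:-a, 1:] dvd [:-a, 1:] * p"
      using d by (simp only: double_root_def power2_eq_square)
    then show ?thesis using True linear_dvd_cancel poly_eq_0_iff_dvd by blast
  next
    case False
    show ?thesis
    proof (cases "p = 0")
      case True then show ?thesis by simp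
    next
      case pn: False
      have "2 \<le> order r ([:-a, 1:] * p)"
        using d pn unfolding double_root_def order_divides by (auto simp del: mult_pCons_left)
      also have "order r ([:-a, 1:] * p) = order r [:-a, 1:] + order r p"
        using pn by (intro order_mult) (auto simp del: mult_pCons_left)
      also have "order r [:-a, 1:] = 0" using False by (simp add: order_0I)
      finally show ?thesis using pn by (simp add: double_root_def order_divides)
    qed
  qed
qed

lemma double_root_poly: "double_root p r \<Longrightarrow> poly p r = 0 \<and> poly (pderiv p) r = 0"
  unfolding double_root_def power2_eq_square
  by (auto simp: pderiv_mult simp del: mult_pCons_left mult_pCons_right elim!: dvdE)

text \<open>At a root r of p the factor q has order 0, so p' q has order one less than p there
  (characteristic 0), whereas p q' has at least the order of p.\<close>

lemma wronskian_zero_imp_const: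
  fixes p q :: "'k::{alg_closed_field, field_char_0} poly"
  assumes W: "p * pderiv q = pderiv p * q"
    and nc: "\<And>r. \<not> (poly p r = 0 \<and> poly q r = 0)"
  shows "degree p = 0"
proof (rule ccontr)
  assume dp: "degree p \<noteq> 0"
  then obtain r where r: "poly p r = 0" using alg_closed_imp_poly_has_root[of p] by auto
  have pn: "p \<noteq> 0" using dp by auto
  have pn': "pderiv p \<noteq> 0" using dp by (simp add: pderiv_eq_0_iff)
  have qr: "poly q r \<noteq> 0" using nc r by blast
  then have qn: "q \<noteq> 0" by auto
  have nz: "pderiv p * q \<noteq> 0" using pn' qn by simp
  have 1: "order r (pderiv p * q) = order r (pderiv p)"
    unfolding order_mult[OF nz] using order_0I[OF qr] by simp
  have 2: "order r p = Suc (order r (pderiv p))"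
    by (rule order_pderiv[OF pn r])
  have nz': "p * pderiv q \<noteq> 0" unfolding W using nz .
  have "order r p \<le> order r (p * pderiv q)" unfolding order_mult[OF nz'] by simp
  then show False unfolding W using 1 2 by simp
qed

text \<open>Bertini's theorem for a pencil in one variable. Common roots are cancelled by induction
  on the degrees. Without common roots, a double root r of p + t q is a zero of the Wronskian and
  determines t as - p(r) / q(r), so only finitely many t occur unless the Wronskian vanishes, which
  makes p and q constant.\<close>

theorem pencil_squarefree:
  fixes p q :: "'k::{alg_closed_field, field_char_0} poly"
  assumes "\<And>r. \<not> (double_root p r \<and> double_root q r)"
  shows "finite {t. \<exists>r. double_root (p + smult t q) r}"
  using assms
proof (induction "degree p + degree q" arbitrary: p q rule: less_induct)
  case less
  show ?case
  proof (cases "\<exists>a. poly p a = 0 \<and> poly q a = 0")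
    case True
    then obtain a p1 q1 where p: "p = [:-a, 1:] * p1" and q: "q = [:-a, 1:] * q1"
      by (metis dvdE poly_eq_0_iff_dvd)
    have nd: "\<not> (double_root p1 r \<and> double_root q1 r)" for r
      using less.prems[of r] double_root_mult_left unfolding p q by blast
    have na: "\<not> (poly p1 a = 0 \<and> poly q1 a = 0)"
    proof
      assume "poly p1 a = 0 \<and> poly q1 a = 0"
      then have "double_root p a" "double_root q a"
        unfolding p q double_root_def power2_eq_square
        by (simp_all only: linear_dvd_cancel poly_eq_0_iff_dvd)
      then show False using less.prems by blast
    qed
    have "p \<noteq> 0 \<or> q \<noteq> 0" using less.prems[of 0] by auto
    then have "degree p1 + degree q1 < degree p + degree q"
      by (cases "p1 = 0"; cases "q1 = 0") (auto simp: p q degree_mult_eq simp del: mult_pCons_left)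
    then have fin: "finite {t. \<exists>r. double_root (p1 + smult t q1) r}"
      using less.hyps nd by blast
    have fin2: "finite {t. poly (p1 + smult t q1) a = 0}"
    proof (cases "poly q1 a = 0")
      case True
      then show ?thesis using na by simp
    next
      case False
      then have "{t. poly (p1 + smult t q1) a = 0} \<subseteq> {- poly p1 a / poly q1 a}"
        by (auto simp: nonzero_eq_divide_eq add_eq_0_iff minus_divide_left simp del: divide_minus_left)
      then show ?thesis using finite_subset by blast
    qed
    \<comment> \<open>After cancelling X - a, a double root either stays one of the cofactor, or it
      is a itself and the cofactor still vanishes at a.\<close>
    have "{t. \<exists>r. double_root (p + smult t q) r} \<subseteq>
        {t. \<exists>r. double_root (p1 + smult t q1) r} \<union> {t. poly (p1 + smult t q1) a = 0}"
    proof
      fix t assume "t \<in> {t. \<exists>r. double_root (p + smult t q) r}"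
      then obtain r where r: "double_root (p + smult t q) r" by auto
      have "p + smult t q = [:-a, 1:] * (p1 + smult t q1)"
        by (simp only: p q distrib_left mult_smult_right)
      then show "t \<in> {t. \<exists>r. double_root (p1 + smult t q1) r} \<union> {t. poly (p1 + smult t q1) a = 0}"
        using r double_root_linear_mult by fastforce
    qed
    then show ?thesis using fin fin2 finite_subset by blast
  next
    case False
    then have nc: "\<not> (poly p r = 0 \<and> poly q r = 0)" for r by blast
    let ?W = "p * pderiv q - pderiv p * q"
    show ?thesis
    proof (cases "?W = 0")
      case True
      then have "degree p = 0" "degree q = 0"
        using wronskian_zero_imp_const[of p q] wronskian_zero_imp_const[of q p] nc
        by (auto simp: mult.commute)
      then obtain a b where ab: "p = [:a:]" "q = [:b:]" by (meson degree_eq_zeroE)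
      have "{t. \<exists>r. double_root (p + smult t q) r} \<subseteq> {t. a + t * b = 0}"
        using double_root_poly by (fastforce simp: ab)
      moreover have "finite {t. a + t * b = 0}"
      proof (cases "b = 0")
        case True then show ?thesis using nc[of 0] by (simp add: ab)
      next
        case False
        then have "{t. a + t * b = 0} \<subseteq> {- a / b}" by (auto simp: nonzero_eq_divide_eq add_eq_0_iff minus_divide_left simp del: divide_minus_left)
        then show ?thesis using finite_subset by blast
      qed
      ultimately show ?thesis using finite_subset by blast
    next
      case W: False
      have "{t. \<exists>r. double_root (p + smult t q) r} \<subseteq> (\<lambda>r. - poly p r / poly q r) ` {r. poly ?W r = 0}"
      proof
        fix t assume "t \<in> {t. \<exists>r. double_root (p + smult t q) r}"
        then obtain r where "double_root (p + smult t q) r" by auto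
        from double_root_poly[OF this]
        have e: "poly p r + t * poly q r = 0" "poly (pderiv p) r + t * poly (pderiv q) r = 0"
          by (auto simp: pderiv_add pderiv_smult)
        have "poly q r \<noteq> 0" using e nc[of r] by auto
        moreover have "poly ?W r = 0"
        proof -
          have "poly p r = - (t * poly q r)" "poly (pderiv p) r = - (t * poly (pderiv q) r)"
            using e by (simp_all add: eq_neg_iff_add_eq_0)
          then show ?thesis by simp
        qed
        ultimately show "t \<in> (\<lambda>r. - poly p r / poly q r) ` {r. poly ?W r = 0}"
          using e by (intro image_eqI[of _ _ r]) (auto simp: nonzero_eq_divide_eq add_eq_0_iff minus_divide_left simp del: divide_minus_left)
      qed
      moreover have "finite {r. poly ?W r = 0}" using W poly_roots_finite by blast
      ultimately show ?thesis using finite_subset by blast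
    qed
  qed
qed

lemma squarefree_roots:
  fixes p :: "'k::alg_closed_field poly"
  assumes "\<And>r. \<not> double_root p r"
  shows "card {z. poly p z = 0} = degree p"
  using assms
proof (induction "degree p" arbitrary: p)
  case 0
  then obtain c where c: "p = [:c:]" by (metis degree_eq_zeroE)
  then have "c \<noteq> 0" using 0(2)[of 0] by auto
  then show ?case using c by simp
next
  case (Suc n)
  then obtain a where "poly p a = 0" using alg_closed_imp_poly_has_root by (metis zero_less_Suc)
  then obtain q where q: "p = [:-a, 1:] * q" by (metis dvdE poly_eq_0_iff_dvd)
  have pn: "p \<noteq> 0" using Suc(3)[of 0] by auto
  then have qn: "q \<noteq> 0" using q by auto
  have "\<not> double_root q r" for r using Suc(3) q double_root_mult_left by blast
  moreover have dq: "n = degree q" using Suc(2) qn by (simp add: q degree_mult_eq del: mult_pCons_left)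
  ultimately have "card {z. poly q z = 0} = n" using Suc(1) by blast
  moreover have "poly q a \<noteq> 0"
  proof
    assume "poly q a = 0"
    then have "double_root p a" unfolding q double_root_def power2_eq_square
      by (simp only: linear_dvd_cancel poly_eq_0_iff_dvd)
    then show False using Suc(3) by blast
  qed
  moreover have "{z. poly p z = 0} = insert a {z. poly q z = 0}" by (auto simp: q)
  ultimately show ?case using poly_roots_finite[OF qn] Suc(2) by simp
qed

subsection \<open>Sequences as sums of geometric sequences\<close>

text \<open>The operator s(j+1) - a s(j) kills the contribution of the node a and multiplies that of
  z by z - a, so the induction hypothesis applies to it and the weights are divided by z -
  a.\<close>

lemma vandermonde_solve:
  fixes s :: "nat \<Rightarrow> 'k::field"
  assumes "finite Z"
  shows "\<exists>c. \<forall>j<card Z. s j = (\<Sum>z\<in>Z. c z * z ^ j)"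
  using assms
proof (induction Z arbitrary: s rule: finite_induct)
  case empty
  then show ?case by simp
next
  case (insert a Z)
  obtain c where c: "\<And>j. j < card Z \<Longrightarrow> s (Suc j) - a * s j = (\<Sum>z\<in>Z. c z * z ^ j)"
    using insert.IH[of "\<lambda>j. s (Suc j) - a * s j"] by blast
  \<comment> \<open>The weight at a is the one value that makes the equation for j = 0 true; the
    recursion then carries it to all later j.\<close>
  define d where "d z = (if z = a then s 0 - (\<Sum>z\<in>Z. c z / (z - a)) else c z / (z - a))" for z
  have dZ: "(\<Sum>z\<in>Z. d z * g z) = (\<Sum>z\<in>Z. c z / (z - a) * g z)" for g
    using insert.hyps by (intro sum.cong) (auto simp: d_def)
  have "s j = (\<Sum>z\<in>insert a Z. d z * z ^ j)" if "j < Suc (card Z)" for j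
    using that
  proof (induction j)
    case 0
    then show ?case using insert.hyps dZ[of "\<lambda>_. 1"] by (simp add: d_def)
  next
    case (Suc j)
    have "s (Suc j) = a * s j + (\<Sum>z\<in>Z. c z * z ^ j)" using c[of j] Suc.prems by (simp add: algebra_simps)
    also have "s j = (\<Sum>z\<in>insert a Z. d z * z ^ j)" using Suc by simp
    also have "(\<Sum>z\<in>Z. c z * z ^ j) = (\<Sum>z\<in>Z. d z * ((z - a) * z ^ j))"
      unfolding dZ using insert.hyps by (intro sum.cong) auto
    also have "a * (\<Sum>z\<in>insert a Z. d z * z ^ j) + \<dots> = (\<Sum>z\<in>insert a Z. d z * z ^ Suc j)"
      using insert.hyps by (simp add: sum_distrib_left sum.distrib[symmetric] algebra_simps)
    finally show ?case .
  qed
  then show ?case using insert.hyps by auto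
qed

text \<open>Sylvester's method: p is the characteristic polynomial of a recurrence for s up to index
  N. The Vandermonde system fits the first \<open>degree p\<close> terms, and since both sides obey
  the recurrence they agree up to N.\<close>

lemma quadrature:
  fixes p :: "'k::field poly"
  assumes fin: "finite Z" and Z: "\<And>z. z \<in> Z \<Longrightarrow> poly p z = 0" and card: "card Z = degree p" and p0: "p \<noteq> 0"
    and rec: "\<And>j. j + degree p \<le> N \<Longrightarrow> (\<Sum>l\<le>degree p. coeff p l * s (l + j)) = 0"
  shows "\<exists>c. \<forall>j\<le>N. s j = (\<Sum>z\<in>Z. c z * z ^ j)"
proof -
  obtain c where c: "\<And>j. j < card Z \<Longrightarrow> s j = (\<Sum>z\<in>Z. c z * z ^ j)"
    using vandermonde_solve[OF fin] by blast
  have "s j = (\<Sum>z\<in>Z. c z * z ^ j)" if "j \<le> N" for j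
    using that
  proof (induction j rule: less_induct)
    case (less j)
    show ?case
    proof (cases "j < degree p")
      case True then show ?thesis using c card by simp
    next
      case False
      define i where "i = j - degree p"
      have j: "j = degree p + i" using False by (simp add: i_def)
      have L: "coeff p (degree p) \<noteq> 0" using p0 by simp
      have "(\<Sum>l\<le>degree p. coeff p l * (\<Sum>z\<in>Z. c z * z ^ (l + i))) = (\<Sum>z\<in>Z. c z * z ^ i * poly p z)"
        unfolding sum_distrib_left poly_altdef by (subst sum.swap) (simp add: power_add mult_ac)
      also have "\<dots> = 0" using Z by simp
      also have "0 = (\<Sum>l\<le>degree p. coeff p l * s (l + i))" using rec[of i] less.prems j by (simp add: add.commute)
      finally have "(\<Sum>l<degree p. coeff p l * (\<Sum>z\<in>Z. c z * z ^ (l + i))) + coeff p (degree p) * (\<Sum>z\<in>Z. c z * z ^ j)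
        = (\<Sum>l<degree p. coeff p l * s (l + i)) + coeff p (degree p) * s j"
        by (simp add: lessThan_Suc_atMost[symmetric] j)
      moreover have "(\<Sum>l<degree p. coeff p l * (\<Sum>z\<in>Z. c z * z ^ (l + i))) = (\<Sum>l<degree p. coeff p l * s (l + i))"
        using less j by (intro sum.cong) auto
      ultimately show ?thesis using L by simp
    qed
  qed
  then show ?thesis by blast
qed

subsection \<open>Binary quintics\<close>

text \<open>A binary quintic is given by the values \<open>s j\<close> of its polarization on \<open>5 - j\<close> copies of the first and
  \<open>j\<close> copies of the second basis vector.\<close>

definition brank :: "nat \<Rightarrow> (nat \<Rightarrow> 'k::field) \<Rightarrow> bool"
  where "brank n s \<longleftrightarrow> (\<exists>ps. length ps \<le> n \<and> (\<forall>j\<le>5. s j = (\<Sum>(u, w)\<leftarrow>ps. u ^ (5 - j) * w ^ j)))"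

lemma brank_mono: "brank n s \<Longrightarrow> n \<le> m \<Longrightarrow> brank m s"
  unfolding brank_def by (elim exE conjE, rule exI, rule conjI, rule order_trans)

lemma fifth_root: "\<exists>k. k ^ 5 = (c::'k::alg_closed_field)"
  using nth_root_exists[of 5 c] by auto

text \<open>A weight c at the node z is absorbed by a fifth root k of c: the summand is the fifth
  power of the form (k, k z).\<close>

lemma brank_sum:
  fixes s :: "nat \<Rightarrow> 'k::alg_closed_field"
  assumes "finite Z" "card Z \<le> n" "\<And>j. j \<le> 5 \<Longrightarrow> s j = (\<Sum>z\<in>Z. c z * z ^ j)"
  shows "brank n s"
proof -
  obtain zs where zs: "set zs = Z" "distinct zs" using assms(1) finite_distinct_list by blast
  obtain k where k: "\<And>z. k z ^ 5 = c z" using choice[of "\<lambda>z k. k ^ 5 = c z"] fifth_root by blast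
  let ?ps = "map (\<lambda>z. (k z, k z * z)) zs"
  have "s j = (\<Sum>(u, w)\<leftarrow>?ps. u ^ (5 - j) * w ^ j)" if "j \<le> 5" for j
  proof -
    have "k z ^ (5 - j) * (k z * z) ^ j = c z * z ^ j" for z
      using that k[of z] by (simp add: power_mult_distrib mult.assoc[symmetric] power_add[symmetric])
    then show ?thesis
      using zs assms(3)[OF that] by (simp add: sum_list_distinct_conv_sum_set o_def)
  qed
  moreover have "length ?ps \<le> n" using zs assms(2) distinct_card[of zs] by simp
  ultimately show ?thesis unfolding brank_def by blast
qed

text \<open>The node at infinity, the form (0, k), contributes to the last moment only; one extra
  summand therefore corrects \<open>s 5\<close> at will.\<close>

lemma brank_Suc_infinity:
  fixes s :: "nat \<Rightarrow> 'k::alg_closed_field"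
  assumes "brank n s'" "\<And>j. j \<le> 4 \<Longrightarrow> s j = s' j"
  shows "brank (Suc n) s"
proof -
  obtain ps where ps: "length ps \<le> n" "\<And>j. j \<le> 5 \<Longrightarrow> s' j = (\<Sum>(u, w)\<leftarrow>ps. u ^ (5 - j) * w ^ j)"
    using assms(1) unfolding brank_def by blast
  obtain k where k: "k ^ 5 = s 5 - s' 5" using fifth_root by blast
  have "s j = (\<Sum>(u, w)\<leftarrow>(0, k) # ps. u ^ (5 - j) * w ^ j)" if "j \<le> 5" for j
  proof (cases "j = 5")
    case True then show ?thesis using ps(2)[of 5] k by simp
  next
    case False
    then show ?thesis using that ps(2)[of j] assms(2)[of j] by simp
  qed
  moreover have "length ((0, k) # ps) \<le> Suc n" using ps(1) by simp
  ultimately show ?thesis unfolding brank_def by blast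
qed

text \<open>The recurrence says that p is apolar to the quintic; a squarefree apolar polynomial
  supplies as many nodes as its degree.\<close>

lemma brank_poly:
  fixes p :: "'k::alg_closed_field poly"
  assumes "\<And>r. \<not> double_root p r" "degree p \<le> n"
    and "\<And>j. j + degree p \<le> 5 \<Longrightarrow> (\<Sum>l\<le>degree p. coeff p l * s (l + j)) = 0"
  shows "brank n s"
proof -
  have p0: "p \<noteq> 0" using assms(1)[of 0] by auto
  let ?Z = "{z. poly p z = 0}"
  have fin: "finite ?Z" using poly_roots_finite[OF p0] .
  have card: "card ?Z = degree p" using squarefree_roots assms(1) .
  have "\<exists>c. \<forall>j\<le>5. s j = (\<Sum>z\<in>?Z. c z * z ^ j)"
    by (rule quadrature[OF fin _ card p0 assms(3)]) auto
  then obtain c where "\<And>j. j \<le> 5 \<Longrightarrow> s j = (\<Sum>z\<in>?Z. c z * z ^ j)" by blast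
  then show ?thesis by (rule brank_sum[OF fin, of n s c, unfolded card, OF assms(2)])
qed

lemma ex_avoid:
  fixes P :: "'k::ring_char_0 \<Rightarrow> bool"
  assumes "finite {t. P t}"
  shows "\<exists>t. \<not> P t"
  using ex_new_if_finite[OF infinite_UNIV_char_0 assms] by simp

text \<open>The cross products of two rows lie in the kernel. If all of them are zero, the rows are
  proportional and vectors such as (a2, -a1, 0) work; if these vanish too, the matrix is
  zero.\<close>

lemma kernel3:
  fixes a1 :: "'k::field"
  assumes det: "a1 * (b2 * c3 - b3 * c2) - a2 * (b1 * c3 - b3 * c1) + a3 * (b1 * c2 - b2 * c1) = 0"
  shows "\<exists>x y z. \<not> (x = 0 \<and> y = 0 \<and> z = 0) \<and> a1 * x + a2 * y + a3 * z = 0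
    \<and> b1 * x + b2 * y + b3 * z = 0 \<and> c1 * x + c2 * y + c3 * z = 0"
proof -
  define P where "P x y z \<longleftrightarrow> a1 * x + a2 * y + a3 * z = 0
    \<and> b1 * x + b2 * y + b3 * z = 0 \<and> c1 * x + c2 * y + c3 * z = 0" for x y z
  have ab: "P (a2 * b3 - a3 * b2) (a3 * b1 - a1 * b3) (a1 * b2 - a2 * b1)"
    using det unfolding P_def by (simp add: algebra_simps)
  have ac: "P (a2 * c3 - a3 * c2) (a3 * c1 - a1 * c3) (a1 * c2 - a2 * c1)"
    using det unfolding P_def by (simp add: algebra_simps)
  have bc: "P (b2 * c3 - b3 * c2) (b3 * c1 - b1 * c3) (b1 * c2 - b2 * c1)"
    using det unfolding P_def by (simp add: algebra_simps)
  have "\<exists>x y z. \<not> (x = 0 \<and> y = 0 \<and> z = 0) \<and> P x y z"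
  proof (rule ccontr)
    assume "\<not> ?thesis"
    then have no: "P x y z \<Longrightarrow> x = 0 \<and> y = 0 \<and> z = 0" for x y z by blast
    have z: "a2 * b3 = a3 * b2" "a3 * b1 = a1 * b3" "a1 * b2 = a2 * b1"
      "a2 * c3 = a3 * c2" "a3 * c1 = a1 * c3" "a1 * c2 = a2 * c1"
      "b2 * c3 = b3 * c2" "b3 * c1 = b1 * c3" "b1 * c2 = b2 * c1"
      using no[OF ab] no[OF ac] no[OF bc] by simp_all
    have "P a2 (- a1) 0" "P 0 a3 (- a2)" "P b2 (- b1) 0" "P 0 b3 (- b2)" "P c2 (- c1) 0" "P 0 c3 (- c2)"
      unfolding P_def using z by (simp_all add: mult.commute)
    then have "a1 = 0" "a2 = 0" "a3 = 0" "b1 = 0" "b2 = 0" "b3 = 0" "c1 = 0" "c2 = 0" "c3 = 0"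
      using no by fastforce+
    then have "P 1 0 0" by (simp add: P_def)
    then show False using no by fastforce
  qed
  then show ?thesis unfolding P_def by blast
qed

lemma brank_cong:
  assumes "brank n s" "\<And>j. j \<le> 5 \<Longrightarrow> s j = t j"
  shows "brank n t"
proof -
  obtain ps where "length ps \<le> n" "\<And>j. j \<le> 5 \<Longrightarrow> s j = (\<Sum>(u, w)\<leftarrow>ps. u ^ (5 - j) * w ^ j)"
    using assms(1) unfolding brank_def by blast
  then show ?thesis unfolding brank_def using assms(2) by (intro exI[of _ ps]) auto
qed

lemma brank_cubic:
  fixes s0 :: "'k::alg_closed_field"
  assumes "\<And>r. \<not> double_root [:c0, c1, c2, 1:] r"
    and "c0 * s0 + c1 * s1 + c2 * s2 + s3 = 0" "c0 * s1 + c1 * s2 + c2 * s3 + s4 = 0"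
    and "c0 * s2 + c1 * s3 + c2 * s4 + s5 = 0"
  shows "brank 3 ((!) [s0, s1, s2, s3, s4, s5])"
proof (rule brank_poly[OF assms(1)])
  fix j assume "j + degree [:c0, c1, c2, 1:] \<le> 5"
  then consider "j = 0" | "j = 1" | "j = 2" by fastforce
  then show "(\<Sum>l\<le>degree [:c0, c1, c2, 1:]. coeff [:c0, c1, c2, 1:] l * [s0, s1, s2, s3, s4, s5] ! (l + j)) = 0"
    using assms(2-4) by cases (auto simp: eval_nat_numeral)
qed simp

lemma brank_quartic:
  fixes s0 :: "'k::alg_closed_field"
  assumes "\<And>r. \<not> double_root [:c0, c1, c2, c3, 1:] r"
    and "c0 * s0 + c1 * s1 + c2 * s2 + c3 * s3 + s4 = 0" "c0 * s1 + c1 * s2 + c2 * s3 + c3 * s4 + s5 = 0"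
  shows "brank 4 ((!) [s0, s1, s2, s3, s4, s5])"
proof (rule brank_poly[OF assms(1)])
  fix j assume "j + degree [:c0, c1, c2, c3, 1:] \<le> 5"
  then consider "j = 0" | "j = 1" by fastforce
  then show "(\<Sum>l\<le>degree [:c0, c1, c2, c3, 1:]. coeff [:c0, c1, c2, c3, 1:] l * [s0, s1, s2, s3, s4, s5] ! (l + j)) = 0"
    using assms(2-3) by cases (auto simp: eval_nat_numeral)
qed simp

lemma brank_quintic:
  fixes s0 :: "'k::alg_closed_field"
  assumes "\<And>r. \<not> double_root [:c0, c1, c2, c3, c4, 1:] r"
    and "c0 * s0 + c1 * s1 + c2 * s2 + c3 * s3 + c4 * s4 + s5 = 0"
  shows "brank 5 ((!) [s0, s1, s2, s3, s4, s5])"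
proof (rule brank_poly[OF assms(1)])
  fix j assume "j + degree [:c0, c1, c2, c3, c4, 1:] \<le> 5"
  then have "j = 0" by simp
  then show "(\<Sum>l\<le>degree [:c0, c1, c2, c3, c4, 1:]. coeff [:c0, c1, c2, c3, c4, 1:] l * [s0, s1, s2, s3, s4, s5] ! (l + j)) = 0"
    using assms(2) by (auto simp: eval_nat_numeral)
qed simp

lemma brank_1_geometric:
  fixes c :: "'k::alg_closed_field"
  shows "brank 1 ((!) [c, c * r, c * r^2, c * r^3, c * r^4, c * r^5])"
proof (rule brank_sum[of "{r}" _ _ "\<lambda>_. c"])
  fix j :: nat assume "j \<le> 5"
  then consider "j = 0" | "j = 1" | "j = 2" | "j = 3" | "j = 4" | "j = 5" by linarith
  then show "[c, c * r, c * r^2, c * r^3, c * r^4, c * r^5] ! j = (\<Sum>z\<in>{r}. c * z ^ j)"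
    by cases auto
qed auto

lemma brank_Suc_list:
  fixes s0 :: "'k::alg_closed_field"
  assumes "brank n ((!) [s0, s1, s2, s3, s4, t])"
  shows "brank (Suc n) ((!) [s0, s1, s2, s3, s4, s5])"
proof (rule brank_Suc_infinity[OF assms])
  fix j :: nat assume "j \<le> 4"
  then consider "j = 0" | "j = 1" | "j = 2" | "j = 3" | "j = 4" by linarith
  then show "[s0, s1, s2, s3, s4, s5] ! j = [s0, s1, s2, s3, s4, t] ! j"
    by cases auto
qed

section \<open>Ranks of binary quintics whose last moments are still free\<close>

lemma disc_no_double_root:
  fixes c0 :: "'k::field"
  assumes "c1^2 - 4 * c0 * c2 \<noteq> 0"
  shows "\<not> double_root [:c0, c1, c2:] r"
proof
  assume "double_root [:c0, c1, c2:] r"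
  from double_root_poly[OF this]
  have "c0 + r * (c1 + r * c2) = 0" and c1: "c1 = - 2 * r * c2"
    by (auto simp: pderiv_pCons eq_neg_iff_add_eq_0 algebra_simps)
  then have "c0 = r^2 * c2" by (simp add: algebra_simps power2_eq_square)
  then show False using assms c1 by (simp add: algebra_simps power2_eq_square)
qed

text \<open>Used with N = 3 and N = 4: the quadratic is apolar only to the initial segment, and the
  two-node sum then continues the sequence up to index 5.\<close>

lemma quadratic_quadrature:
  fixes c0 :: "'k::alg_closed_field"
  assumes c2: "c2 \<noteq> 0" and disc: "\<And>r. \<not> double_root [:c0, c1, c2:] r"
    and rec: "\<And>j. j + 2 \<le> N \<Longrightarrow> c0 * s j + c1 * s (j + 1) + c2 * s (j + 2) = 0"
  shows "\<exists>t. brank 2 t \<and> (\<forall>j\<le>N. t j = s j)"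
proof -
  let ?p = "[:c0, c1, c2:]"
  let ?Z = "{z. poly ?p z = 0}"
  have p0: "?p \<noteq> 0" using c2 by simp
  have deg: "degree ?p = 2" using c2 by simp
  have fin: "finite ?Z" using poly_roots_finite[OF p0] .
  have card: "card ?Z = degree ?p" using squarefree_roots disc .
  have "\<exists>c. \<forall>j\<le>N. s j = (\<Sum>z\<in>?Z. c z * z ^ j)"
  proof (rule quadrature[OF fin _ card p0])
    fix j assume "j + degree ?p \<le> N"
    then show "(\<Sum>l\<le>degree ?p. coeff ?p l * s (l + j)) = 0"
      unfolding deg using rec[of j] by (simp add: eval_nat_numeral)
  qed auto
  then obtain c where c: "\<And>j. j \<le> N \<Longrightarrow> s j = (\<Sum>z\<in>?Z. c z * z ^ j)" by blast
  have "brank 2 (\<lambda>j. \<Sum>z\<in>?Z. c z * z ^ j)"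
    by (rule brank_sum[OF fin]) (simp_all add: card deg del: poly_pCons)
  moreover have "\<forall>j\<le>N. (\<Sum>z\<in>?Z. c z * z ^ j) = s j" using c by (simp del: poly_pCons)
  ultimately show ?thesis by (intro exI conjI)
qed

text \<open>Cofinitely many s5 instead of one: two lines have to share a prescribed sum of last
  moments, and both conditions must hold at t and at a constant minus t.\<close>

definition gen_brank :: "nat \<Rightarrow> 'k::field \<Rightarrow> 'k \<Rightarrow> 'k \<Rightarrow> 'k \<Rightarrow> 'k \<Rightarrow> bool"
  where "gen_brank n s0 s1 s2 s3 s4 \<longleftrightarrow> finite {s5. \<not> brank n ((!) [s0, s1, s2, s3, s4, s5])}"

lemma gen_brank_mono: "gen_brank n s0 s1 s2 s3 s4 \<Longrightarrow> n \<le> m \<Longrightarrow> gen_brank m s0 s1 s2 s3 s4"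
  unfolding gen_brank_def by (rule finite_subset[rotated]) (auto dest: brank_mono)

lemma gen_brank_finite:
  assumes "finite B" "\<And>s5. s5 \<notin> B \<Longrightarrow> brank n ((!) [s0, s1, s2, s3, s4, s5])"
  shows "gen_brank n s0 s1 s2 s3 s4"
  unfolding gen_brank_def by (rule finite_subset[OF _ assms(1)]) (use assms(2) in blast)

lemma gen_brank_all: "(\<And>s5. brank n ((!) [s0, s1, s2, s3, s4, s5])) \<Longrightarrow> gen_brank n s0 s1 s2 s3 s4"
  by (rule gen_brank_finite[of "{}"]) auto

definition hankel2 :: "'k::comm_ring_1 \<Rightarrow> 'k \<Rightarrow> 'k \<Rightarrow> 'k"
  where "hankel2 s0 s1 s2 = s0 * s2 - s1^2"

text \<open>The determinant of the Hankel matrix with rows (s0, s1, s2), (s1, s2, s3), (s2, s3, s4),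
  the catalecticant of the first five moments.\<close>

definition hankel3 :: "'k::comm_ring_1 \<Rightarrow> 'k \<Rightarrow> 'k \<Rightarrow> 'k \<Rightarrow> 'k \<Rightarrow> 'k"
  where "hankel3 s0 s1 s2 s3 s4 = (s0 * s2 - s1^2) * s4 - s0 * s3^2 + 2 * s1 * s2 * s3 - s2^3"

text \<open>The discriminant of the quadratic polynomial whose coefficients are the cross product of
  (s0, s1, s2) and (s1, s2, s3), which is the quadratic apolar to s0, ..., s3. Its leading
  coefficient is \<open>hankel2\<close>.\<close>

definition hankel_disc :: "'k::comm_ring_1 \<Rightarrow> 'k \<Rightarrow> 'k \<Rightarrow> 'k \<Rightarrow> 'k"
  where "hankel_disc s0 s1 s2 s3 =
    (s1 * s2 - s0 * s3)^2 - 4 * (s1 * s3 - s2^2) * (s0 * s2 - s1^2)"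

text \<open>With an invertible Hankel matrix there is exactly one monic apolar cubic for each s5,
  and it depends affinely on s5. So these cubics form a pencil, which is squarefree for almost all
  s5.\<close>

lemma gen_brank_hankel3:
  fixes s0 :: "'k::{alg_closed_field, field_char_0}"
  assumes D: "hankel3 s0 s1 s2 s3 s4 \<noteq> 0"
  shows "gen_brank 3 s0 s1 s2 s3 s4"
proof -
  define d where "d = hankel3 s0 s1 s2 s3 s4"
  have d0: "d \<noteq> 0" using D by (simp add: d_def)
  \<comment> \<open>The witnesses are the entries of the adjugate matrix applied to (a, b, c),
    divided by the determinant.\<close>
  have sol: "\<exists>x y z. x * s0 + y * s1 + z * s2 = a \<and> x * s1 + y * s2 + z * s3 = b \<and> x * s2 + y * s3 + z * s4 = c" for a b c
  proof (intro exI conjI)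
    let ?x = "(a * (s2 * s4 - s3^2) + b * (s2 * s3 - s1 * s4) + c * (s1 * s3 - s2^2)) / d"
    let ?y = "(a * (s2 * s3 - s1 * s4) + b * (s0 * s4 - s2^2) + c * (s1 * s2 - s0 * s3)) / d"
    let ?z = "(a * (s1 * s3 - s2^2) + b * (s1 * s2 - s0 * s3) + c * (s0 * s2 - s1^2)) / d"
    have e: "X / d * p + Y / d * q + Z / d * r = (X * p + Y * q + Z * r) / d" for X Y Z p q r
      by (simp add: add_divide_distrib)
    show "?x * s0 + ?y * s1 + ?z * s2 = a" unfolding e unfolding nonzero_divide_eq_eq[OF d0] unfolding d_def hankel3_def
      by (simp add: algebra_simps power2_eq_square power3_eq_cube)
    show "?x * s1 + ?y * s2 + ?z * s3 = b" unfolding e unfolding nonzero_divide_eq_eq[OF d0] unfolding d_def hankel3_def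
      by (simp add: algebra_simps power2_eq_square power3_eq_cube)
    show "?x * s2 + ?y * s3 + ?z * s4 = c" unfolding e unfolding nonzero_divide_eq_eq[OF d0] unfolding d_def hankel3_def
      by (simp add: algebra_simps power2_eq_square power3_eq_cube)
  qed
  \<comment> \<open>A is the apolar cubic for s5 = 0, and B is its rate of change: for a given s5
    the cubic is A - s5 B, the member of the pencil with parameter -s5.\<close>
  obtain u0 u1 u2 where u: "u0 * s0 + u1 * s1 + u2 * s2 = - s3" "u0 * s1 + u1 * s2 + u2 * s3 = - s4"
    "u0 * s2 + u1 * s3 + u2 * s4 = 0" using sol by blast
  obtain w0 w1 w2 where w: "w0 * s0 + w1 * s1 + w2 * s2 = 0" "w0 * s1 + w1 * s2 + w2 * s3 = 0"
    "w0 * s2 + w1 * s3 + w2 * s4 = 1" using sol by blast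
  let ?A = "[:u0, u1, u2, 1:]" and ?B = "[:w0, w1, w2:]"
  have nd: "\<not> (double_root ?A r \<and> double_root ?B r)" for r
  proof
    assume h: "double_root ?A r \<and> double_root ?B r"
    from double_root_poly[of ?A r] h
    have a: "u0 + r * (u1 + r * (u2 + r)) = 0" "u1 = - 2 * r * u2 - 3 * r^2"
      by (auto simp: pderiv_pCons algebra_simps power2_eq_square eq_neg_iff_add_eq_0 eq_diff_eq)
    then have a0: "u0 = u2 * r^2 + 2 * r^3" by (simp add: algebra_simps power2_eq_square power3_eq_cube eq_neg_iff_add_eq_0)
    from double_root_poly[of ?B r] h
    have b: "w0 + r * (w1 + r * w2) = 0" "w1 = - 2 * r * w2"
      by (auto simp: pderiv_pCons algebra_simps eq_neg_iff_add_eq_0)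
    then have b0: "w0 = r^2 * w2" by (simp add: algebra_simps power2_eq_square)
    \<comment> \<open>A common double root r means B = w2 (X - r)^2 and A = (X - r)^2 (X + u2 + 2
      r), so w2 A = (X + u2 + 2 r) B. Applied to the moments shifted by one, this reads 0 =
      1.\<close>
    have "w2 * (u0 * s1 + u1 * s2 + u2 * s3 + s4) =
        (w0 * s2 + w1 * s3 + w2 * s4) + (u2 + 2 * r) * (w0 * s1 + w1 * s2 + w2 * s3)"
      unfolding a0 a(2) b0 b(2) by (simp add: algebra_simps power2_eq_square power3_eq_cube)
    then show False using u w by simp
  qed
  define X where "X = {t. \<exists>r. double_root (?A + smult t ?B) r}"
  have fX: "finite X" unfolding X_def by (rule pencil_squarefree) (rule nd)
  show ?thesis
  proof (rule gen_brank_finite[of "uminus ` X"])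
    show "finite (uminus ` X)" using fX by simp
    fix s5 assume s5: "s5 \<notin> uminus ` X"
    then have "- s5 \<notin> X" by force
    then have "\<not> double_root [:u0 - s5 * w0, u1 - s5 * w1, u2 - s5 * w2, 1:] r" for r
      by (auto simp: X_def)
    then show "brank 3 ((!) [s0, s1, s2, s3, s4, s5])"
    proof (rule brank_cubic)
      have "(u0 - s5 * w0) * a + (u1 - s5 * w1) * b + (u2 - s5 * w2) * c + e =
        (u0 * a + u1 * b + u2 * c + e) - s5 * (w0 * a + w1 * b + w2 * c)" for a b c e
        by (simp add: algebra_simps)
      note e = this
      show "(u0 - s5 * w0) * s0 + (u1 - s5 * w1) * s1 + (u2 - s5 * w2) * s2 + s3 = 0" unfolding e u w by simp
      show "(u0 - s5 * w0) * s1 + (u1 - s5 * w1) * s2 + (u2 - s5 * w2) * s3 + s4 = 0" unfolding e u w by simp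
      show "(u0 - s5 * w0) * s2 + (u1 - s5 * w1) * s3 + (u2 - s5 * w2) * s4 + s5 = 0" unfolding e u w by simp
    qed
  qed
qed

text \<open>Two nodes reproduce s0, ..., s4, and the node at infinity takes care of any s5.\<close>

lemma gen_brank_quadratic:
  fixes s0 :: "'k::alg_closed_field"
  assumes "c2 \<noteq> 0" "\<And>r. \<not> double_root [:c0, c1, c2:] r"
    and "c0 * s0 + c1 * s1 + c2 * s2 = 0" "c0 * s1 + c1 * s2 + c2 * s3 = 0" "c0 * s2 + c1 * s3 + c2 * s4 = 0"
  shows "gen_brank 3 s0 s1 s2 s3 s4"
proof (rule gen_brank_all)
  fix s5
  have "\<exists>t. brank 2 t \<and> (\<forall>j\<le>4. t j = [s0, s1, s2, s3, s4, s5] ! j)"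
  proof (rule quadratic_quadrature[OF assms(1,2)])
    fix j :: nat assume "j + 2 \<le> 4"
    then consider "j = 0" | "j = 1" | "j = 2" by fastforce
    then show "c0 * [s0, s1, s2, s3, s4, s5] ! j + c1 * [s0, s1, s2, s3, s4, s5] ! (j + 1) + c2 * [s0, s1, s2, s3, s4, s5] ! (j + 2) = 0"
      using assms(3-5) by cases (auto simp: eval_nat_numeral)
  qed
  then obtain t where t: "brank 2 t" "\<And>j. j \<le> 4 \<Longrightarrow> [s0, s1, s2, s3, s4, s5] ! j = t j" by force
  show "brank 3 ((!) [s0, s1, s2, s3, s4, s5])" using brank_Suc_infinity[OF t] by (simp add: eval_nat_numeral)
qed

text \<open>If the catalecticant vanishes, the quadratic apolar to s0, ..., s3 is also apolar to the
  third row, because that pairing is the determinant itself.\<close>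

lemma gen_brank_disc:
  fixes s0 :: "'k::{alg_closed_field, field_char_0}"
  assumes "hankel2 s0 s1 s2 \<noteq> 0" "hankel_disc s0 s1 s2 s3 \<noteq> 0"
  shows "gen_brank 3 s0 s1 s2 s3 s4"
proof (cases "hankel3 s0 s1 s2 s3 s4 = 0")
  case False then show ?thesis by (rule gen_brank_hankel3)
next
  case True
  show ?thesis
  proof (rule gen_brank_quadratic[of "s0 * s2 - s1^2" "s1 * s3 - s2^2" "s1 * s2 - s0 * s3"])
    show "s0 * s2 - s1^2 \<noteq> 0" using assms by (simp add: hankel2_def)
    show "\<not> double_root [:s1 * s3 - s2^2, s1 * s2 - s0 * s3, s0 * s2 - s1^2:] r" for r
      by (rule disc_no_double_root) (use assms in \<open>simp add: hankel_disc_def\<close>)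
    show "(s1 * s3 - s2^2) * s2 + (s1 * s2 - s0 * s3) * s3 + (s0 * s2 - s1^2) * s4 = 0"
      using True by (simp add: hankel3_def algebra_simps power2_eq_square power3_eq_cube)
  qed (simp_all add: algebra_simps power2_eq_square)
qed

lemma brank_2_disc:
  fixes s0 :: "'k::{alg_closed_field, field_char_0}"
  assumes "hankel2 s0 s1 s2 \<noteq> 0" "hankel_disc s0 s1 s2 s3 \<noteq> 0"
  shows "\<exists>s4 s5. brank 2 ((!) [s0, s1, s2, s3, s4, s5])"
proof -
  have "\<exists>t. brank 2 t \<and> (\<forall>j\<le>3. t j = [s0, s1, s2, s3] ! j)"
  proof (rule quadratic_quadrature[of "s0 * s2 - s1^2" "s1 * s3 - s2^2" "s1 * s2 - s0 * s3"])
    show "s0 * s2 - s1^2 \<noteq> 0" using assms by (simp add: hankel2_def)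
    show "\<not> double_root [:s1 * s3 - s2^2, s1 * s2 - s0 * s3, s0 * s2 - s1^2:] r" for r
      by (rule disc_no_double_root) (use assms in \<open>simp add: hankel_disc_def\<close>)
    fix j :: nat assume "j + 2 \<le> 3"
    then consider "j = 0" | "j = 1" by fastforce
    then show "(s1 * s3 - s2^2) * [s0, s1, s2, s3] ! j + (s1 * s2 - s0 * s3) * [s0, s1, s2, s3] ! (j + 1) + (s0 * s2 - s1^2) * [s0, s1, s2, s3] ! (j + 2) = 0"
      by cases (auto simp: eval_nat_numeral algebra_simps)
  qed
  then obtain t where t: "brank 2 t" "\<And>j. j \<le> 3 \<Longrightarrow> t j = [s0, s1, s2, s3] ! j" by blast
  have "t j = [s0, s1, s2, s3, t 4, t 5] ! j" if j: "j \<le> 5" for j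
  proof -
    consider "j = 0" | "j = 1" | "j = 2" | "j = 3" | "j = 4" | "j = 5" using j by linarith
    then show ?thesis using t(2)[of j] by cases auto
  qed
  then have "brank 2 ((!) [s0, s1, s2, s3, t 4, t 5])" by (rule brank_cong[OF t(1)])
  then show ?thesis by blast
qed

text \<open>When the catalecticant vanishes there is an apolar quadratic form. Its roots may be two
  simple finite ones, one double finite one, one finite and one infinite, or infinity twice. The
  last three shapes determine the moments up to a few constants, and an explicit pencil of apolar
  quartics yields a squarefree one.\<close>

lemma gen_brank_4:
  fixes s0 :: "'k::{alg_closed_field, field_char_0}"
  assumes nz: "\<not> (s0 = 0 \<and> s1 = 0 \<and> s2 = 0 \<and> s3 = 0)"
  shows "gen_brank 4 s0 s1 s2 s3 s4"
proof (cases "hankel3 s0 s1 s2 s3 s4 = 0")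
  case False then show ?thesis using gen_brank_hankel3 gen_brank_mono by fastforce
next
  case True
  have "s0 * (s2 * s4 - s3 * s3) - s1 * (s1 * s4 - s3 * s2) + s2 * (s1 * s3 - s2 * s2) = 0"
    using True by (simp add: hankel3_def algebra_simps power2_eq_square power3_eq_cube)
  from kernel3[OF this] obtain c0 c1 c2 where c: "\<not> (c0 = 0 \<and> c1 = 0 \<and> c2 = 0)"
    "c0 * s0 + c1 * s1 + c2 * s2 = 0" "c0 * s1 + c1 * s2 + c2 * s3 = 0" "c0 * s2 + c1 * s3 + c2 * s4 = 0"
    by (metis mult.commute)
  show ?thesis
  proof (cases "c2 = 0")
    case c2: False
    show ?thesis
    proof (cases "\<exists>r. double_root [:c0, c1, c2:] r")
      case False
      then show ?thesis using gen_brank_quadratic[OF c2 _ c(2-4)] gen_brank_mono[of 3 s0 s1 s2 s3 s4 4] by auto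
    next
      case True
      then obtain r where "double_root [:c0, c1, c2:] r" by blast
      from double_root_poly[OF this]
      have "c0 + r * (c1 + r * c2) = 0" and c1: "c1 = - 2 * r * c2"
        by (auto simp: pderiv_pCons eq_neg_iff_add_eq_0 algebra_simps)
      then have c0: "c0 = r^2 * c2" by (simp add: algebra_simps power2_eq_square)
      \<comment> \<open>Let L send X^j to s_j and put y = X - r. The recurrence gives L(1) = s0,
        L(y) = B and L(y^2) = L(y^3) = L(y^4) = 0.\<close>
      define B where "B = s1 - r * s0"
      have s1: "s1 = r * s0 + B" by (simp add: B_def)
      have rec: "x = 2 * r * y - r^2 * z" if "c0 * z + c1 * y + c2 * x = 0" for x y z
      proof -
        have "c2 * (x - (2 * r * y - r^2 * z)) = 0" using that unfolding c0 c1 by (simp add: algebra_simps)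
        then show ?thesis using c2 by simp
      qed
      have s2: "s2 = r^2 * s0 + 2 * r * B" using rec[OF c(2)] s1 by (simp add: algebra_simps power2_eq_square)
      have s3: "s3 = r^3 * s0 + 3 * r^2 * B" using rec[OF c(3)] s1 s2 by (simp add: algebra_simps power2_eq_square power3_eq_cube)
      have s4: "s4 = r^4 * s0 + 4 * r^3 * B" using rec[OF c(4)] s2 s3 by (simp add: algebra_simps power2_eq_square power3_eq_cube power4_eq_xxxx)
      show ?thesis
      proof (cases "B = 0")
        case True
        have "gen_brank 2 s0 s1 s2 s3 s4"
        proof (rule gen_brank_all)
          fix s5
          show "brank 2 ((!) [s0, s1, s2, s3, s4, s5])"
            using brank_Suc_list[OF brank_1_geometric[of s0 r], of s5] True s1 s2 s3 s4
            by (simp add: mult.commute eval_nat_numeral)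
        qed
        then show ?thesis by (rule gen_brank_mono) simp
      next
        case B: False
        show ?thesis
        \<comment> \<open>The excluded value makes e = 0; then a0 below would vanish, and all
          quartics of the pencil would have the double root r.\<close>
        proof (rule gen_brank_finite[of "{r^5 * s0 + 5 * r^4 * B}"])
          fix s5 assume s5: "s5 \<notin> {r^5 * s0 + 5 * r^4 * B}"
          define e where "e = s5 - (r^5 * s0 + 5 * r^4 * B)"
          have e0: "e \<noteq> 0" and s5e: "s5 = r^5 * s0 + 5 * r^4 * B + e" using s5 by (auto simp: e_def)
          \<comment> \<open>Here L(y^5) = e. For P = y^4 + a1 y + a0 + t y^2 the conditions L(P) =
            L(y P) = 0 read a0 s0 + a1 B = 0 and a0 B + e = 0, for every t. As a0 is nonzero, P
            avoids the root r of y^2.\<close>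
          define a0 where "a0 = - e / B"
          define a1 where "a1 = e * s0 / B^2"
          have a: "a0 * B = - e" "a1 * B = - a0 * s0" "a0 \<noteq> 0" using B e0 by (auto simp: a0_def a1_def power2_eq_square)
          let ?y = "[:-r, 1:]"
          let ?P = "?y^4 + smult a1 ?y + [:a0:]"
          have "\<not> (double_root ?P x \<and> double_root (?y^2) x)" for x
          proof
            assume h: "double_root ?P x \<and> double_root (?y^2) x"
            then have "x = r" using double_root_poly[of "?y^2" x] by simp
            then have "poly ?P r = 0" using h double_root_poly by blast
            then show False using a by simp
          qed
          then have "finite {t. \<exists>x. double_root (?P + smult t (?y^2)) x}" by (rule pencil_squarefree)
          from ex_avoid[OF this] obtain t where t: "\<And>x. \<not> double_root (?P + smult t (?y^2)) x" by blast
          have eq: "?P + smult t (?y^2) = [:r^4 - a1 * r + a0 + t * r^2, a1 - 4 * r^3 - 2 * t * r, 6 * r^2 + t, - 4 * r, 1:]"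
            by (simp add: eval_nat_numeral algebra_simps)
          show "brank 4 ((!) [s0, s1, s2, s3, s4, s5])"
          proof (rule brank_quartic)
            show "\<not> double_root [:r^4 - a1 * r + a0 + t * r^2, a1 - 4 * r^3 - 2 * t * r, 6 * r^2 + t, - 4 * r, 1:] x" for x
              using t unfolding eq .
            have "(r^4 - a1 * r + a0 + t * r^2) * s0 + (a1 - 4 * r^3 - 2 * t * r) * s1 + (6 * r^2 + t) * s2 + - 4 * r * s3 + s4 = a0 * s0 + a1 * B"
              unfolding s1 s2 s3 s4 by (simp add: algebra_simps eval_nat_numeral)
            then show "(r^4 - a1 * r + a0 + t * r^2) * s0 + (a1 - 4 * r^3 - 2 * t * r) * s1 + (6 * r^2 + t) * s2 + - 4 * r * s3 + s4 = 0"
              using a by simp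
            have "(r^4 - a1 * r + a0 + t * r^2) * s1 + (a1 - 4 * r^3 - 2 * t * r) * s2 + (6 * r^2 + t) * s3 + - 4 * r * s4 + s5 = r * (a0 * s0 + a1 * B) + (a0 * B + e)"
              unfolding s1 s2 s3 s4 s5e by (simp add: algebra_simps eval_nat_numeral)
            then show "(r^4 - a1 * r + a0 + t * r^2) * s1 + (a1 - 4 * r^3 - 2 * t * r) * s2 + (6 * r^2 + t) * s3 + - 4 * r * s4 + s5 = 0"
              using a by simp
          qed
        qed simp
      qed
    qed
  next
    case c2: True
    show ?thesis
    proof (cases "c1 = 0")
      case False
      define r where "r = - c0 / c1"
      have rec: "y = r * z" if "c0 * z + c1 * y + c2 * x = 0" for x y z
      proof -
        have "c1 * y = c1 * (r * z)" using that c2 False by (simp add: r_def add_eq_0_iff)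
        then show ?thesis using False by simp
      qed
      have s1: "s1 = r * s0" using rec[OF c(2)] .
      have s2: "s2 = r^2 * s0" using rec[OF c(3)] s1 by (simp add: power2_eq_square)
      have s3: "s3 = r^3 * s0" using rec[OF c(4)] s2 by (simp add: power2_eq_square power3_eq_cube)
      have s0: "s0 \<noteq> 0" using nz s1 s2 s3 by auto
      \<comment> \<open>In terms of y = X - r: L(1) = s0, L(y) = L(y^2) = L(y^3) = 0 and L(y^4) =
        e.\<close>
      define e where "e = s4 - r^4 * s0"
      have s4: "s4 = r^4 * s0 + e" by (simp add: e_def)
      show ?thesis
      proof (cases "e = 0")
        case True
        have "gen_brank 2 s0 s1 s2 s3 s4"
        proof (rule gen_brank_all)
          fix s5
          show "brank 2 ((!) [s0, s1, s2, s3, s4, s5])"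
            using brank_Suc_list[OF brank_1_geometric[of s0 r], of s5] True s1 s2 s3 s4
            by (simp add: mult.commute eval_nat_numeral)
        qed
        then show ?thesis by (rule gen_brank_mono) simp
      next
        case e0: False
        show ?thesis
        proof (rule gen_brank_all)
          fix s5
          \<comment> \<open>f is L(y^5). For P = y^4 + a3 y^3 + a0 + t y^2 the two conditions are a0
            s0 + e = 0 and a3 e + f = 0, again for every t.\<close>
          define f where "f = s5 - r^5 * s0 - 5 * r * e"
          have s5e: "s5 = r^5 * s0 + 5 * r * e + f" by (simp add: f_def)
          define a0 where "a0 = - e / s0"
          define a3 where "a3 = - f / e"
          have a: "a0 * s0 = - e" "a3 * e = - f" "a0 \<noteq> 0" using s0 e0 by (auto simp: a0_def a3_def)
          let ?y = "[:-r, 1:]"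
          let ?P = "?y^4 + smult a3 (?y^3) + [:a0:]"
          have "\<not> (double_root ?P x \<and> double_root (?y^2) x)" for x
          proof
            assume h: "double_root ?P x \<and> double_root (?y^2) x"
            then have "x = r" using double_root_poly[of "?y^2" x] by simp
            then have "poly ?P r = 0" using h double_root_poly by blast
            then show False using a by simp
          qed
          then have "finite {t. \<exists>x. double_root (?P + smult t (?y^2)) x}" by (rule pencil_squarefree)
          from ex_avoid[OF this] obtain t where t: "\<And>x. \<not> double_root (?P + smult t (?y^2)) x" by blast
          have eq: "?P + smult t (?y^2) = [:r^4 - a3 * r^3 + a0 + t * r^2, 3 * a3 * r^2 - 4 * r^3 - 2 * t * r, 6 * r^2 - 3 * a3 * r + t, a3 - 4 * r, 1:]"
            by (simp add: eval_nat_numeral algebra_simps)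
          show "brank 4 ((!) [s0, s1, s2, s3, s4, s5])"
          proof (rule brank_quartic)
            show "\<not> double_root [:r^4 - a3 * r^3 + a0 + t * r^2, 3 * a3 * r^2 - 4 * r^3 - 2 * t * r, 6 * r^2 - 3 * a3 * r + t, a3 - 4 * r, 1:] x" for x
              using t unfolding eq .
            have "(r^4 - a3 * r^3 + a0 + t * r^2) * s0 + (3 * a3 * r^2 - 4 * r^3 - 2 * t * r) * s1 + (6 * r^2 - 3 * a3 * r + t) * s2 + (a3 - 4 * r) * s3 + s4 = a0 * s0 + e"
              unfolding s1 s2 s3 s4 by (simp add: algebra_simps eval_nat_numeral)
            then show "(r^4 - a3 * r^3 + a0 + t * r^2) * s0 + (3 * a3 * r^2 - 4 * r^3 - 2 * t * r) * s1 + (6 * r^2 - 3 * a3 * r + t) * s2 + (a3 - 4 * r) * s3 + s4 = 0"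
              using a by simp
            have "(r^4 - a3 * r^3 + a0 + t * r^2) * s1 + (3 * a3 * r^2 - 4 * r^3 - 2 * t * r) * s2 + (6 * r^2 - 3 * a3 * r + t) * s3 + (a3 - 4 * r) * s4 + s5 = r * (a0 * s0 + e) + (a3 * e + f)"
              unfolding s1 s2 s3 s4 s5e by (simp add: algebra_simps eval_nat_numeral)
            then show "(r^4 - a3 * r^3 + a0 + t * r^2) * s1 + (3 * a3 * r^2 - 4 * r^3 - 2 * t * r) * s2 + (6 * r^2 - 3 * a3 * r + t) * s3 + (a3 - 4 * r) * s4 + s5 = 0"
              using a by simp
          qed
        qed
      qed
    next
      case True
      then have z: "s0 = 0" "s1 = 0" "s2 = 0" using c c2 by auto
      then have s3: "s3 \<noteq> 0" using nz by auto
      show ?thesis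
      proof (rule gen_brank_all)
        fix s5
        \<comment> \<open>Since s0 and s1 vanish, the constant coefficient t of the quartic is free;
          a3 and a2 solve the two conditions, which are triangular because s3 is nonzero.\<close>
        define a3 where "a3 = - s4 / s3"
        define a2 where "a2 = - (a3 * s4 + s5) / s3"
        have a: "a3 * s3 = - s4" "a2 * s3 = - (a3 * s4 + s5)" using s3 by (auto simp: a3_def a2_def)
        have "\<not> (double_root [:0, 0, a2, a3, 1:] x \<and> double_root 1 x)" for x
          using double_root_poly[of 1 x] by auto
        then have "finite {t. \<exists>x. double_root ([:0, 0, a2, a3, 1:] + smult t 1) x}" by (rule pencil_squarefree)
        from ex_avoid[OF this] obtain t where t: "\<And>x. \<not> double_root ([:0, 0, a2, a3, 1:] + smult t 1) x" by blast
        have eq: "[:0, 0, a2, a3, 1:] + smult t 1 = [:t, 0, a2, a3, 1:]" by (simp add: one_pCons)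
        show "brank 4 ((!) [s0, s1, s2, s3, s4, s5])"
          by (rule brank_quartic[of t 0 a2 a3]) (use t a in \<open>simp_all add: eq z\<close>)
      qed
    qed
  qed
qed

text \<open>X - r is apolar to the pair (s0, s1), so a multiple of it can be added to any apolar
  quintic; being linear it has no double root, and a squarefree member of the pencil exists. Only s0
  has to be nonzero, since it is used to solve for a constant coefficient.\<close>

lemma brank_5:
  fixes s0 :: "'k::{alg_closed_field, field_char_0}"
  assumes s0: "s0 \<noteq> 0"
  shows "brank 5 ((!) [s0, s1, s2, s3, s4, s5])"
proof -
  define r where "r = s1 / s0"
  have s1: "s1 = s0 * r" using s0 by (simp add: r_def)
  show ?thesis
  proof (cases "s5 = s0 * r^5 \<and> s4 = s0 * r^4 \<and> s3 = s0 * r^3 \<and> s2 = s0 * r^2")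
    case True
    then show ?thesis using brank_mono[OF brank_1_geometric[of s0 r], of 5] s1 by simp
  next
    case False
    have "\<exists>a2 a3 a4. s5 - s0 * r^5 + a2 * (s2 - s0 * r^2) + a3 * (s3 - s0 * r^3) + a4 * (s4 - s0 * r^4) \<noteq> 0"
    proof (cases "s5 = s0 * r^5")
      case False then show ?thesis by (intro exI[of _ 0]) simp
    next
      case s5: True
      then consider "s2 - s0 * r^2 \<noteq> 0" | "s3 - s0 * r^3 \<noteq> 0" | "s4 - s0 * r^4 \<noteq> 0" using False by auto
      then show ?thesis
      proof cases
        case 1 then show ?thesis using s5 by (intro exI[of _ 1] exI[of _ 0]) simp
      next
        case 2 then show ?thesis using s5 by (intro exI[of _ 0] exI[of _ 1] exI[of _ 0]) simp
      next
        case 3 then show ?thesis using s5 by (intro exI[of _ 0] exI[of _ 0] exI[of _ 1]) simp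
      qed
    qed
    then obtain a2 a3 a4 where a: "s5 - s0 * r^5 + a2 * (s2 - s0 * r^2) + a3 * (s3 - s0 * r^3) + a4 * (s4 - s0 * r^4) \<noteq> 0"
      by blast
    define a0 where "a0 = - (s5 + a2 * s2 + a3 * s3 + a4 * s4) / s0"
    have a0: "a0 * s0 = - (s5 + a2 * s2 + a3 * s3 + a4 * s4)" using s0 by (simp add: a0_def)
    let ?A = "[:a0, 0, a2, a3, a4, 1:]" and ?B = "[:-r, 1:]"
    have "\<not> (double_root ?A x \<and> double_root ?B x)" for x
      using double_root_poly[of ?B x] by (auto simp: pderiv_pCons)
    then have "finite {t. \<exists>x. double_root (?A + smult t ?B) x}" by (rule pencil_squarefree)
    from ex_avoid[OF this] obtain t where t: "\<And>x. \<not> double_root (?A + smult t ?B) x" by blast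
    have eq: "?A + smult t ?B = [:a0 - t * r, t, a2, a3, a4, 1:]" by simp
    show ?thesis
    proof (rule brank_quintic)
      show "\<not> double_root [:a0 - t * r, t, a2, a3, a4, 1:] x" for x using t unfolding eq .
      show "(a0 - t * r) * s0 + t * s1 + a2 * s2 + a3 * s3 + a4 * s4 + s5 = 0"
        using a0 by (simp add: s1 algebra_simps)
    qed
  qed
qed

text \<open>The four moments are s0 r^j with s0 nonzero, so that suitable s4 and s5 make the quintic
  a single fifth power.\<close>

definition special :: "'k::field \<Rightarrow> 'k \<Rightarrow> 'k \<Rightarrow> 'k \<Rightarrow> bool"
  where "special s0 s1 s2 s3 \<longleftrightarrow> s0 \<noteq> 0 \<and> hankel2 s0 s1 s2 = 0 \<and> s0^2 * s3 = s1^3"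

lemma special_geometric:
  assumes "special s0 s1 s2 s3"
  shows "\<exists>r. s1 = s0 * r \<and> s2 = s0 * r^2 \<and> s3 = s0 * r^3"
proof -
  have s0: "s0 \<noteq> 0" and h: "s0 * s2 = s1^2" "s0^2 * s3 = s1^3"
    using assms by (auto simp: special_def hankel2_def)
  define r where "r = s1 / s0"
  have s1: "s1 = s0 * r" using s0 by (simp add: r_def)
  have "s0 * s2 = s0 * (s0 * r^2)" using h(1) by (simp add: s1 power2_eq_square algebra_simps)
  moreover have "s0^2 * s3 = s0^2 * (s0 * r^3)" using h(2) by (simp add: s1 power2_eq_square power3_eq_cube algebra_simps)
  ultimately show ?thesis using s0 s1 by auto
qed

lemma special_brank:
  fixes s0 :: "'k::{alg_closed_field, field_char_0}"
  assumes "special s0 s1 s2 s3"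
  shows "\<exists>s4 s5. brank 1 ((!) [s0, s1, s2, s3, s4, s5])" "\<exists>s4. gen_brank 2 s0 s1 s2 s3 s4"
proof -
  obtain r where r: "s1 = s0 * r" "s2 = s0 * r^2" "s3 = s0 * r^3" using special_geometric[OF assms] by blast
  have b: "brank 1 ((!) [s0, s1, s2, s3, s0 * r^4, s0 * r^5])" using brank_1_geometric[of s0 r] r by simp
  then show "\<exists>s4 s5. brank 1 ((!) [s0, s1, s2, s3, s4, s5])" by blast
  have "gen_brank 2 s0 s1 s2 s3 (s0 * r^4)"
    by (rule gen_brank_all) (use brank_Suc_list[OF b] in \<open>simp add: eval_nat_numeral\<close>)
  then show "\<exists>s4. gen_brank 2 s0 s1 s2 s3 s4" by blast
qed

text \<open>If s0 s2 = s1^2, then s0^3 times the catalecticant is minus the square of s0^2 s3 -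
  s1^3. If s0 = 0, then s1 = 0 and the catalecticant is - s2^3.\<close>

lemma hankel3_degenerate:
  fixes s0 :: "'k::field"
  assumes "hankel2 s0 s1 s2 = 0" "\<not> special s0 s1 s2 s3" "\<not> (s0 = 0 \<and> s1 = 0 \<and> s2 = 0)"
  shows "hankel3 s0 s1 s2 s3 s4 \<noteq> 0"
proof (cases "s0 = 0")
  case True
  then have "s1 = 0" using assms(1) by (simp add: hankel2_def)
  then show ?thesis using True assms(3) by (simp add: hankel3_def)
next
  case False
  have ne: "s0^2 * s3 \<noteq> s1^3" using assms False by (simp add: special_def)
  have h: "s0 * s2 = s1^2" using assms(1) by (simp add: hankel2_def)
  have "s0^3 * hankel3 s0 s1 s2 s3 s4 =
      s0^3 * s4 * (s0 * s2 - s1^2) - s0^4 * s3^2 + 2 * s0^2 * s1 * s3 * (s0 * s2) - (s0 * s2)^3"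
    by (simp add: hankel3_def algebra_simps eval_nat_numeral)
  also have "\<dots> = - ((s0^2 * s3 - s1^3)^2)" unfolding h by (simp add: algebra_simps eval_nat_numeral)
  finally have "s0^3 * hankel3 s0 s1 s2 s3 s4 \<noteq> 0" using ne by simp
  then show ?thesis by auto
qed

text \<open>The hypotheses involve only s0, ..., s3, so rank 3 is generic whatever s4 is, and s4 can
  be used to satisfy other equations.\<close>

lemma strong_generic:
  fixes s0 :: "'k::{alg_closed_field, field_char_0}"
  assumes "\<not> (s0 = 0 \<and> s1 = 0 \<and> s2 = 0)" "\<not> special s0 s1 s2 s3"
    and "\<not> (hankel2 s0 s1 s2 \<noteq> 0 \<and> hankel_disc s0 s1 s2 s3 = 0)"
  shows "gen_brank 3 s0 s1 s2 s3 s4"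
proof (cases "hankel2 s0 s1 s2 = 0")
  case True
  show ?thesis by (rule gen_brank_hankel3, rule hankel3_degenerate) (fact True assms)+
next
  case False
  then show ?thesis using assms(3) gen_brank_disc by blast
qed

lemma finite_exceptional:
  fixes s0 :: "'k::field_char_0"
  assumes "\<not> (s0 = 0 \<and> s1 = 0 \<and> s2 = 0)"
  shows "finite {s3. special s0 s1 s2 s3 \<or> (hankel2 s0 s1 s2 \<noteq> 0 \<and> hankel_disc s0 s1 s2 s3 = 0)}"
proof (cases "hankel2 s0 s1 s2 = 0")
  case True
  have "{s3. special s0 s1 s2 s3 \<or> (hankel2 s0 s1 s2 \<noteq> 0 \<and> hankel_disc s0 s1 s2 s3 = 0)} \<subseteq> {s1^3 / s0^2}"
    using True by (auto simp: special_def nonzero_eq_divide_eq mult.commute)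
  then show ?thesis using finite_subset by blast
next
  case False
  let ?p = "[:s1^2 * s2^2 + 4 * s2^2 * hankel2 s0 s1 s2, - 2 * s0 * s1 * s2 - 4 * s1 * hankel2 s0 s1 s2, s0^2:]"
  have "hankel_disc s0 s1 s2 s3 = poly ?p s3" for s3
    by (simp add: hankel_disc_def hankel2_def algebra_simps power2_eq_square)
  moreover have "?p \<noteq> 0"
  proof (cases "s0 = 0")
    case True
    \<comment> \<open>For s0 = 0 the quadratic degenerates to a polynomial with linear coefficient 4
      s1^3.\<close>
    then have "s1 \<noteq> 0" using False by (simp add: hankel2_def)
    then show ?thesis using True by (simp add: hankel2_def)
  qed simp
  then have "finite {s3. poly ?p s3 = 0}" by (rule poly_roots_finite)
  ultimately have "finite {s3. hankel_disc s0 s1 s2 s3 = 0}" by simp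
  then show ?thesis by (rule finite_subset[rotated]) (use False in \<open>auto simp: special_def\<close>)
qed

text \<open>Outside the special case s4 can be chosen with nonzero catalecticant: this is automatic
  if \<open>hankel2\<close> is 0, and otherwise the catalecticant is affine in s4 with slope
  \<open>hankel2\<close>.\<close>

lemma ex_brank_3:
  fixes s0 :: "'k::{alg_closed_field, field_char_0}"
  assumes nz: "\<not> (s0 = 0 \<and> s1 = 0 \<and> s2 = 0)"
  shows "\<exists>s4 s5. brank 3 ((!) [s0, s1, s2, s3, s4, s5])"
proof -
  have "\<exists>s4. gen_brank 3 s0 s1 s2 s3 s4"
  proof (cases "special s0 s1 s2 s3")
    case True
    then obtain s4 where "gen_brank 2 s0 s1 s2 s3 s4" using special_brank(2) by blast
    then have "gen_brank 3 s0 s1 s2 s3 s4" by (rule gen_brank_mono) simp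
    then show ?thesis by blast
  next
    case ns: False
    have "\<exists>s4. hankel3 s0 s1 s2 s3 s4 \<noteq> 0"
    proof (cases "hankel2 s0 s1 s2 = 0")
      case True then show ?thesis using hankel3_degenerate[OF True ns nz] by blast
    next
      case False
      have "hankel3 s0 s1 s2 s3 1 - hankel3 s0 s1 s2 s3 0 = hankel2 s0 s1 s2"
        by (simp add: hankel3_def hankel2_def)
      then have "hankel3 s0 s1 s2 s3 1 \<noteq> 0 \<or> hankel3 s0 s1 s2 s3 0 \<noteq> 0" using False by auto
      then show ?thesis by blast
    qed
    then show ?thesis using gen_brank_hankel3 by blast
  qed
  then obtain s4 where "finite {s5. \<not> brank 3 ((!) [s0, s1, s2, s3, s4, s5])}" unfolding gen_brank_def by blast
  from ex_avoid[OF this] show ?thesis by blast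
qed

lemma finite_hankel3_zero:
  fixes s0 :: "'k::field_char_0"
  assumes "s0 \<noteq> 0" "\<not> special s0 s1 s2 s3"
  shows "finite {s4. hankel3 s0 s1 s2 s3 s4 = 0}"
proof (cases "hankel2 s0 s1 s2 = 0")
  case True then show ?thesis using hankel3_degenerate[OF True assms(2)] assms(1) by simp
next
  case False
  let ?p = "[:- s0 * s3^2 + 2 * s1 * s2 * s3 - s2^3, hankel2 s0 s1 s2:]"
  have "hankel3 s0 s1 s2 s3 s4 = poly ?p s4" for s4
    by (simp add: hankel3_def hankel2_def)
  moreover have "finite {s4. poly ?p s4 = 0}" using False by (intro poly_roots_finite) simp
  ultimately show ?thesis by simp
qed

lemma finite_affine_vimage:
  fixes k :: "'k::field"
  assumes "finite A" "k \<noteq> 0"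
  shows "finite {x. a + x * k \<in> A}"
proof -
  have "inj_on (\<lambda>x. a + x * k) {x. a + x * k \<in> A}" using assms(2) by (auto intro: inj_onI)
  moreover have "(\<lambda>x. a + x * k) ` {x. a + x * k \<in> A} \<subseteq> A" by auto
  ultimately show ?thesis by (metis assms(1) inj_on_finite)
qed

subsection \<open>Four concurrent lines\<close>

text \<open>The ternary analogue of \<open>brank\<close>: \<open>m b c\<close> is the value of the
  polarization on 5 - b - c, b and c copies of three basis vectors.\<close>

definition trank :: "nat \<Rightarrow> (nat \<Rightarrow> nat \<Rightarrow> 'k::field) \<Rightarrow> bool"
  where "trank n m \<longleftrightarrow> (\<exists>ts. length ts \<le> n \<and>
    (\<forall>b c. b + c \<le> 5 \<longrightarrow> m b c = (\<Sum>(u, v, w)\<leftarrow>ts. u ^ (5 - b - c) * v ^ b * w ^ c)))"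

lemma trank_mono: "trank n m \<Longrightarrow> n \<le> n' \<Longrightarrow> trank n' m"
  unfolding trank_def by (elim exE conjE, rule exI, rule conjI, rule order_trans)

text \<open>Linear forms (u, z u, w) with fixed z make up one line of forms, and all these lines
  pass through (0, 0, 1). A binary quintic on the line z contributes z^b times its moment number
  c.\<close>

lemma trank_lines:
  fixes S :: "'k::field \<Rightarrow> nat \<Rightarrow> 'k"
  assumes "finite Z" "\<And>z. z \<in> Z \<Longrightarrow> brank (n z) (S z)"
    and "\<And>b c. b + c \<le> 5 \<Longrightarrow> m b c = (\<Sum>z\<in>Z. z ^ b * S z c)"
  shows "trank (\<Sum>z\<in>Z. n z) m"
  using assms
proof (induction Z arbitrary: m rule: finite_induct)
  case empty
  then show ?case unfolding trank_def by (intro exI[of _ "[]"]) simp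
next
  case (insert a Z)
  have "trank (\<Sum>z\<in>Z. n z) (\<lambda>b c. \<Sum>z\<in>Z. z ^ b * S z c)" using insert by auto
  then obtain ts where ts: "length ts \<le> (\<Sum>z\<in>Z. n z)"
    "\<And>b c. b + c \<le> 5 \<Longrightarrow> (\<Sum>z\<in>Z. z ^ b * S z c) = (\<Sum>(u, v, w)\<leftarrow>ts. u ^ (5 - b - c) * v ^ b * w ^ c)"
    unfolding trank_def by blast
  obtain ps where ps: "length ps \<le> n a" "\<And>j. j \<le> 5 \<Longrightarrow> S a j = (\<Sum>(u, w)\<leftarrow>ps. u ^ (5 - j) * w ^ j)"
    using insert.prems(1)[of a] unfolding brank_def by blast
  let ?qs = "map (\<lambda>(u, w). (u, u * a, w)) ps"
  have "m b c = (\<Sum>(u, v, w)\<leftarrow>?qs @ ts. u ^ (5 - b - c) * v ^ b * w ^ c)" if bc: "b + c \<le> 5" for b c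
  proof -
    have e: "u ^ (5 - (b + c)) * (u * a) ^ b * w ^ c = a ^ b * (u ^ (5 - c) * w ^ c)" for u w
    proof -
      have "u ^ (5 - c) = u ^ (5 - (b + c)) * u ^ b" using bc by (simp add: power_add[symmetric])
      then show ?thesis by (simp add: power_mult_distrib algebra_simps)
    qed
    have "(\<Sum>(u, v, w)\<leftarrow>?qs. u ^ (5 - b - c) * v ^ b * w ^ c) = a ^ b * (\<Sum>(u, w)\<leftarrow>ps. u ^ (5 - c) * w ^ c)"
      by (simp add: o_def case_prod_unfold e sum_list_const_mult)
    then show ?thesis
      using insert.prems(2)[OF bc] insert.hyps ts(2)[OF bc] ps(2)[of c] bc by simp
  qed
  moreover have "length (?qs @ ts) \<le> (\<Sum>z\<in>insert a Z. n z)" using ts(1) ps(1) insert.hyps by simp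
  ultimately show ?case unfolding trank_def by (intro exI[of _ "?qs @ ts"] conjI allI impI)
qed

text \<open>Lines i and j choose their last two moments freely. The two equations for c = 4 then fix
  the fourth moments of k and l, hence the assumption for every s4. The single equation for c = 5
  leaves one parameter t, shared between k and l.\<close>

lemma trank_four_lines:
  fixes m :: "nat \<Rightarrow> nat \<Rightarrow> 'k::{alg_closed_field, field_char_0}"
  assumes dist: "distinct [i, j, k, l]"
    and m: "\<And>b c. b + c \<le> 5 \<Longrightarrow> c \<le> 3 \<Longrightarrow> m b c = (\<Sum>z\<in>{i, j, k, l}. z ^ b * A z c)"
    and i: "\<exists>s4 s5. brank ni ((!) [A i 0, A i 1, A i 2, A i 3, s4, s5])"
    and j: "\<exists>s4 s5. brank nj ((!) [A j 0, A j 1, A j 2, A j 3, s4, s5])"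
    and k: "\<And>s4. gen_brank nk (A k 0) (A k 1) (A k 2) (A k 3) s4"
    and l: "\<And>s4. gen_brank nl (A l 0) (A l 1) (A l 2) (A l 3) s4"
    and n: "ni + nj + nk + nl \<le> 10"
  shows "trank 10 m"
proof -
  obtain i4 i5 where i: "brank ni ((!) [A i 0, A i 1, A i 2, A i 3, i4, i5])" using i by blast
  obtain j4 j5 where j: "brank nj ((!) [A j 0, A j 1, A j 2, A j 3, j4, j5])" using j by blast
  define x0 where "x0 = m 0 4 - i4 - j4"
  define x1 where "x1 = m 1 4 - i * i4 - j * j4"
  have kl: "k - l \<noteq> 0" using dist by auto
  define k4 where "k4 = (x1 - l * x0) / (k - l)"
  define l4 where "l4 = x0 - k4"
  have e: "k4 * (k - l) = x1 - l * x0" using kl by (simp add: k4_def)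
  have m4: "m 0 4 = i4 + j4 + k4 + l4" by (simp add: l4_def x0_def)
  have "x1 = k * k4 + l * l4" using e by (simp add: l4_def algebra_simps)
  then have m14: "m 1 4 = i * i4 + j * j4 + k * k4 + l * l4" by (simp add: x1_def algebra_simps)
  let ?c = "m 0 5 - i5 - j5"
  have "finite {t. \<not> brank nk ((!) [A k 0, A k 1, A k 2, A k 3, k4, t])}" using k unfolding gen_brank_def .
  moreover have "finite {t. ?c + t * (-1) \<in> {t. \<not> brank nl ((!) [A l 0, A l 1, A l 2, A l 3, l4, t])}}"
    using l unfolding gen_brank_def by (intro finite_affine_vimage) auto
  ultimately have "finite {t. \<not> brank nk ((!) [A k 0, A k 1, A k 2, A k 3, k4, t]) \<or> \<not> brank nl ((!) [A l 0, A l 1, A l 2, A l 3, l4, ?c - t])}"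
    by (intro finite_Collect_disjI[THEN iffD2] conjI) simp_all
  from ex_avoid[OF this] obtain t where t: "brank nk ((!) [A k 0, A k 1, A k 2, A k 3, k4, t])"
    "brank nl ((!) [A l 0, A l 1, A l 2, A l 3, l4, ?c - t])" by blast
  define S where "S z = (!) [A z 0, A z 1, A z 2, A z 3, if z = i then i4 else if z = j then j4 else if z = k then k4 else l4,
    if z = i then i5 else if z = j then j5 else if z = k then t else ?c - t]" for z
  define N where "N z = (if z = i then ni else if z = j then nj else if z = k then nk else nl)" for z
  have "trank (\<Sum>z\<in>{i, j, k, l}. N z) m"
  proof (rule trank_lines)
    fix z assume "z \<in> {i, j, k, l}"
    then consider "z = i" | "z = j" | "z = k" | "z = l" by blast
    then show "brank (N z) (S z)"
      using i j t dist by cases (auto simp: N_def S_def)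
  next
    fix b c :: nat assume bc: "b + c \<le> 5"
    show "m b c = (\<Sum>z\<in>{i, j, k, l}. z ^ b * S z c)"
    proof (cases "c \<le> 3")
      case True
      then consider "c = 0" | "c = 1" | "c = 2" | "c = 3" by linarith
      then have "S z c = A z c" for z by cases (simp_all add: S_def)
      then show ?thesis using m[OF bc True] by simp
    next
      case False
      then consider "c = 4" "b = 0" | "c = 4" "b = 1" | "c = 5" "b = 0" using bc by linarith
      then show ?thesis using dist m4 m14 by cases (auto simp: S_def)
    qed
  qed simp
  moreover have "(\<Sum>z\<in>{i, j, k, l}. N z) = ni + nj + nk + nl" using dist by (auto simp: N_def)
  ultimately show ?thesis using trank_mono[of _ m 10] n by simp
qed

text \<open>The version for a line that has dropped out: the fourth moments are prescribed, and all
  three lines only need a generic fifth moment.\<close>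

lemma trank_three_lines:
  fixes m :: "nat \<Rightarrow> nat \<Rightarrow> 'k::{alg_closed_field, field_char_0}"
  assumes dist: "distinct [i, j, k]"
    and m: "\<And>b c. b + c \<le> 5 \<Longrightarrow> c \<le> 3 \<Longrightarrow> m b c = (\<Sum>z\<in>{i, j, k}. z ^ b * A z c)"
    and m4: "m 0 4 = i4 + j4 + k4" and m14: "m 1 4 = i * i4 + j * j4 + k * k4"
    and i: "gen_brank ni (A i 0) (A i 1) (A i 2) (A i 3) i4"
    and j: "gen_brank nj (A j 0) (A j 1) (A j 2) (A j 3) j4"
    and k: "gen_brank nk (A k 0) (A k 1) (A k 2) (A k 3) k4"
    and n: "ni + nj + nk \<le> 10"
  shows "trank 10 m"
proof -
  from ex_avoid[OF i[unfolded gen_brank_def]] obtain i5 where i: "brank ni ((!) [A i 0, A i 1, A i 2, A i 3, i4, i5])" by blast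
  let ?c = "m 0 5 - i5"
  have "finite {t. \<not> brank nj ((!) [A j 0, A j 1, A j 2, A j 3, j4, t])}" using j unfolding gen_brank_def .
  moreover have "finite {t. ?c + t * (-1) \<in> {t. \<not> brank nk ((!) [A k 0, A k 1, A k 2, A k 3, k4, t])}}"
    using k unfolding gen_brank_def by (intro finite_affine_vimage) auto
  ultimately have "finite {t. \<not> brank nj ((!) [A j 0, A j 1, A j 2, A j 3, j4, t]) \<or> \<not> brank nk ((!) [A k 0, A k 1, A k 2, A k 3, k4, ?c - t])}"
    by (intro finite_Collect_disjI[THEN iffD2] conjI) simp_all
  from ex_avoid[OF this] obtain t where t: "brank nj ((!) [A j 0, A j 1, A j 2, A j 3, j4, t])"
    "brank nk ((!) [A k 0, A k 1, A k 2, A k 3, k4, ?c - t])" by blast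
  define S where "S z = (!) [A z 0, A z 1, A z 2, A z 3, if z = i then i4 else if z = j then j4 else k4,
    if z = i then i5 else if z = j then t else ?c - t]" for z
  define N where "N z = (if z = i then ni else if z = j then nj else nk)" for z
  have "trank (\<Sum>z\<in>{i, j, k}. N z) m"
  proof (rule trank_lines)
    fix z assume "z \<in> {i, j, k}"
    then consider "z = i" | "z = j" | "z = k" by blast
    then show "brank (N z) (S z)"
      using i t dist by cases (auto simp: N_def S_def)
  next
    fix b c :: nat assume bc: "b + c \<le> 5"
    show "m b c = (\<Sum>z\<in>{i, j, k}. z ^ b * S z c)"
    proof (cases "c \<le> 3")
      case True
      then consider "c = 0" | "c = 1" | "c = 2" | "c = 3" by linarith
      then have "S z c = A z c" for z by cases (simp_all add: S_def)
      then show ?thesis using m[OF bc True] by simp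
    next
      case False
      then consider "c = 4" "b = 0" | "c = 4" "b = 1" | "c = 5" "b = 0" using bc by linarith
      then show ?thesis using dist m4 m14 by cases (auto simp: S_def)
    qed
  qed simp
  moreover have "(\<Sum>z\<in>{i, j, k}. N z) = ni + nj + nk" using dist by (auto simp: N_def)
  ultimately show ?thesis using trank_mono[of _ m 10] n by simp
qed

lemma card4_obtain:
  assumes "card Z = 4" "i \<in> Z" "j \<in> Z" "i \<noteq> j"
  obtains k l where "Z = {i, j, k, l}" "distinct [i, j, k, l]"
proof -
  have "card (Z - {i, j}) = 2" using assms by (simp add: card_Diff_subset)
  then obtain k l where kl: "Z - {i, j} = {k, l}" "k \<noteq> l" by (auto simp: card_2_iff)
  have "Z = {i, j, k, l}" using kl(1) assms by blast
  moreover have "distinct [i, j, k, l]" using kl assms(4) by auto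
  ultimately show ?thesis using that by blast
qed

text \<open>The signed maximal minors of the 3 by 4 Vandermonde matrix span its kernel, and each is
  a nonzero product of differences. This is the direction in which the third moments of the four
  lines can be moved.\<close>

lemma vandermonde_cofactor:
  fixes i :: "'k::idom"
  assumes "distinct [i, j, k, l]"
  shows "\<exists>\<kappa>. (\<forall>z\<in>{i, j, k, l}. \<kappa> z \<noteq> 0) \<and> (\<forall>b\<le>2. (\<Sum>z\<in>{i, j, k, l}. z ^ b * \<kappa> z) = 0)"
proof -
  define \<kappa> where "\<kappa> z = (if z = i then (j - k) * (j - l) * (k - l) else if z = j then - ((i - k) * (i - l) * (k - l))
    else if z = k then (i - j) * (i - l) * (j - l) else - ((i - j) * (i - k) * (j - k)))" for z
  have "\<forall>z\<in>{i, j, k, l}. \<kappa> z \<noteq> 0" using assms by (auto simp: \<kappa>_def)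
  moreover have "(\<Sum>z\<in>{i, j, k, l}. z ^ b * \<kappa> z) = 0" if b: "b \<le> 2" for b :: nat
  proof -
    consider "b = 0" | "b = 1" | "b = 2" using b by linarith
    moreover have "(\<Sum>z\<in>{i, j, k, l}. z ^ b * \<kappa> z) = i ^ b * ((j - k) * (j - l) * (k - l)) - j ^ b * ((i - k) * (i - l) * (k - l))
      + k ^ b * ((i - j) * (i - l) * (j - l)) - l ^ b * ((i - j) * (i - k) * (j - k))"
      using assms by (auto simp: \<kappa>_def)
    ultimately show ?thesis by cases (simp_all add: algebra_simps power2_eq_square)
  qed
  ultimately show ?thesis by blast
qed

text \<open>The moments with c at most 2 are given; x moves all the third moments along the kernel
  vector. A line is exceptional for x if it is special or has vanishing discriminant with nonzero
  \<open>hankel2\<close>. The case distinction decides whether x is taken generic or is tuned to one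
  line.\<close>

theorem trank_concurrent:
  fixes m :: "nat \<Rightarrow> nat \<Rightarrow> 'k::{alg_closed_field, field_char_0}"
  assumes card: "card Z = 4"
    and m: "\<And>b c. b + c \<le> 5 \<Longrightarrow> c \<le> 2 \<Longrightarrow> m b c = (\<Sum>z\<in>Z. z ^ b * A z c)"
    and two: "\<exists>i\<in>Z. \<exists>j\<in>Z. i \<noteq> j \<and> A i 0 \<noteq> 0 \<and> A j 0 \<noteq> 0"
  shows "trank 10 m"
proof -
  have fin: "finite Z" by (rule card_ge_0_finite) (simp add: card)
  obtain \<kappa> where \<kappa>: "\<And>z. z \<in> Z \<Longrightarrow> \<kappa> z \<noteq> 0" "\<And>b. b \<le> 2 \<Longrightarrow> (\<Sum>z\<in>Z. z ^ b * \<kappa> z) = 0"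
  proof -
    obtain i j where ij: "i \<in> Z" "j \<in> Z" "i \<noteq> j" using two by blast
    from card4_obtain[OF card this] obtain k l where Z: "Z = {i, j, k, l}" "distinct [i, j, k, l]" .
    from vandermonde_cofactor[OF Z(2), folded Z(1)] show ?thesis using that by blast
  qed
  obtain d where d: "\<And>b. b < 4 \<Longrightarrow> m b 3 = (\<Sum>z\<in>Z. d z * z ^ b)"
    using vandermonde_solve[OF fin, of "\<lambda>b. m b 3"] card by auto
  define B where "B x z c = (if c = 3 then d z + x * \<kappa> z else A z c)" for x z and c :: nat
  have B3: "B x z 3 = d z + x * \<kappa> z" for x z by (simp add: B_def)
  have B012: "B x z 0 = A z 0" "B x z 1 = A z 1" "B x z 2 = A z 2" for x z by (simp_all add: B_def)
  have mB: "m b c = (\<Sum>z\<in>Z. z ^ b * B x z c)" if bc: "b + c \<le> 5" "c \<le> 3" for b c x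
  proof (cases "c = 3")
    case True
    then have b: "b \<le> 2" using bc by simp
    have "(\<Sum>z\<in>Z. z ^ b * B x z 3) = (\<Sum>z\<in>Z. d z * z ^ b) + x * (\<Sum>z\<in>Z. z ^ b * \<kappa> z)"
      by (simp add: B3 algebra_simps sum.distrib sum_distrib_left)
    then show ?thesis using True d[of b] \<kappa>(2)[OF b] b by simp
  next
    case False
    then show ?thesis using m[of b c] bc by (simp add: B_def)
  qed
  let ?zero = "\<lambda>z. A z 0 = 0 \<and> A z 1 = 0 \<and> A z 2 = 0"
  let ?h = "\<lambda>z. hankel2 (A z 0) (A z 1) (A z 2)"
  let ?sp = "\<lambda>x z. special (A z 0) (A z 1) (A z 2) (d z + x * \<kappa> z)"
  let ?disc = "\<lambda>x z. hankel_disc (A z 0) (A z 1) (A z 2) (d z + x * \<kappa> z)"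
  let ?exc = "\<lambda>x z. ?sp x z \<or> (?h z \<noteq> 0 \<and> ?disc x z = 0)"
  show ?thesis
  proof (cases "\<exists>l\<in>Z. ?zero l")
    case True
    then obtain l where l: "l \<in> Z" "?zero l" by blast
    obtain i j where ij: "i \<in> Z" "j \<in> Z" "i \<noteq> j" "A i 0 \<noteq> 0" "A j 0 \<noteq> 0" using two by blast
    obtain p q where pq: "Z = {i, j, p, q}" "distinct [i, j, p, q]" using card4_obtain[OF card ij(1-3)] by blast
    have "l \<noteq> i" "l \<noteq> j" using l ij by auto
    then have "l = p \<or> l = q" using l pq by blast
    then obtain k where k: "Z = {i, j, k, l}" "distinct [i, j, k, l]"
    proof
      assume "l = p" then show ?thesis using that[of q] pq by auto
    next
      assume "l = q" then show ?thesis using that[of p] pq by auto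
    qed
    \<comment> \<open>With this x the third moment of l vanishes too, and the line l disappears from
      all equations with c at most 3.\<close>
    define x where "x = - d l / \<kappa> l"
    have Bl: "B x l 3 = 0" "B x l 0 = 0" "B x l 1 = 0" "B x l 2 = 0" using l \<kappa>(1)[OF l(1)] by (simp_all add: B_def x_def)
    have mB3: "m b c = (\<Sum>z\<in>{i, j, k}. z ^ b * B x z c)" if bc: "b + c \<le> 5" "c \<le> 3" for b c
    proof -
      consider "c = 0" | "c = 1" | "c = 2" | "c = 3" using bc(2) by linarith
      then have "B x l c = 0" using Bl by cases auto
      then show ?thesis using mB[OF bc, of x] k by simp
    qed
    have dijk: "distinct [i, j, k]" using k by simp
    obtain e where e: "\<And>b. b < 3 \<Longrightarrow> m b 4 = (\<Sum>z\<in>{i, j, k}. e z * z ^ b)"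
      using vandermonde_solve[of "{i, j, k}" "\<lambda>b. m b 4"] dijk by auto
    have e0: "m 0 4 = e i + e j + e k" "m 1 4 = i * e i + j * e j + k * e k"
      using e[of 0] e[of 1] dijk by (simp_all add: mult.commute)
    \<comment> \<open>(j - k, k - i, i - j) spans the kernel of the 2 by 3 Vandermonde matrix, so y
      is the one freedom left in the fourth moments of three lines.\<close>
    have fin3: "trank 10 m" if "gen_brank ni (B x i 0) (B x i 1) (B x i 2) (B x i 3) (e i + y * (j - k))"
      "gen_brank nj (B x j 0) (B x j 1) (B x j 2) (B x j 3) (e j + y * (k - i))"
      "gen_brank nk (B x k 0) (B x k 1) (B x k 2) (B x k 3) (e k + y * (i - j))" "ni + nj + nk \<le> 10" for ni nj nk y
    proof (rule trank_three_lines[OF dijk mB3 _ _ that])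
      show "m 0 4 = e i + y * (j - k) + (e j + y * (k - i)) + (e k + y * (i - j))"
        unfolding e0 by (simp add: algebra_simps)
      show "m 1 4 = i * (e i + y * (j - k)) + j * (e j + y * (k - i)) + k * (e k + y * (i - j))"
        unfolding e0 by (simp add: algebra_simps)
    qed
    have g4: "gen_brank 4 (B x z 0) (B x z 1) (B x z 2) (B x z 3) s4"
      if "\<not> (B x z 0 = 0 \<and> B x z 1 = 0 \<and> B x z 2 = 0 \<and> B x z 3 = 0)" for z s4
      using that by (rule gen_brank_4)
    have g4i: "gen_brank 4 (B x i 0) (B x i 1) (B x i 2) (B x i 3) s4" for s4 by (rule g4) (simp add: B_def ij)
    have g4j: "gen_brank 4 (B x j 0) (B x j 1) (B x j 2) (B x j 3) s4" for s4 by (rule g4) (simp add: B_def ij)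
    have solve: "\<exists>y. a + y * b = c" if "b \<noteq> 0" for a b c :: 'k
      using that by (intro exI[of _ "(c - a) / b"]) simp
    have ne: "j - k \<noteq> 0" "k - i \<noteq> 0" "i - j \<noteq> 0" using dijk by auto
    show ?thesis
    proof (cases "B x k 0 = 0 \<and> B x k 1 = 0 \<and> B x k 2 = 0 \<and> B x k 3 = 0")
      case True
      \<comment> \<open>All first four moments on k vanish; y removes the fourth one as well and
        leaves a multiple of the node at infinity. Ranks 4 + 4 + 1.\<close>
      obtain y where y: "e k + y * (i - j) = 0" using solve[OF ne(3)] by blast
      have "brank 0 ((!) [0, 0, 0, 0, 0, 0 :: 'k])" unfolding brank_def
      proof (intro exI[of _ "[]"] conjI allI impI)
        fix j :: nat assume "j \<le> 5"
        then consider "j = 0" | "j = 1" | "j = 2" | "j = 3" | "j = 4" | "j = 5" by linarith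
        then show "[0, 0, 0, 0, 0, 0 :: 'k] ! j = (\<Sum>(u, w)\<leftarrow>[]. u ^ (5 - j) * w ^ j)" by cases auto
      qed simp
      then have "gen_brank 1 0 0 0 0 (0 :: 'k)"
        by (intro gen_brank_all) (use brank_Suc_list[of 0] in force)
      then have "gen_brank 1 (B x k 0) (B x k 1) (B x k 2) (B x k 3) (e k + y * (i - j))" using y True by simp
      from fin3[OF g4i g4j this] show ?thesis by simp
    next
      case False
      then have g4k: "gen_brank 4 (B x k 0) (B x k 1) (B x k 2) (B x k 3) s4" for s4 by (rule g4)
      show ?thesis
      \<comment> \<open>A special line is given rank 2 by tuning y, for 2 + 4 + 4. Otherwise a
        generic y makes both catalecticants on i and j nonzero, for 3 + 3 + 4.\<close>
      proof (cases "?sp x i \<or> ?sp x j")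
        case True
        then show ?thesis
        proof
          assume "?sp x i"
          from special_brank(2)[OF this] obtain s4 where s4: "gen_brank 2 (B x i 0) (B x i 1) (B x i 2) (B x i 3) s4"
            unfolding B012 B3 by blast
          obtain y where "e i + y * (j - k) = s4" using solve[OF ne(1)] by blast
          then have "gen_brank 2 (B x i 0) (B x i 1) (B x i 2) (B x i 3) (e i + y * (j - k))" using s4 by simp
          from fin3[OF this g4j g4k] show ?thesis by simp
        next
          assume "?sp x j"
          from special_brank(2)[OF this] obtain s4 where s4: "gen_brank 2 (B x j 0) (B x j 1) (B x j 2) (B x j 3) s4"
            unfolding B012 B3 by blast
          obtain y where "e j + y * (k - i) = s4" using solve[OF ne(2)] by blast
          then have "gen_brank 2 (B x j 0) (B x j 1) (B x j 2) (B x j 3) (e j + y * (k - i))" using s4 by simp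
          from fin3[OF g4i this g4k] show ?thesis by simp
        qed
      next
        case False
        let ?H = "\<lambda>z s4. hankel3 (A z 0) (A z 1) (A z 2) (d z + x * \<kappa> z) s4"
        have "finite {s4. ?H i s4 = 0}" "finite {s4. ?H j s4 = 0}"
          using False ij by (auto intro: finite_hankel3_zero)
        then have "finite {y. e i + y * (j - k) \<in> {s4. ?H i s4 = 0}}" "finite {y. e j + y * (k - i) \<in> {s4. ?H j s4 = 0}}"
          using ne by (blast intro: finite_affine_vimage)+
        then have "finite {y. ?H i (e i + y * (j - k)) = 0 \<or> ?H j (e j + y * (k - i)) = 0}"
          by (intro finite_Collect_disjI[THEN iffD2] conjI) simp_all
        from ex_avoid[OF this] obtain y where y: "?H i (e i + y * (j - k)) \<noteq> 0" "?H j (e j + y * (k - i)) \<noteq> 0" by blast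
        from fin3[OF gen_brank_hankel3 gen_brank_hankel3 g4k, unfolded B012 B3, OF y] show ?thesis by simp
      qed
    qed
  next
    case False
    then have nz: "\<not> ?zero z" if "z \<in> Z" for z using that by blast
    have gen3: "gen_brank 3 (B x z 0) (B x z 1) (B x z 2) (B x z 3) s4" if "z \<in> Z" "\<not> ?exc x z" for x z s4
      unfolding B012 B3 by (rule strong_generic) (use nz[OF that(1)] that(2) in blast)+
    show ?thesis
    proof (cases "\<exists>i\<in>Z. \<exists>j\<in>Z. i \<noteq> j \<and> ?h i \<noteq> 0 \<and> ?h j \<noteq> 0")
      case True
      then obtain i j where ij: "i \<in> Z" "j \<in> Z" "i \<noteq> j" "?h i \<noteq> 0" "?h j \<noteq> 0" by blast
      from card4_obtain[OF card ij(1-3)] obtain k l where kl: "Z = {i, j, k, l}" "distinct [i, j, k, l]" .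
      have "finite {x. ?exc x z}" if "z \<in> Z" for z
        using finite_affine_vimage[OF finite_exceptional[OF nz[OF that]] \<kappa>(1)[OF that], of "d z"] by simp
      then have "finite (\<Union>z\<in>Z. {x. ?exc x z})" using fin by blast
      then have "finite {x. \<exists>z\<in>Z. ?exc x z}" by (rule rev_finite_subset) blast
      \<comment> \<open>For generic x no line is exceptional: i and j are continued by two nodes
        each, k and l have generic rank 3, which gives 2 + 2 + 3 + 3.\<close>
      from ex_avoid[OF this] obtain x where x: "\<And>z. z \<in> Z \<Longrightarrow> \<not> ?exc x z" by blast
      show ?thesis
      proof (rule trank_four_lines[OF kl(2) mB[of _ _ x, unfolded kl(1)]])
        show "\<exists>s4 s5. brank 2 ((!) [B x i 0, B x i 1, B x i 2, B x i 3, s4, s5])"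
          unfolding B012 B3 by (rule brank_2_disc) (use ij x[OF ij(1)] in blast)+
        show "\<exists>s4 s5. brank 2 ((!) [B x j 0, B x j 1, B x j 2, B x j 3, s4, s5])"
          unfolding B012 B3 by (rule brank_2_disc) (use ij x[OF ij(2)] in blast)+
        show "gen_brank 3 (B x k 0) (B x k 1) (B x k 2) (B x k 3) s4" for s4 by (rule gen3) (use x kl in auto)
        show "gen_brank 3 (B x l 0) (B x l 1) (B x l 2) (B x l 3) s4" for s4 by (rule gen3) (use x kl in auto)
      qed auto
    next
      case False
      then have h1: "i = j" if "i \<in> Z" "j \<in> Z" "?h i \<noteq> 0" "?h j \<noteq> 0" for i j using that by blast
      obtain i where i: "i \<in> Z" "A i 0 \<noteq> 0" "?h i = 0" using two h1 by blast
      \<comment> \<open>At most one line has nonzero \<open>hankel2\<close>, so one of the two lines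
        with nonzero moment for c = 0 has it zero. This x makes that line special, hence of rank
        1.\<close>
      define x where "x = ((A i 1)^3 / (A i 0)^2 - d i) / \<kappa> i"
      have spi: "?sp x i" using i \<kappa>(1)[OF i(1)] by (simp add: special_def x_def)
      have r1: "\<exists>s4 s5. brank 1 ((!) [B x z 0, B x z 1, B x z 2, B x z 3, s4, s5])" if "?sp x z" for z
        unfolding B012 B3 using special_brank(1)[OF that] .
      show ?thesis
      proof (cases "\<exists>k\<in>Z - {i}. \<exists>l\<in>Z - {i}. k \<noteq> l \<and> \<not> ?exc x k \<and> \<not> ?exc x l")
        case True
        then obtain k l where kl: "k \<in> Z" "l \<in> Z" "k \<noteq> i" "l \<noteq> i" "k \<noteq> l" "\<not> ?exc x k" "\<not> ?exc x l" by blast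
        from card4_obtain[OF card i(1) kl(1)] kl(3) obtain p q where pq: "Z = {i, k, p, q}" "distinct [i, k, p, q]" by metis
        have "l = p \<or> l = q" using kl pq by blast
        then obtain j where j: "Z = {i, j, k, l}" "distinct [i, j, k, l]"
        proof
          assume "l = p" then show ?thesis using that[of q] pq by auto
        next
          assume "l = q" then show ?thesis using that[of p] pq by auto
        qed
        show ?thesis
        \<comment> \<open>Ranks 1 + 3 + 3 + 3; the line j may be exceptional, since it only needs
          some continuation of rank 3.\<close>
        proof (rule trank_four_lines[OF j(2) mB[of _ _ x, unfolded j(1)] r1[OF spi]])
          show "\<exists>s4 s5. brank 3 ((!) [B x j 0, B x j 1, B x j 2, B x j 3, s4, s5])"
            unfolding B012 by (rule ex_brank_3) (use nz[of j] j in blast)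
          show "gen_brank 3 (B x k 0) (B x k 1) (B x k 2) (B x k 3) s4" for s4 by (rule gen3) (use kl in auto)
          show "gen_brank 3 (B x l 0) (B x l 1) (B x l 2) (B x l 3) s4" for s4 by (rule gen3) (use kl in auto)
        qed auto
      next
        case no: False
        \<comment> \<open>Any two of the other three lines include an exceptional one. If none were
          special, at least two of the three would have nonzero \<open>hankel2\<close>, which is
          excluded. A second special line gives 1 + 1 + 4 + 4.\<close>
        have "\<exists>j\<in>Z - {i}. ?sp x j"
        proof (rule ccontr)
          assume ns: "\<not> ?thesis"
          have "card (Z - {i}) = 3" using card i(1) fin by (simp add: card_Diff_singleton)
          then have "Z - {i} \<noteq> {}" by (metis card.empty zero_neq_numeral)
          then obtain j where j: "j \<in> Z" "i \<noteq> j" by blast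
          from card4_obtain[OF card i(1) j] obtain k l where kl: "Z = {i, j, k, l}" "distinct [i, j, k, l]" .
          have mem: "j \<in> Z - {i}" "k \<in> Z - {i}" "l \<in> Z - {i}" and ne: "j \<noteq> k" "j \<noteq> l" "k \<noteq> l" using kl by auto
          have hh: "?h a \<noteq> 0 \<or> ?h b \<noteq> 0" if "a \<in> Z - {i}" "b \<in> Z - {i}" "a \<noteq> b" for a b
          proof -
            have "?exc x a \<or> ?exc x b" using no that by blast
            then show ?thesis using ns that by blast
          qed
          have h1': "\<not> (?h a \<noteq> 0 \<and> ?h b \<noteq> 0)" if "a \<in> Z - {i}" "b \<in> Z - {i}" "a \<noteq> b" for a b
            using h1[of a b] that by blast
          show False using hh[OF mem(1,2) ne(1)] hh[OF mem(1,3) ne(2)] hh[OF mem(2,3) ne(3)]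
            h1'[OF mem(1,2) ne(1)] h1'[OF mem(1,3) ne(2)] h1'[OF mem(2,3) ne(3)] by argo
        qed
        then obtain j where j: "j \<in> Z" "i \<noteq> j" "?sp x j" by blast
        from card4_obtain[OF card i(1) j(1,2)] obtain k l where kl: "Z = {i, j, k, l}" "distinct [i, j, k, l]" .
        show ?thesis
        proof (rule trank_four_lines[OF kl(2) mB[of _ _ x, unfolded kl(1)] r1[OF spi] r1[OF j(3)]])
          show "gen_brank 4 (B x k 0) (B x k 1) (B x k 2) (B x k 3) s4" for s4
            unfolding B012 by (rule gen_brank_4) (use nz[of k] kl in blast)
          show "gen_brank 4 (B x l 0) (B x l 1) (B x l 2) (B x l 3) s4" for s4
            unfolding B012 by (rule gen_brank_4) (use nz[of l] kl in blast)
        qed auto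
      qed
    qed
  qed
qed

subsection \<open>Symmetric 5-linear forms in three variables\<close>

type_synonym 'k v3 = "'k \<times> 'k \<times> 'k"

definition sm :: "'k::comm_ring_1 \<Rightarrow> 'k v3 \<Rightarrow> 'k v3"
  where "sm c v = (case v of (x, y, z) \<Rightarrow> (c * x, c * y, c * z))"

definition dot :: "'k::comm_ring_1 v3 \<Rightarrow> 'k v3 \<Rightarrow> 'k"
  where "dot u v = (case u of (a, b, c) \<Rightarrow> case v of (x, y, z) \<Rightarrow> a * x + b * y + c * z)"

definition cross :: "'k::comm_ring_1 v3 \<Rightarrow> 'k v3 \<Rightarrow> 'k v3"
  where "cross u v = (case u of (a, b, c) \<Rightarrow> case v of (x, y, z) \<Rightarrow> (b * z - c * y, c * x - a * z, a * y - b * x))"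

definition det3 :: "'k::comm_ring_1 v3 \<Rightarrow> 'k v3 \<Rightarrow> 'k v3 \<Rightarrow> 'k"
  where "det3 u v w = dot u (cross v w)"

lemmas v3_defs = sm_def dot_def cross_def det3_def zero_prod_def

lemma dot_lin: "dot u (v + w) = dot u v + dot u w" "dot u (sm c v) = c * dot u v"
  "dot (u + v) w = dot u w + dot v w" "dot (sm c u) w = c * dot u w"
  by (auto simp: v3_defs algebra_simps split: prod.splits)

lemma dot_commute: "dot u v = dot v u"
  by (cases u; cases v) (simp add: dot_def algebra_simps)

lemma det3_cycle: "det3 b c a = det3 a b c"
  by (cases a; cases b; cases c) (simp add: v3_defs algebra_simps)

lemma det3_eq_0: "det3 u u v = 0" "det3 u v v = 0" "det3 u v u = 0"
  by (cases u; cases v; simp add: v3_defs algebra_simps)+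

lemma cramer:
  fixes e1 :: "'k::field v3"
  assumes "det3 e1 e2 e3 \<noteq> 0"
  shows "v = sm (det3 v e2 e3 / det3 e1 e2 e3) e1 + sm (det3 e1 v e3 / det3 e1 e2 e3) e2
    + sm (det3 e1 e2 v / det3 e1 e2 e3) e3"
proof -
  obtain a1 a2 a3 b1 b2 b3 c1 c2 c3 x y z where v: "e1 = (a1, a2, a3)" "e2 = (b1, b2, b3)" "e3 = (c1, c2, c3)" "v = (x, y, z)"
    by (metis surj_pair)
  define D where "D = det3 e1 e2 e3"
  have D: "D \<noteq> 0" using assms by (simp add: D_def)
  have e: "t = p / D * a + q / D * b + r / D * c \<longleftrightarrow> D * t = p * a + q * b + r * c" for t p q r a b c
    using D by (simp add: field_simps)
  show ?thesis unfolding D_def[symmetric] unfolding v sm_def prod.case plus_prod_def fst_conv snd_conv prod.inject e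
    by (simp add: D_def v v3_defs algebra_simps)
qed

lemma basis_induct:
  fixes e1 :: "'k::field v3"
  assumes D: "det3 e1 e2 e3 \<noteq> 0" and add: "\<And>x y. P x \<Longrightarrow> P y \<Longrightarrow> P (x + y)" and sm: "\<And>k x. P x \<Longrightarrow> P (sm k x)"
    and "P e1" "P e2" "P e3"
  shows "P v"
proof -
  have "P (sm (det3 v e2 e3 / det3 e1 e2 e3) e1 + sm (det3 e1 v e3 / det3 e1 e2 e3) e2
    + sm (det3 e1 e2 v / det3 e1 e2 e3) e3)"
    by (rule add[OF add[OF sm[OF assms(4)] sm[OF assms(5)]] sm[OF assms(6)]])
  then show ?thesis by (subst cramer[OF D, of v])
qed

text \<open>The complete polarization of f. Adjacent transpositions generate all permutations, so
  linearity in the first argument spreads to the others.\<close>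

locale quintic_form =
  fixes M :: "'k::{alg_closed_field, field_char_0} v3 \<Rightarrow> 'k v3 \<Rightarrow> 'k v3 \<Rightarrow> 'k v3 \<Rightarrow> 'k v3 \<Rightarrow> 'k"
  assumes add1: "M (a + a') b c d e = M a b c d e + M a' b c d e"
    and sm1: "M (sm k a) b c d e = k * M a b c d e"
    and sw12: "M a b c d e = M b a c d e"
    and sw23: "M a b c d e = M a c b d e"
    and sw34: "M a b c d e = M a b d c e"
    and sw45: "M a b c d e = M a b c e d"
begin

lemmas M_ac = sw12 sw23 sw34 sw45

lemma add2: "M a (b + b') c d e = M a b c d e + M a b' c d e"
  using add1[of b b' a c d e] by (simp only: sw12[of a])
lemma add3: "M a b (c + c') d e = M a b c d e + M a b c' d e"
  using add2[of a c c' b d e] by (simp only: sw23[of a b])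
lemma add4: "M a b c (d + d') e = M a b c d e + M a b c d' e"
  using add3[of a b d d' c e] by (simp only: sw34[of a b c])
lemma add5: "M a b c d (e + e') = M a b c d e + M a b c d e'"
  using add4[of a b c e e' d] by (simp only: sw45[of a b c d])
lemma sm2: "M a (sm k b) c d e = k * M a b c d e"
  using sm1[of k b a c d e] by (simp only: sw12[of a])
lemma sm3: "M a b (sm k c) d e = k * M a b c d e"
  using sm2[of a k c b d e] by (simp only: sw23[of a b])
lemma sm4: "M a b c (sm k d) e = k * M a b c d e"
  using sm3[of a b k d c e] by (simp only: sw34[of a b c])
lemma sm5: "M a b c d (sm k e) = k * M a b c d e"
  using sm4[of a b c k e d] by (simp only: sw45[of a b c d])

lemmas M_lin = add1 add2 add3 add4 add5 sm1 sm2 sm3 sm4 sm5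

end

text \<open>Going through the list of arguments allows one statement for all monomials (see
  \<open>mom_args\<close>). The value is meaningful for b + c at most 5, when the list has length
  5.\<close>

definition mom :: "('k v3 \<Rightarrow> 'k v3 \<Rightarrow> 'k v3 \<Rightarrow> 'k v3 \<Rightarrow> 'k v3 \<Rightarrow> 'k) \<Rightarrow> 'k v3 \<Rightarrow> 'k v3 \<Rightarrow> 'k v3 \<Rightarrow> nat \<Rightarrow> nat \<Rightarrow> 'k"
  where "mom M e1 e2 e3 b c = (case replicate (5 - b - c) e1 @ replicate b e2 @ replicate c e3 of
     [x1, x2, x3, x4, x5] \<Rightarrow> M x1 x2 x3 x4 x5)"

lemma mom_args:
  assumes "b + c \<le> 5"
  obtains x1 x2 x3 x4 x5 where "replicate (5 - b - c) p @ replicate b q @ replicate c r = [x1, x2, x3, x4, x5]"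
    "\<And>M. mom M p q r b c = M x1 x2 x3 x4 x5"
proof -
  let ?L = "replicate (5 - b - c) p @ replicate b q @ replicate c r"
  have "length ?L = Suc (Suc (Suc (Suc (Suc 0))))" using assms by simp
  then obtain x1 x2 x3 x4 x5 where L: "?L = [x1, x2, x3, x4, x5]" by (auto simp: length_Suc_conv simp del: length_append length_replicate)
  show ?thesis using that[OF L] unfolding mom_def L by simp
qed

definition qrank :: "nat \<Rightarrow> ('k::comm_ring_1 v3 \<Rightarrow> 'k v3 \<Rightarrow> 'k v3 \<Rightarrow> 'k v3 \<Rightarrow> 'k v3 \<Rightarrow> 'k) \<Rightarrow> bool"
  where "qrank n M \<longleftrightarrow> (\<exists>ls. length ls \<le> n \<and>
    (\<forall>a b c d e. M a b c d e = (\<Sum>l\<leftarrow>ls. dot l a * dot l b * dot l c * dot l d * dot l e)))"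

lemma mom_eval:
  "mom M x y z 0 0 = M x x x x x" "mom M x y z 1 0 = M x x x x y" "mom M x y z 2 0 = M x x x y y"
  "mom M x y z 3 0 = M x x y y y" "mom M x y z 4 0 = M x y y y y" "mom M x y z 5 0 = M y y y y y"
  "mom M x y z 0 1 = M x x x x z" "mom M x y z 1 1 = M x x x y z" "mom M x y z 2 1 = M x x y y z"
  "mom M x y z 3 1 = M x y y y z" "mom M x y z 4 1 = M y y y y z"
  "mom M x y z 0 2 = M x x x z z" "mom M x y z 1 2 = M x x y z z" "mom M x y z 2 2 = M x y y z z"
  "mom M x y z 3 2 = M y y y z z"
  "mom M x y z 0 3 = M x x z z z" "mom M x y z 1 3 = M x y z z z" "mom M x y z 2 3 = M y y z z z"
  "mom M x y z 0 4 = M x z z z z" "mom M x y z 1 4 = M y z z z z"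
  "mom M x y z 0 5 = M z z z z z"
  by (simp_all add: mom_def eval_nat_numeral)

context quintic_form
begin

lemma zero_on_basis21:
  assumes D: "det3 e1 e2 e3 \<noteq> 0"
    and z21: "M e1 e1 e1 e1 e1 = 0" "M e1 e1 e1 e1 e2 = 0" "M e1 e1 e1 e2 e2 = 0" "M e1 e1 e2 e2 e2 = 0" "M e1 e2 e2 e2 e2 = 0"
      "M e2 e2 e2 e2 e2 = 0" "M e1 e1 e1 e1 e3 = 0" "M e1 e1 e1 e2 e3 = 0" "M e1 e1 e2 e2 e3 = 0" "M e1 e2 e2 e2 e3 = 0"
      "M e2 e2 e2 e2 e3 = 0" "M e1 e1 e1 e3 e3 = 0" "M e1 e1 e2 e3 e3 = 0" "M e1 e2 e2 e3 e3 = 0" "M e2 e2 e2 e3 e3 = 0"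
      "M e1 e1 e3 e3 e3 = 0" "M e1 e2 e3 e3 e3 = 0" "M e2 e2 e3 e3 e3 = 0" "M e1 e3 e3 e3 e3 = 0" "M e2 e3 e3 e3 e3 = 0"
      "M e3 e3 e3 e3 e3 = 0"
  shows "M a b c d e = 0"
proof -
  let ?E = "{e1, e2, e3}"
  note ext = basis_induct[OF D]
  have 0: "M a b c d e = 0" if "a \<in> ?E" "b \<in> ?E" "c \<in> ?E" "d \<in> ?E" "e \<in> ?E" for a b c d e
    using that by (elim insertE emptyE; hypsubst; simp only: M_ac z21)
  have 1: "M a b c d e = 0" if "b \<in> ?E" "c \<in> ?E" "d \<in> ?E" "e \<in> ?E" for a b c d e
    by (rule ext[of "\<lambda>a. M a b c d e = 0"]) (simp_all add: M_lin 0[OF _ that])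
  have 2: "M a b c d e = 0" if "c \<in> ?E" "d \<in> ?E" "e \<in> ?E" for a b c d e
    by (rule ext[of "\<lambda>b. M a b c d e = 0"]) (simp_all add: M_lin 1[OF _ that])
  have 3: "M a b c d e = 0" if "d \<in> ?E" "e \<in> ?E" for a b c d e
    by (rule ext[of "\<lambda>c. M a b c d e = 0"]) (simp_all add: M_lin 2[OF _ that])
  have 4: "M a b c d e = 0" if "e \<in> ?E" for a b c d e
    by (rule ext[of "\<lambda>d. M a b c d e = 0"]) (simp_all add: M_lin 3[OF _ that])
  show ?thesis
    by (rule ext[of "\<lambda>e. M a b c d e = 0"]) (simp_all add: M_lin 4)
qed

lemma zero_on_basis:
  assumes D: "det3 e1 e2 e3 \<noteq> 0" and z: "\<And>b c. b + c \<le> 5 \<Longrightarrow> mom M e1 e2 e3 b c = 0"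
  shows "M a b c d e = 0"
proof -
  have "mom M e1 e2 e3 0 0 = 0" "mom M e1 e2 e3 1 0 = 0" "mom M e1 e2 e3 2 0 = 0" "mom M e1 e2 e3 3 0 = 0" "mom M e1 e2 e3 4 0 = 0" "mom M e1 e2 e3 5 0 = 0" "mom M e1 e2 e3 0 1 = 0" "mom M e1 e2 e3 1 1 = 0" "mom M e1 e2 e3 2 1 = 0" "mom M e1 e2 e3 3 1 = 0" "mom M e1 e2 e3 4 1 = 0" "mom M e1 e2 e3 0 2 = 0" "mom M e1 e2 e3 1 2 = 0" "mom M e1 e2 e3 2 2 = 0" "mom M e1 e2 e3 3 2 = 0" "mom M e1 e2 e3 0 3 = 0" "mom M e1 e2 e3 1 3 = 0" "mom M e1 e2 e3 2 3 = 0" "mom M e1 e2 e3 0 4 = 0" "mom M e1 e2 e3 1 4 = 0" "mom M e1 e2 e3 0 5 = 0"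
    by (rule z; simp)+
  from zero_on_basis21[OF D this[unfolded mom_eval]] show ?thesis .
qed

lemma diff_quintic_form:
  assumes "quintic_form N"
  shows "quintic_form (\<lambda>a b c d e. M a b c d e - N a b c d e)"
proof -
  interpret N: quintic_form N by fact
  show ?thesis
  proof
    fix a b c d e
    show "M a b c d e - N a b c d e = M b a c d e - N b a c d e" using sw12[of a b c d e] N.sw12[of a b c d e] by simp
    show "M a b c d e - N a b c d e = M a c b d e - N a c b d e" using sw23[of a b c d e] N.sw23[of a b c d e] by simp
    show "M a b c d e - N a b c d e = M a b d c e - N a b d c e" using sw34[of a b c d e] N.sw34[of a b c d e] by simp
    show "M a b c d e - N a b c d e = M a b c e d - N a b c e d" using sw45[of a b c d e] N.sw45[of a b c d e] by simp
  qed (simp_all add: add1 sm1 N.add1 N.sm1 algebra_simps)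
qed

end

lemma power_sum_quintic_form:
  "quintic_form (\<lambda>a b c d e. \<Sum>l\<leftarrow>ls. dot l a * dot l b * dot l c * dot l d * dot l e)"
  by standard (simp_all add: dot_lin algebra_simps sum_list_addf sum_list_const_mult)

text \<open>Coordinates are turned into forms by the dual basis of e1, e2, e3, built from cross
  products. The difference of M and the resulting power sum is a quintic form with all 21 moments
  zero.\<close>

lemma (in quintic_form) qrank_if_trank:
  assumes D: "det3 e1 e2 e3 \<noteq> 0" and t: "trank n (mom M e1 e2 e3)"
  shows "qrank n M"
proof -
  let ?D = "det3 e1 e2 e3"
  define l1 where "l1 = sm (1 / ?D) (cross e2 e3)"
  define l2 where "l2 = sm (1 / ?D) (cross e3 e1)"
  define l3 where "l3 = sm (1 / ?D) (cross e1 e2)"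
  have l: "dot l1 e1 = 1" "dot l1 e2 = 0" "dot l1 e3 = 0" "dot l2 e1 = 0" "dot l2 e2 = 1" "dot l2 e3 = 0"
    "dot l3 e1 = 0" "dot l3 e2 = 0" "dot l3 e3 = 1"
    unfolding l1_def l2_def l3_def dot_lin dot_commute[of _ e1] dot_commute[of _ e2] dot_commute[of _ e3] det3_def[symmetric]
    using D det3_cycle[of e2 e3 e1] det3_cycle[of e3 e1 e2] by (simp_all add: det3_eq_0)
  obtain ts where ts: "length ts \<le> n"
    "\<And>b c. b + c \<le> 5 \<Longrightarrow> mom M e1 e2 e3 b c = (\<Sum>(u, v, w)\<leftarrow>ts. u ^ (5 - b - c) * v ^ b * w ^ c)"
    using t unfolding trank_def by blast
  let ?f = "\<lambda>(u, v, w). sm u l1 + sm v l2 + sm w l3"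
  let ?ls = "map ?f ts"
  let ?N = "\<lambda>a b c d e. \<Sum>l\<leftarrow>?ls. dot l a * dot l b * dot l c * dot l d * dot l e"
  have N: "mom ?N e1 e2 e3 b c = (\<Sum>(u, v, w)\<leftarrow>ts. u ^ (5 - b - c) * v ^ b * w ^ c)" if bc: "b + c \<le> 5" for b c
  proof -
    obtain x1 x2 x3 x4 x5 where L: "replicate (5 - b - c) e1 @ replicate b e2 @ replicate c e3 = [x1, x2, x3, x4, x5]"
      "\<And>M. mom M e1 e2 e3 b c = M x1 x2 x3 x4 x5" by (rule mom_args[OF bc, where p = e1 and q = e2 and r = e3]) blast
    have "dot l x1 * dot l x2 * dot l x3 * dot l x4 * dot l x5 = dot l e1 ^ (5 - b - c) * dot l e2 ^ b * dot l e3 ^ c" for l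
    proof -
      have "prod_list (map (dot l) [x1, x2, x3, x4, x5]) = dot l e1 ^ (5 - b - c) * dot l e2 ^ b * dot l e3 ^ c"
        unfolding L(1)[symmetric] by (simp add: map_replicate mult.assoc)
      then show ?thesis by (simp add: mult.assoc)
    qed
    then show ?thesis unfolding L(2) by (simp add: o_def case_prod_unfold dot_lin l)
  qed
  interpret Q: quintic_form "\<lambda>a b c d e. M a b c d e - ?N a b c d e"
    by (rule diff_quintic_form[OF power_sum_quintic_form])
  have "M a b c d e - ?N a b c d e = 0" for a b c d e
  proof (rule Q.zero_on_basis[OF D])
    fix b c :: nat assume bc: "b + c \<le> 5"
    obtain x1 x2 x3 x4 x5 where "replicate (5 - b - c) e1 @ replicate b e2 @ replicate c e3 = [x1, x2, x3, x4, x5]"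
      and L: "\<And>M. mom M e1 e2 e3 b c = M x1 x2 x3 x4 x5" by (rule mom_args[OF bc, where p = e1 and q = e2 and r = e3]) blast
    have "mom (\<lambda>a b c d e. M a b c d e - ?N a b c d e) e1 e2 e3 b c = mom M e1 e2 e3 b c - mom ?N e1 e2 e3 b c"
      unfolding L ..
    then show "mom (\<lambda>a b c d e. M a b c d e - ?N a b c d e) e1 e2 e3 b c = 0" using ts(2)[OF bc] N[OF bc] by simp
  qed
  then have eq: "M a b c d e = ?N a b c d e" for a b c d e by (rule eq_iff_diff_eq_0[THEN iffD2])
  have len: "length ?ls \<le> n" using ts(1) by simp
  show ?thesis unfolding qrank_def by (intro exI[of _ ?ls] conjI allI len eq)
qed

section \<open>Apolar quartics on a plane and bad points\<close>

lemma four_dependent: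
  fixes a0 :: "'k::field"
  shows "\<exists>q0 q1 q2 q3. \<not> (q0 = 0 \<and> q1 = 0 \<and> q2 = 0 \<and> q3 = 0)
    \<and> q0 * a0 + q1 * a1 + q2 * a2 + q3 * a3 = 0
    \<and> q0 * b0 + q1 * b1 + q2 * b2 + q3 * b3 = 0
    \<and> q0 * c0 + q1 * c1 + q2 * c2 + q3 * c3 = 0"
proof (cases "a0 * (b1 * c2 - b2 * c1) - a1 * (b0 * c2 - b2 * c0) + a2 * (b0 * c1 - b1 * c0) = 0")
  case True
  from kernel3[OF this] obtain x y z where "\<not> (x = 0 \<and> y = 0 \<and> z = 0)" "a0 * x + a1 * y + a2 * z = 0"
    "b0 * x + b1 * y + b2 * z = 0" "c0 * x + c1 * y + c2 * z = 0" by blast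
  then show ?thesis by (intro exI[of _ x] exI[of _ y] exI[of _ z] exI[of _ 0]) (simp add: mult.commute)
next
  case False
  let ?m0 = "a1 * (b2 * c3 - b3 * c2) - a2 * (b1 * c3 - b3 * c1) + a3 * (b1 * c2 - b2 * c1)"
  let ?m1 = "a0 * (b2 * c3 - b3 * c2) - a2 * (b0 * c3 - b3 * c0) + a3 * (b0 * c2 - b2 * c0)"
  let ?m2 = "a0 * (b1 * c3 - b3 * c1) - a1 * (b0 * c3 - b3 * c0) + a3 * (b0 * c1 - b1 * c0)"
  let ?m3 = "a0 * (b1 * c2 - b2 * c1) - a1 * (b0 * c2 - b2 * c0) + a2 * (b0 * c1 - b1 * c0)"
  show ?thesis
  proof (intro exI conjI)
    show "\<not> (- ?m0 = 0 \<and> ?m1 = 0 \<and> - ?m2 = 0 \<and> ?m3 = 0)" using False by blast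
    show "- ?m0 * a0 + ?m1 * a1 + - ?m2 * a2 + ?m3 * a3 = 0" by (simp add: algebra_simps)
    show "- ?m0 * b0 + ?m1 * b1 + - ?m2 * b2 + ?m3 * b3 = 0" by (simp add: algebra_simps)
    show "- ?m0 * c0 + ?m1 * c1 + - ?m2 * c2 + ?m3 * c3 = 0" by (simp add: algebra_simps)
  qed
qed

text \<open>Linear dependence of f and g without a case distinction on which of them is
  zero.\<close>

definition par :: "('a \<Rightarrow> 'k::comm_ring_1) \<Rightarrow> ('a \<Rightarrow> 'k) \<Rightarrow> bool"
  where "par f g \<longleftrightarrow> (\<forall>x y. f x * g y = f y * g x)"

context quintic_form
begin

text \<open>This depends only on the point \<open>\<mu>\<close> and on the line through \<open>\<mu>\<close> and \<open>b\<close>.\<close>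

definition bad :: "'k v3 \<Rightarrow> 'k v3 \<Rightarrow> bool"
  where "bad \<mu> b \<longleftrightarrow> par (M \<mu> \<mu> \<mu> \<mu>) (M \<mu> \<mu> \<mu> b) \<and> par (M \<mu> \<mu> \<mu> \<mu>) (M \<mu> \<mu> b b) \<and> par (M \<mu> \<mu> \<mu> b) (M \<mu> \<mu> b b)"

lemma badI:
  assumes "\<And>x. M \<mu> \<mu> \<mu> \<mu> x = k0 * w x" "\<And>x. M \<mu> \<mu> \<mu> b x = k1 * w x" "\<And>x. M \<mu> \<mu> b b x = k2 * w x"
  shows "bad \<mu> b"
  unfolding bad_def par_def assms by (simp add: algebra_simps)

text \<open>Four polars in the three-dimensional dual space are dependent. Leaving out e2^4 means
  choosing the member of the pencil of apolar quartics that has a root at infinity, here a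
  polynomial of degree at most 3.\<close>

lemma relation_quartic:
  assumes D: "det3 e1 e2 e3 \<noteq> 0"
  shows "\<exists>q0 q1 q2 q3. \<not> (q0 = 0 \<and> q1 = 0 \<and> q2 = 0 \<and> q3 = 0)
    \<and> (\<forall>x. q0 * M e1 e1 e1 e1 x + q1 * M e1 e1 e1 e2 x + q2 * M e1 e1 e2 e2 x + q3 * M e1 e2 e2 e2 x = 0)"
proof -
  obtain q0 q1 q2 q3 where q: "\<not> (q0 = 0 \<and> q1 = 0 \<and> q2 = 0 \<and> q3 = 0)"
    "q0 * M e1 e1 e1 e1 e1 + q1 * M e1 e1 e1 e2 e1 + q2 * M e1 e1 e2 e2 e1 + q3 * M e1 e2 e2 e2 e1 = 0"
    "q0 * M e1 e1 e1 e1 e2 + q1 * M e1 e1 e1 e2 e2 + q2 * M e1 e1 e2 e2 e2 + q3 * M e1 e2 e2 e2 e2 = 0"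
    "q0 * M e1 e1 e1 e1 e3 + q1 * M e1 e1 e1 e2 e3 + q2 * M e1 e1 e2 e2 e3 + q3 * M e1 e2 e2 e2 e3 = 0"
    using four_dependent[of "M e1 e1 e1 e1 e1" "M e1 e1 e1 e2 e1" "M e1 e1 e2 e2 e1" "M e1 e2 e2 e2 e1"
      "M e1 e1 e1 e1 e2" "M e1 e1 e1 e2 e2" "M e1 e1 e2 e2 e2" "M e1 e2 e2 e2 e2"
      "M e1 e1 e1 e1 e3" "M e1 e1 e1 e2 e3" "M e1 e1 e2 e2 e3" "M e1 e2 e2 e2 e3"] by blast
  have "q0 * M e1 e1 e1 e1 x + q1 * M e1 e1 e1 e2 x + q2 * M e1 e1 e2 e2 x + q3 * M e1 e2 e2 e2 x = 0" (is "?L x = 0") for x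
  proof (rule basis_induct[OF D, of "\<lambda>x. ?L x = 0"])
    fix x y assume "?L x = 0" "?L y = 0"
    moreover have "?L (x + y) = ?L x + ?L y" by (simp add: M_lin algebra_simps)
    ultimately show "?L (x + y) = 0" by simp
  next
    fix k x assume "?L x = 0"
    moreover have "?L (sm k x) = k * ?L x" by (simp add: M_lin algebra_simps)
    ultimately show "?L (sm k x) = 0" by simp
  qed (fact q)+
  then show ?thesis using q(1) by blast
qed

text \<open>Replacing X^j by e1^(4-j) e2^j turns (X - r)^2 into the square of e2 - r e1. Both
  relations thus become relations between the polars of that square with e1^2, e1 e2 and e2^2. They
  are independent because only the first involves e2^2, so the three polars lie on one line, which
  is badness.\<close>

lemma bad_of_common_double_root:
  assumes P: "double_root [:p0, p1, p2, p3, p4:] r" and Q: "double_root [:q0, q1, q2, q3:] r"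
    and p4: "p4 \<noteq> 0" and q: "\<not> (q0 = 0 \<and> q1 = 0 \<and> q2 = 0 \<and> q3 = 0)"
    and p: "\<And>x. p0 * M e1 e1 e1 e1 x + p1 * M e1 e1 e1 e2 x + p2 * M e1 e1 e2 e2 x + p3 * M e1 e2 e2 e2 x + p4 * M e2 e2 e2 e2 x = 0"
    and q': "\<And>x. q0 * M e1 e1 e1 e1 x + q1 * M e1 e1 e1 e2 x + q2 * M e1 e1 e2 e2 x + q3 * M e1 e2 e2 e2 x = 0"
  shows "bad (e2 + sm (- r) e1) e1"
proof -
  define \<mu> where "\<mu> = e2 + sm (- r) e1"
  from double_root_poly[OF P] have "p0 + r * (p1 + r * (p2 + r * (p3 + r * p4))) = 0"
    "p1 + r * (2 * p2 + r * (3 * p3 + r * (4 * p4))) = 0"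
    by (auto simp: pderiv_pCons algebra_simps)
  then have p01: "p1 = - (2 * r * p2 + 3 * r^2 * p3 + 4 * r^3 * p4)" "p0 = r^2 * p2 + 2 * r^3 * p3 + 3 * r^4 * p4"
    by algebra+
  from double_root_poly[OF Q] have "q0 + r * (q1 + r * (q2 + r * q3)) = 0" "q1 + r * (2 * q2 + r * (3 * q3)) = 0"
    by (auto simp: pderiv_pCons algebra_simps)
  then have q01: "q1 = - (2 * r * q2 + 3 * r^2 * q3)" "q0 = r^2 * q2 + 2 * r^3 * q3"
    by algebra+
  let ?w0 = "M \<mu> \<mu> e1 e1" and ?w1 = "M \<mu> \<mu> e1 e2" and ?w2 = "M \<mu> \<mu> e2 e2"
  have A: "(p2 + 2 * r * p3 + 3 * r^2 * p4) * ?w0 x + (p3 + 2 * r * p4) * ?w1 x + p4 * ?w2 x = 0" for x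
    using p[of x] unfolding p01 \<mu>_def by (simp add: M_lin M_ac algebra_simps eval_nat_numeral)
  have B: "(q2 + 2 * r * q3) * ?w0 x + q3 * ?w1 x = 0" for x
    using q'[of x] unfolding q01 \<mu>_def by (simp add: M_lin M_ac algebra_simps eval_nat_numeral)
  have v0: "M \<mu> \<mu> \<mu> \<mu> x = ?w2 x - 2 * r * ?w1 x + r^2 * ?w0 x" for x
    unfolding \<mu>_def by (simp add: M_lin M_ac algebra_simps eval_nat_numeral)
  have v1: "M \<mu> \<mu> \<mu> e1 x = ?w1 x - r * ?w0 x" for x
    unfolding \<mu>_def by (simp add: M_lin M_ac algebra_simps eval_nat_numeral)
  have "\<exists>w k0 k1. \<forall>x. ?w0 x = k0 * w x \<and> ?w1 x = k1 * w x"
  proof (cases "q3 = 0")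
    case True
    then have "q2 \<noteq> 0" using q q01 by auto
    then have "?w0 x = 0" for x using B[of x] True by simp
    then show ?thesis by (intro exI[of _ ?w1] exI[of _ 0] exI[of _ 1]) simp
  next
    case False
    define k where "k = - (q2 + 2 * r * q3) / q3"
    have k: "q3 * k = - (q2 + 2 * r * q3)" using False by (simp add: k_def)
    have "?w1 x = k * ?w0 x" for x
    proof -
      have "q3 * ?w1 x = - (q2 + 2 * r * q3) * ?w0 x" using B[of x] by algebra
      also have "\<dots> = q3 * (k * ?w0 x)" unfolding k[symmetric] by simp
      finally show ?thesis using False by simp
    qed
    then show ?thesis by (intro exI[of _ ?w0] exI[of _ 1] exI[of _ k]) simp
  qed
  then obtain w k0 k1 where w: "\<And>x. ?w0 x = k0 * w x" "\<And>x. ?w1 x = k1 * w x" by blast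
  define k2 where "k2 = - ((p2 + 2 * r * p3 + 3 * r^2 * p4) * k0 + (p3 + 2 * r * p4) * k1) / p4"
  have k2: "p4 * k2 = - ((p2 + 2 * r * p3 + 3 * r^2 * p4) * k0 + (p3 + 2 * r * p4) * k1)"
    using p4 by (simp add: k2_def)
  have w2: "?w2 x = k2 * w x" for x
  proof -
    have "p4 * ?w2 x = - ((p2 + 2 * r * p3 + 3 * r^2 * p4) * ?w0 x + (p3 + 2 * r * p4) * ?w1 x)"
      using A[of x] by algebra
    also have "\<dots> = p4 * k2 * w x" unfolding w k2 by (simp add: algebra_simps)
    finally show ?thesis using p4 by simp
  qed
  have "bad \<mu> e1"
    by (rule badI[of _ "k2 - 2 * r * k1 + r^2 * k0" w _ "k1 - r * k0" k0])
      (simp_all add: v0 v1 w w2 algebra_simps)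
  then show ?thesis unfolding \<mu>_def .
qed

text \<open>On the plane of e1 and e2 the form is a (x + z y)^5, and e2 - z e1 is the zero of its
  linear factor. The polars in question therefore vanish on the plane and are multiples of the
  functional w that defines it.\<close>

lemma bad_of_fifth_power:
  assumes D: "det3 e1 e2 e3 \<noteq> 0"
    and F: "M e1 e1 e1 e1 e1 = a" "M e1 e1 e1 e1 e2 = a * z" "M e1 e1 e1 e2 e2 = a * z^2"
      "M e1 e1 e2 e2 e2 = a * z^3" "M e1 e2 e2 e2 e2 = a * z^4" "M e2 e2 e2 e2 e2 = a * z^5"
  shows "bad (e2 + sm (- z) e1) e1"
proof -
  define \<mu> where "\<mu> = e2 + sm (- z) e1"
  define w where "w x = det3 e1 e2 x / det3 e1 e2 e3" for x
  have w: "w e1 = 0" "w e2 = 0" "w e3 = 1" "w (x + y) = w x + w y" "w (sm k x) = k * w x" for x y k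
    using D by (auto simp: w_def det3_eq_0 add_divide_distrib[symmetric])
      (cases e1; cases e2; cases x; cases y; simp add: v3_defs algebra_simps)+
  have lin: "f x = f e3 * w x" if "\<And>x y. f (x + y) = f x + f y" "\<And>k x. f (sm k x) = k * f x" "f e1 = 0" "f e2 = 0" for f x
    by (rule basis_induct[OF D, of "\<lambda>x. f x = f e3 * w x"]) (simp_all add: that w algebra_simps)
  have F': "M e1 e1 e1 e2 e1 = a * z" "M e1 e1 e2 e2 e1 = a * z^2" "M e1 e2 e2 e2 e1 = a * z^3" "M e2 e2 e2 e2 e1 = a * z^4"
    using F by (simp_all only: M_ac)
  have v0: "M \<mu> \<mu> \<mu> \<mu> x = M \<mu> \<mu> \<mu> \<mu> e3 * w x" for x
    by (rule lin) (simp_all add: M_lin, simp_all add: \<mu>_def M_lin M_ac F algebra_simps eval_nat_numeral)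
  have v1: "M \<mu> \<mu> \<mu> e1 x = M \<mu> \<mu> \<mu> e1 e3 * w x" for x
    by (rule lin) (simp_all add: M_lin, simp_all add: \<mu>_def M_lin M_ac F algebra_simps eval_nat_numeral)
  have v2: "M \<mu> \<mu> e1 e1 x = M \<mu> \<mu> e1 e1 e3 * w x" for x
    by (rule lin) (simp_all add: M_lin, simp_all add: \<mu>_def M_lin M_ac F algebra_simps eval_nat_numeral)
  have "bad \<mu> e1" by (rule badI[OF v0 v1 v2])
  then show ?thesis unfolding \<mu>_def .
qed

lemma good_or_bad:
  assumes D: "det3 e1 e2 e3 \<noteq> 0"
  shows "qrank 10 M \<or> (\<exists>x y x' y'. x * y' - x' * y \<noteq> 0 \<and> bad (sm x e1 + sm y e2) (sm x' e1 + sm y' e2))"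
proof -
  obtain q0 q1 q2 q3 where q: "\<not> (q0 = 0 \<and> q1 = 0 \<and> q2 = 0 \<and> q3 = 0)"
    "\<And>x. q0 * M e1 e1 e1 e1 x + q1 * M e1 e1 e1 e2 x + q2 * M e1 e1 e2 e2 x + q3 * M e1 e2 e2 e2 x = 0"
    using relation_quartic[OF D] by blast
  \<comment> \<open>The first relation has no e2^4 term. Rewritten with f = e1 - r e2 its leading
    coefficient is the value of this polynomial at r, so a generic r makes the degree exactly 4. A
    second relation of degree at most 3 then completes the pencil.\<close>
  have "finite {r. poly [:0, q3, q2, q1, q0:] r = 0}" using q(1) by (intro poly_roots_finite) auto
  from ex_avoid[OF this] obtain r where r: "poly [:0, q3, q2, q1, q0:] r \<noteq> 0" by blast
  define f where "f = e1 + sm (- r) e2"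
  define p0 p1 p2 p3 p4 where "p0 = q0" and "p1 = 4 * r * q0 + q1" and "p2 = 6 * r^2 * q0 + 3 * r * q1 + q2"
    and "p3 = 4 * r^3 * q0 + 3 * r^2 * q1 + 2 * r * q2 + q3" and "p4 = r^4 * q0 + r^3 * q1 + r^2 * q2 + r * q3"
  note p_def = p0_def p1_def p2_def p3_def p4_def
  have p4: "p4 \<noteq> 0" using r by (simp add: p4_def algebra_simps eval_nat_numeral)
  have p: "p0 * M f f f f x + p1 * M f f f e2 x + p2 * M f f e2 e2 x + p3 * M f e2 e2 e2 x + p4 * M e2 e2 e2 e2 x = 0" for x
  proof -
    have "p0 * M f f f f x + p1 * M f f f e2 x + p2 * M f f e2 e2 x + p3 * M f e2 e2 e2 x + p4 * M e2 e2 e2 e2 x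
      = q0 * M e1 e1 e1 e1 x + q1 * M e1 e1 e1 e2 x + q2 * M e1 e1 e2 e2 x + q3 * M e1 e2 e2 e2 x"
      unfolding p_def f_def by (simp add: M_lin M_ac algebra_simps eval_nat_numeral)
    then show ?thesis using q(2) by simp
  qed
  have "det3 f e2 e3 = det3 e1 e2 e3"
    unfolding f_def by (cases e1; cases e2; cases e3) (simp add: v3_defs algebra_simps)
  then have Df: "det3 f e2 e3 \<noteq> 0" using D by simp
  obtain h0 h1 h2 h3 where h: "\<not> (h0 = 0 \<and> h1 = 0 \<and> h2 = 0 \<and> h3 = 0)"
    "\<And>x. h0 * M f f f f x + h1 * M f f f e2 x + h2 * M f f e2 e2 x + h3 * M f e2 e2 e2 x = 0"
    using relation_quartic[OF Df] by blast
  have lift: ?thesis if "bad (e2 + sm (- s) f) f" for s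
  proof -
    have "e2 + sm (- s) f = sm (- s) e1 + sm (1 + s * r) e2" "f = sm 1 e1 + sm (- r) e2"
      unfolding f_def by (cases e1; cases e2; simp add: v3_defs algebra_simps)+
    then have "bad (sm (- s) e1 + sm (1 + s * r) e2) (sm 1 e1 + sm (- r) e2)" using that by metis
    moreover have "(- s) * (- r) - 1 * (1 + s * r) \<noteq> 0" by simp
    ultimately show ?thesis by blast
  qed
  let ?P = "[:p0, p1, p2, p3, p4:]" and ?Q = "[:h0, h1, h2, h3:]"
  show ?thesis
  proof (cases "\<exists>s. double_root ?P s \<and> double_root ?Q s")
    case True
    then obtain s where s: "double_root ?P s" "double_root ?Q s" by blast
    show ?thesis by (rule lift, rule bad_of_common_double_root[OF s p4 h(1) p h(2)])
  next
    case False
    then have "finite {t. \<exists>s. double_root (?P + smult t ?Q) s}" by (intro pencil_squarefree) blast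
    from ex_avoid[OF this] obtain t where t: "\<And>s. \<not> double_root (?P + smult t ?Q) s" by blast
    define d0 d1 d2 d3 where "d0 = p0 + t * h0" and "d1 = p1 + t * h1" and "d2 = p2 + t * h2" and "d3 = p3 + t * h3"
    let ?R = "[:d0, d1, d2, d3, p4:]"
    have "?P + smult t ?Q = ?R" by (simp add: d0_def d1_def d2_def d3_def)
    then have R: "\<not> double_root ?R s" for s using t by simp
    have d: "d0 * M f f f f x + d1 * M f f f e2 x + d2 * M f f e2 e2 x + d3 * M f e2 e2 e2 x + p4 * M e2 e2 e2 e2 x = 0" for x
    proof -
      have "d0 * M f f f f x + d1 * M f f f e2 x + d2 * M f f e2 e2 x + d3 * M f e2 e2 e2 x + p4 * M e2 e2 e2 e2 x
        = (p0 * M f f f f x + p1 * M f f f e2 x + p2 * M f f e2 e2 x + p3 * M f e2 e2 e2 x + p4 * M e2 e2 e2 e2 x)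
        + t * (h0 * M f f f f x + h1 * M f f f e2 x + h2 * M f f e2 e2 x + h3 * M f e2 e2 e2 x)"
        unfolding d0_def d1_def d2_def d3_def by (simp add: algebra_simps)
      then show ?thesis using p h(2) by simp
    qed
    define Z where "Z = {z. poly ?R z = 0}"
    have R0: "?R \<noteq> 0" using p4 by simp
    have deg: "degree ?R = 4" using p4 by simp
    have fin: "finite Z" unfolding Z_def using poly_roots_finite[OF R0] .
    have card: "card Z = degree ?R" unfolding Z_def using squarefree_roots R .
    have root: "poly ?R z = 0" if "z \<in> Z" for z using that by (simp add: Z_def)
    let ?m = "mom M f e2 e3"
    \<comment> \<open>Pairing the quartic relation with f and e2 gives the two recurrences needed
      for c = 0, pairing with e3 the one for c = 1; for c = 2 four nodes fit the four moments
      without any condition.\<close>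
    have "\<exists>a. \<forall>j\<le>5. ?m j 0 = (\<Sum>z\<in>Z. a z * z ^ j)"
    proof (rule quadrature[OF fin root card R0])
      fix j assume "j + degree ?R \<le> 5"
      then consider "j = 0" | "j = 1" unfolding deg by linarith
      then show "(\<Sum>l\<le>degree ?R. coeff ?R l * ?m (l + j) 0) = 0"
        unfolding deg using d[of f] d[of e2]
        by cases (simp_all add: eval_nat_numeral mom_def M_ac)
    qed
    then obtain a where a: "\<And>j. j \<le> 5 \<Longrightarrow> ?m j 0 = (\<Sum>z\<in>Z. a z * z ^ j)" by blast
    have "\<exists>b. \<forall>j\<le>4. ?m j 1 = (\<Sum>z\<in>Z. b z * z ^ j)"
    proof (rule quadrature[OF fin root card R0])
      fix j assume "j + degree ?R \<le> 4"
      then have "j = 0" unfolding deg by linarith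
      then show "(\<Sum>l\<le>degree ?R. coeff ?R l * ?m (l + j) 1) = 0"
        unfolding deg using d[of e3]
        by (simp add: eval_nat_numeral mom_def M_ac)
    qed
    then obtain b where b: "\<And>j. j \<le> 4 \<Longrightarrow> ?m j 1 = (\<Sum>z\<in>Z. b z * z ^ j)" by blast
    obtain g where g: "\<And>j. j < card Z \<Longrightarrow> ?m j 2 = (\<Sum>z\<in>Z. g z * z ^ j)"
      using vandermonde_solve[OF fin, of "\<lambda>j. ?m j 2"] by blast
    define A where "A z c = (if c = 0 then a z else if c = 1 then b z else g z)" for z and c :: nat
    have mA: "?m j c = (\<Sum>z\<in>Z. z ^ j * A z c)" if jc: "j + c \<le> 5" "c \<le> 2" for j c
    proof -
      consider "c = 0" | "c = 1" | "c = 2" using jc(2) by linarith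
      then show ?thesis
      proof cases
        case 1 then show ?thesis using a[of j] jc by (simp add: A_def mult.commute)
      next
        case 2 then show ?thesis using b[of j] jc by (simp add: A_def mult.commute)
      next
        case 3 then show ?thesis using g[of j] jc card deg by (simp add: A_def mult.commute)
      qed
    qed
    show ?thesis
    proof (cases "\<exists>i\<in>Z. \<exists>j\<in>Z. i \<noteq> j \<and> A i 0 \<noteq> 0 \<and> A j 0 \<noteq> 0")
      case True
      have "trank 10 ?m" by (rule trank_concurrent[where Z = Z and A = A]) (use card deg in simp, rule mA, assumption+, rule True)
      then show ?thesis using qrank_if_trank[OF Df] by blast
    next
      case no: False
      obtain z where z: "z \<in> Z" "\<And>y. y \<in> Z \<Longrightarrow> y \<noteq> z \<Longrightarrow> a y = 0"
      proof (cases "\<exists>z\<in>Z. a z \<noteq> 0")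
        case True
        then obtain z where "z \<in> Z" "a z \<noteq> 0" by blast
        then show ?thesis using that[of z] no by (auto simp: A_def)
      next
        case False
        have "Z \<noteq> {}" using card deg by auto
        then show ?thesis using that False by blast
      qed
      \<comment> \<open>Only one line carries a moment with c = 0, so on the plane of f and e2 the
        form is a multiple of one fifth power.\<close>
      have "?m j 0 = a z * z ^ j" if "j \<le> 5" for j
      proof -
        have "(\<Sum>y\<in>Z. a y * y ^ j) = (\<Sum>y\<in>{z}. a y * y ^ j)"
          by (rule sum.mono_neutral_right) (use fin z in auto)
        then show ?thesis using a[OF that] by simp
      qed
      note mz = this[of 0] this[of 1] this[of 2] this[of 3] this[of 4] this[of 5]
      have "bad (e2 + sm (- z) f) f"
        by (rule bad_of_fifth_power[OF Df, of "a z"]) (use mz in \<open>simp_all add: mom_eval[unfolded One_nat_def]\<close>)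
      then show ?thesis by (rule lift)
    qed
  qed
qed

end

section \<open>Linear forms, cones and sums of two binary quintics\<close>

lemma poly_coeff_zero:
  fixes p :: "'k::field_char_0 poly"
  assumes "\<And>x. poly p x = 0"
  shows "coeff p n = 0"
  using assms poly_all_0_iff_0[of p] by simp

lemma sm_simps [simp]: "sm 0 a = 0" "sm 1 a = a" "sm k 0 = 0" "sm k (sm l a) = sm (k * l) a"
  by (cases a; simp add: v3_defs algebra_simps)+

definition lin :: "('k::comm_ring_1 v3 \<Rightarrow> 'k) \<Rightarrow> bool"
  where "lin f \<longleftrightarrow> (\<forall>x y. f (x + y) = f x + f y) \<and> (\<forall>k x. f (sm k x) = k * f x)"

lemma lin_dot:
  fixes f :: "'k::comm_ring_1 v3 \<Rightarrow> 'k"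
  assumes f: "lin f"
  shows "\<exists>l. \<forall>x. f x = dot l x"
proof (intro exI allI)
  fix x :: "'k v3"
  obtain a b c where x: "x = (a, b, c)" by (cases x)
  have e: "x = sm a (1, 0, 0) + (sm b (0, 1, 0) + sm c (0, 0, 1))" by (simp add: x sm_def)
  show "f x = dot (f (1, 0, 0), f (0, 1, 0), f (0, 0, 1)) x"
  proof -
    have a: "f (x + y) = f x + f y" and k: "f (sm k x) = k * f x" for x y k using f by (simp_all only: lin_def)
    show ?thesis by (subst e) (simp only: a k, simp add: dot_def x mult.commute)
  qed
qed

lemma linI:
  assumes "\<And>x y. f (x + y) = f x + f y" "\<And>k x. f (sm k x) = k * f x"
  shows "lin f"
  using assms by (simp add: lin_def)

lemma ex_det3: "cross a b \<noteq> 0 \<Longrightarrow> \<exists>e. det3 e a (b :: 'k::field v3) \<noteq> 0"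
proof -
  assume n: "cross a b \<noteq> 0"
  obtain x y z where c: "cross a b = (x, y, z)" by (metis surj_pair)
  then consider "x \<noteq> 0" | "y \<noteq> 0" | "z \<noteq> 0" using n by (auto simp: zero_prod_def)
  then show ?thesis
  proof cases
    case 1 then show ?thesis by (intro exI[of _ "(1, 0, 0)"]) (simp add: det3_def dot_def c)
  next
    case 2 then show ?thesis by (intro exI[of _ "(0, 1, 0)"]) (simp add: det3_def dot_def c)
  next
    case 3 then show ?thesis by (intro exI[of _ "(0, 0, 1)"]) (simp add: det3_def dot_def c)
  qed
qed

lemma ex_cross: "a \<noteq> 0 \<Longrightarrow> \<exists>b. cross a (b :: 'k::field v3) \<noteq> 0"
proof -
  assume n: "a \<noteq> 0"
  obtain x y z where a: "a = (x, y, z)" by (metis surj_pair)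
  then consider "x \<noteq> 0" | "y \<noteq> 0" | "z \<noteq> 0" using n by (auto simp: zero_prod_def)
  then show ?thesis
  proof cases
    case 1 then show ?thesis by (intro exI[of _ "(0, 1, 0)"]) (simp add: v3_defs a)
  next
    case 2 then show ?thesis by (intro exI[of _ "(0, 0, 1)"]) (simp add: v3_defs a)
  next
    case 3 then show ?thesis by (intro exI[of _ "(1, 0, 0)"]) (simp add: v3_defs a)
  qed
qed

lemma det3_transpose: "det3 a b c = - dot b (cross a c)"
  by (cases a; cases b; cases c) (simp add: v3_defs algebra_simps)

lemma coplanar_combination:
  fixes a :: "'k::field v3"
  assumes n: "cross a b \<noteq> 0" and d: "det3 a b c = 0"
  shows "\<exists>p q. c = sm p a + sm q b"
proof -
  obtain e where e: "det3 e a b \<noteq> 0" using ex_det3[OF n] by blast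
  have "det3 c a b = 0" using d det3_cycle[of b c a] det3_cycle[of c a b] by simp
  then have "c = sm (det3 e c b / det3 e a b) a + sm (det3 e a c / det3 e a b) b"
    using cramer[OF e, of c] by simp
  then show ?thesis by blast
qed

lemma cross_scale: "cross (sm p a) b = sm p (cross a b)" "cross a (sm p b) = sm p (cross a b)"
  "cross (a + a') b = cross a b + cross a' b" "cross a (b + b') = cross a b + cross a b'" "cross a a = 0"
  by (cases a; cases a'; cases b; cases b'; simp add: v3_defs algebra_simps)+

lemma qrank_mono: "qrank n M \<Longrightarrow> n \<le> n' \<Longrightarrow> qrank n' M"
  unfolding qrank_def by (elim exE conjE, rule exI, rule conjI, rule order_trans)

lemma qrank_Suc:
  fixes c :: "'k::alg_closed_field"
  assumes f: "lin f" and N: "qrank n (\<lambda>a b c' d e. M a b c' d e - c * (f a * f b * f c' * f d * f e))"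
  shows "qrank (Suc n) M"
proof -
  obtain l where l: "\<And>x. f x = dot l x" using lin_dot[OF f] by blast
  obtain k where k: "k ^ 5 = c" using fifth_root by blast
  obtain ls where ls: "length ls \<le> n" "\<And>a b c' d e. M a b c' d e - c * (f a * f b * f c' * f d * f e)
    = (\<Sum>l\<leftarrow>ls. dot l a * dot l b * dot l c' * dot l d * dot l e)" using N unfolding qrank_def by blast
  have "M a b c' d e = (\<Sum>l\<leftarrow>sm k l # ls. dot l a * dot l b * dot l c' * dot l d * dot l e)" for a b c' d e
    using ls(2)[of a b c' d e] by (simp add: l dot_lin k[symmetric] eval_nat_numeral algebra_simps)
  moreover have "length (sm k l # ls) \<le> Suc n" using ls(1) by simp
  ultimately show ?thesis unfolding qrank_def by (intro exI[of _ "sm k l # ls"] conjI allI)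
qed

lemma qrank_0: "(\<And>a b c d e. M a b c d e = 0) \<Longrightarrow> qrank n M"
  unfolding qrank_def by (intro exI[of _ "[]"]) simp

lemma trank_binary:
  fixes m :: "nat \<Rightarrow> nat \<Rightarrow> 'k::{alg_closed_field, field_char_0}"
  assumes "m 0 0 \<noteq> 0" and z: "\<And>b c. b + c \<le> 5 \<Longrightarrow> c \<ge> 1 \<Longrightarrow> m b c = 0"
  shows "trank 5 m"
proof -
  have "brank 5 ((!) [m 0 0, m 1 0, m 2 0, m 3 0, m 4 0, m 5 0])" using assms(1) by (rule brank_5)
  then obtain ps where ps: "length ps \<le> 5" "\<And>j. j \<le> 5 \<Longrightarrow> [m 0 0, m 1 0, m 2 0, m 3 0, m 4 0, m 5 0] ! j = (\<Sum>(u, w)\<leftarrow>ps. u ^ (5 - j) * w ^ j)"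
    unfolding brank_def by blast
  let ?ts = "map (\<lambda>(u, w). (u, w, 0)) ps"
  have "m b c = (\<Sum>(u, v, w)\<leftarrow>?ts. u ^ (5 - b - c) * v ^ b * w ^ c)" if bc: "b + c \<le> 5" for b c
  proof (cases "c = 0")
    case True
    then have b: "b \<le> 5" using bc by simp
    then consider "b = 0" | "b = 1" | "b = 2" | "b = 3" | "b = 4" | "b = 5" by linarith
    then have "[m 0 0, m 1 0, m 2 0, m 3 0, m 4 0, m 5 0] ! b = m b 0" by cases simp_all
    then show ?thesis using ps(2)[OF b] True by (simp add: o_def case_prod_unfold)
  next
    case False
    then show ?thesis using z[OF bc] by (simp add: o_def case_prod_unfold zero_power)
  qed
  moreover have "length ?ts \<le> 5" using ps(1) by simp
  ultimately show ?thesis unfolding trank_def by (intro exI[of _ ?ts] conjI allI impI)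
qed

text \<open>The pure power of the shared vector is split as x + (m 0 0 - x) with both parts nonzero,
  so that each of the two binary quintics has rank at most 5 by \<open>brank_5\<close>.\<close>

lemma trank_two_binary:
  fixes m :: "nat \<Rightarrow> nat \<Rightarrow> 'k::{alg_closed_field, field_char_0}"
  assumes z: "\<And>b c. b + c \<le> 5 \<Longrightarrow> b \<ge> 1 \<Longrightarrow> c \<ge> 1 \<Longrightarrow> m b c = 0"
  shows "trank 10 m"
proof -
  have "finite {x. x \<in> {0, m 0 0}}" by simp
  from ex_avoid[OF this] obtain x where x: "x \<noteq> 0" "x \<noteq> m 0 0" by blast
  have "trank 5 (\<lambda>b c. if c = 0 then if b = 0 then x else m b 0 else 0)"
    by (rule trank_binary) (use x in auto)
  then obtain ts where ts: "length ts \<le> 5" "\<And>b c. b + c \<le> 5 \<Longrightarrow>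
    (if c = 0 then if b = 0 then x else m b 0 else 0) = (\<Sum>(u, v, w)\<leftarrow>ts. u ^ (5 - b - c) * v ^ b * w ^ c)"
    unfolding trank_def by blast
  have "trank 5 (\<lambda>b c. if c = 0 then if b = 0 then m 0 0 - x else m 0 b else 0)"
    by (rule trank_binary) (use x in auto)
  then obtain us where us: "length us \<le> 5" "\<And>b c. b + c \<le> 5 \<Longrightarrow>
    (if c = 0 then if b = 0 then m 0 0 - x else m 0 b else 0) = (\<Sum>(u, v, w)\<leftarrow>us. u ^ (5 - b - c) * v ^ b * w ^ c)"
    unfolding trank_def by blast
  let ?us = "map (\<lambda>(u, v, w). (u, w, v)) us"
  have "m b c = (\<Sum>(u, v, w)\<leftarrow>ts @ ?us. u ^ (5 - b - c) * v ^ b * w ^ c)" if bc: "b + c \<le> 5" for b c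
  proof -
    have e: "u ^ (5 - (b + c)) * w ^ b * v ^ c = u ^ (5 - c - b) * v ^ c * w ^ b" for u v w :: 'k
      by (simp add: algebra_simps)
    have "(\<Sum>(u, v, w)\<leftarrow>?us. u ^ (5 - b - c) * v ^ b * w ^ c) = (\<Sum>(u, v, w)\<leftarrow>us. u ^ (5 - c - b) * v ^ c * w ^ b)"
      by (simp add: o_def case_prod_unfold e add.commute)
    also have "\<dots> = (if b = 0 then if c = 0 then m 0 0 - x else m 0 c else 0)" using us(2)[of c b] bc by simp
    finally show ?thesis using ts(2)[OF bc] z[OF bc] by (auto simp: not_less_eq_eq)
  qed
  moreover have "length (ts @ ?us) \<le> 10" using ts(1) us(1) by simp
  ultimately show ?thesis unfolding trank_def by (intro exI[of _ "ts @ ?us"] conjI allI impI)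
qed

context quintic_form
begin

text \<open>The linear coefficient of M at (\<mu> + x c)^5, a polynomial in x that vanishes
  identically. The next three lemmas remove the remaining repetitions in the same way.\<close>

lemma polarize5: "(\<And>\<mu>. M \<mu> \<mu> \<mu> \<mu> \<mu> = 0) \<Longrightarrow> M \<mu> \<mu> \<mu> \<mu> c = 0"
proof -
  assume z: "\<And>\<mu>. M \<mu> \<mu> \<mu> \<mu> \<mu> = 0"
  let ?p = "[:M \<mu> \<mu> \<mu> \<mu> \<mu>, 5 * M \<mu> \<mu> \<mu> \<mu> c, 10 * M \<mu> \<mu> \<mu> c c, 10 * M \<mu> \<mu> c c c, 5 * M \<mu> c c c c, M c c c c c:]"
  have "poly ?p x = M (\<mu> + sm x c) (\<mu> + sm x c) (\<mu> + sm x c) (\<mu> + sm x c) (\<mu> + sm x c)" for x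
    by (simp add: M_lin M_ac algebra_simps)
  then have "poly ?p x = 0" for x using z by simp
  from poly_coeff_zero[OF this, of 1] show ?thesis by simp
qed

lemma polarize4: "(\<And>\<mu>. M \<mu> \<mu> \<mu> \<mu> x = 0) \<Longrightarrow> M \<mu> \<mu> \<mu> c x = 0"
proof -
  assume z: "\<And>\<mu>. M \<mu> \<mu> \<mu> \<mu> x = 0"
  let ?p = "[:M \<mu> \<mu> \<mu> \<mu> x, 4 * M \<mu> \<mu> \<mu> c x, 6 * M \<mu> \<mu> c c x, 4 * M \<mu> c c c x, M c c c c x:]"
  have "poly ?p t = M (\<mu> + sm t c) (\<mu> + sm t c) (\<mu> + sm t c) (\<mu> + sm t c) x" for t
    by (simp add: M_lin M_ac algebra_simps)
  then have "poly ?p t = 0" for t using z by simp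
  from poly_coeff_zero[OF this, of 1] show ?thesis by simp
qed

lemma polarize3: "(\<And>\<mu>. M \<mu> \<mu> \<mu> x y = 0) \<Longrightarrow> M \<mu> \<mu> c x y = 0"
proof -
  assume z: "\<And>\<mu>. M \<mu> \<mu> \<mu> x y = 0"
  let ?p = "[:M \<mu> \<mu> \<mu> x y, 3 * M \<mu> \<mu> c x y, 3 * M \<mu> c c x y, M c c c x y:]"
  have "poly ?p t = M (\<mu> + sm t c) (\<mu> + sm t c) (\<mu> + sm t c) x y" for t
    by (simp add: M_lin M_ac algebra_simps)
  then have "poly ?p t = 0" for t using z by simp
  from poly_coeff_zero[OF this, of 1] show ?thesis by simp
qed

lemma polarize2: "(\<And>\<mu>. M \<mu> \<mu> x y z = 0) \<Longrightarrow> M \<mu> c x y z = 0"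
proof -
  assume z: "\<And>\<mu>. M \<mu> \<mu> x y z = 0"
  have "M (\<mu> + c) (\<mu> + c) x y z = M \<mu> \<mu> x y z + 2 * M \<mu> c x y z + M c c x y z"
    by (simp add: M_lin M_ac algebra_simps)
  then show ?thesis using z by simp
qed

lemma cone_if_polar4: "(\<And>\<mu>. M \<mu> \<mu> \<mu> \<mu> x = 0) \<Longrightarrow> M a b c d x = 0"
proof -
  assume z: "\<And>\<mu>. M \<mu> \<mu> \<mu> \<mu> x = 0"
  have 3: "M \<mu> \<mu> \<mu> c x = 0" for \<mu> c using polarize4[OF z] .
  have 2: "M \<mu> \<mu> b c x = 0" for \<mu> b c using polarize3[OF 3] .
  show ?thesis by (rule polarize2[OF 2])
qed

lemma zero_if_polar5: "(\<And>\<mu>. M \<mu> \<mu> \<mu> \<mu> \<mu> = 0) \<Longrightarrow> M a b c d e = 0"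
  by (rule cone_if_polar4, rule polarize5)

text \<open>f depends on two variables only. The basis starts with a vector where f is nonzero, as
  \<open>trank_binary\<close> requires; it is independent of k because f vanishes on multiples of
  k.\<close>

lemma qrank_cone:
  assumes k: "k \<noteq> 0" and z: "\<And>a b c d. M k a b c d = 0"
  shows "qrank 5 M"
proof (cases "\<forall>x. M x x x x x = 0")
  case True
  then show ?thesis using zero_if_polar5 by (intro qrank_0) blast
next
  case False
  then obtain x where x: "M x x x x x \<noteq> 0" by blast
  have "cross k x \<noteq> 0"
  proof
    assume c: "cross k x = 0"
    obtain b where b: "cross k b \<noteq> 0" using ex_cross[OF k] by blast
    have "det3 k b x = 0" using det3_transpose[of k b x] c by (simp add: dot_def zero_prod_def split: prod.splits)
    then obtain p q where pq: "x = sm p k + sm q b" using coplanar_combination[OF b] by blast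
    have "sm q (cross k b) = 0" using c by (simp add: pq cross_scale)
    then have "q = 0" using b by (cases "cross k b") (auto simp: sm_def zero_prod_def)
    then show False using x z by (simp add: pq M_lin)
  qed
  then obtain e where "det3 e k x \<noteq> 0" using ex_det3 by blast
  then have D: "det3 x e k \<noteq> 0" using det3_cycle[of e k x] by simp
  have "trank 5 (mom M x e k)"
  proof (rule trank_binary)
    show "mom M x e k 0 0 \<noteq> 0" using x by (simp add: mom_eval)
    fix b c :: nat assume bc: "b + c \<le> 5" "1 \<le> c"
    obtain x1 x2 x3 x4 x5 where L: "replicate (5 - b - c) x @ replicate b e @ replicate c k = [x1, x2, x3, x4, x5]"
      "\<And>M. mom M x e k b c = M x1 x2 x3 x4 x5" by (rule mom_args[OF bc(1), where p = x and q = e and r = k]) blast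
    have "last (replicate (5 - b - c) x @ replicate b e @ replicate c k) = k" using bc(2) by simp
    then have "x5 = k" unfolding L by simp
    moreover have "M x1 x2 x3 x4 k = M k x1 x2 x3 x4" by (simp only: M_ac)
    ultimately show "mom M x e k b c = 0" using z by (simp add: L(2))
  qed
  then show ?thesis by (rule qrank_if_trank[OF D])
qed

text \<open>At least three arguments from the plane of a and b give 0, so f is the cube of the
  linear form defining the plane times a conic. A basis f, g of the plane that is orthogonal for M x
  y e e e kills the last mixed moment, and two binary quintics remain.\<close>

lemma qrank_cube_times_conic:
  assumes n: "cross a b \<noteq> 0" and z: "\<And>x y. M a a a x y = 0" "\<And>x y. M a a b x y = 0" "\<And>x y. M a b b x y = 0" "\<And>x y. M b b b x y = 0"
  shows "qrank 10 M"
proof -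
  obtain e where e: "det3 e a b \<noteq> 0" using ex_det3[OF n] by blast
  let ?B = "\<lambda>x y. M x y e e e"
  have "\<exists>p q p' q'. p * q' - p' * q \<noteq> 0 \<and> ?B (sm p a + sm q b) (sm p' a + sm q' b) = 0"
  proof (cases "?B a a = 0")
    case aa: True
    show ?thesis
    proof (cases "?B b b = 0")
      case True
      \<comment> \<open>For isotropic a and b the vectors a + b and a - b are orthogonal; in the
        other cases one Gram-Schmidt step suffices.\<close>
      then have "?B (sm 1 a + sm 1 b) (sm 1 a + sm (-1) b) = 0" using aa sw12[of a b] by (simp add: M_lin)
      then show ?thesis by (intro exI[of _ 1] exI[of _ "-1"] conjI) auto
    next
      case False
      then have "?B (sm 1 a + sm (- ?B a b / ?B b b) b) (sm 0 a + sm 1 b) = 0" by (simp add: M_lin)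
      moreover have "(1::'k) * 1 - 0 * (- ?B a b / ?B b b) \<noteq> 0" by simp
      ultimately show ?thesis by blast
    qed
  next
    case False
    then have "?B (sm 1 a + sm 0 b) (sm (- ?B a b / ?B a a) a + sm 1 b) = 0" by (simp add: M_lin)
    moreover have "(1::'k) * 1 - (- ?B a b / ?B a a) * 0 \<noteq> 0" by simp
    ultimately show ?thesis by blast
  qed
  then obtain p q p' q' where pq: "p * q' - p' * q \<noteq> 0" and B: "?B (sm p a + sm q b) (sm p' a + sm q' b) = 0" by blast
  define f g where "f = sm p a + sm q b" and "g = sm p' a + sm q' b"
  have zab: "M x y w u v = 0" if "x = a \<or> x = b" "y = a \<or> y = b" "w = a \<or> w = b" for x y w u v
    using that by (elim disjE; hypsubst; simp only: z sw12[of b a] sw23[of _ b a])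
  have zfg: "M x y w u v = 0" if "x = f \<or> x = g" "y = f \<or> y = g" "w = f \<or> w = g" for x y w u v
    using that unfolding f_def g_def by (elim disjE; hypsubst; simp add: M_lin zab)
  have D: "det3 e f g \<noteq> 0"
  proof -
    have "det3 e f g = (p * q' - p' * q) * det3 e a b"
      unfolding f_def g_def by (cases e; cases a; cases b) (simp add: v3_defs algebra_simps)
    then show ?thesis using pq e by simp
  qed
  have "trank 10 (mom M e f g)"
  proof (rule trank_two_binary)
    fix b c :: nat assume bc: "b + c \<le> 5" "1 \<le> b" "1 \<le> c"
    obtain x1 x2 x3 x4 x5 where L: "replicate (5 - b - c) e @ replicate b f @ replicate c g = [x1, x2, x3, x4, x5]"
      "\<And>M. mom M e f g b c = M x1 x2 x3 x4 x5" by (rule mom_args[OF bc(1), where p = e and q = f and r = g]) blast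
    show "mom M e f g b c = 0"
    proof (cases "b = 1 \<and> c = 1")
      case True
      have "M f g e e e = M e e e f g" by (simp only: M_ac)
      then show ?thesis using B True mom_eval(8)[of M e f g] by (simp only: f_def[symmetric] g_def[symmetric])
    next
      case False
      then have s: "3 \<le> b + c" using bc by linarith
      have "drop 2 (replicate (5 - b - c) e @ replicate b f @ replicate c g) = replicate (b - (2 - (5 - b - c))) f @ replicate (c - (2 - (5 - b - c) - b)) g"
        using bc s by simp
      then have "set [x3, x4, x5] \<subseteq> {f, g}" unfolding L by (auto simp: drop_Cons' dest: arg_cong[of _ _ set] split: if_splits)
      then have "M x3 x4 x5 x1 x2 = 0" by (intro zfg) auto
      moreover have "M x1 x2 x3 x4 x5 = M x3 x4 x5 x1 x2" by (simp only: M_ac)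
      ultimately show ?thesis by (simp add: L(2))
    qed
  qed
  then show ?thesis by (rule qrank_if_trank[OF D])
qed

section \<open>Special points and forms with infinitely many of them\<close>

definition alpha :: "'k v3 \<Rightarrow> bool"
  where "alpha \<mu> \<longleftrightarrow> (\<forall>x y. M \<mu> \<mu> \<mu> x y = 0)"

text \<open>While \<open>alpha\<close> makes \<mu> a point of multiplicity at least 3 of f, here the
  cubic polar at \<mu>^2 is a multiple of the cube of a linear form that does not vanish at \<mu>.
  The normalization makes c the value of f at \<mu>.\<close>

definition beta :: "'k v3 \<Rightarrow> 'k \<Rightarrow> ('k v3 \<Rightarrow> 'k) \<Rightarrow> bool"
  where "beta \<mu> c l \<longleftrightarrow> lin l \<and> c \<noteq> 0 \<and> l \<mu> = 1 \<and> (\<forall>x y w. M \<mu> \<mu> x y w = c * l x * l y * l w)"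

lemma par_D: "par f g \<Longrightarrow> f x * g y = f y * g x"
  by (simp add: par_def)

text \<open>The change of b acts on the three polars by a triangular substitution, which keeps them
  pairwise proportional.\<close>

lemma bad_shift:
  assumes "bad \<mu> b"
  shows "bad \<mu> (sm l b + sm k \<mu>)"
proof -
  let ?v0 = "M \<mu> \<mu> \<mu> \<mu>" and ?v1 = "M \<mu> \<mu> \<mu> b" and ?v2 = "M \<mu> \<mu> b b"
  have p: "?v0 x * ?v1 y = ?v0 y * ?v1 x" "?v0 x * ?v2 y = ?v0 y * ?v2 x" "?v1 x * ?v2 y = ?v1 y * ?v2 x" for x y
    using assms unfolding bad_def by (auto dest: par_D)
  have v1: "M \<mu> \<mu> \<mu> (sm l b + sm k \<mu>) x = l * ?v1 x + k * ?v0 x" for x by (simp add: M_lin)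
  have v2: "M \<mu> \<mu> (sm l b + sm k \<mu>) (sm l b + sm k \<mu>) x = l^2 * ?v2 x + 2 * l * k * ?v1 x + k^2 * ?v0 x" for x
    by (simp add: M_lin sw34[of \<mu> \<mu> \<mu> b] algebra_simps power2_eq_square)
  show ?thesis unfolding bad_def par_def v1 v2
  proof (intro conjI allI)
    fix x y
    show "?v0 x * (l * ?v1 y + k * ?v0 y) = ?v0 y * (l * ?v1 x + k * ?v0 x)"
      using p[of x y] by algebra
    show "?v0 x * (l^2 * ?v2 y + 2 * l * k * ?v1 y + k^2 * ?v0 y) = ?v0 y * (l^2 * ?v2 x + 2 * l * k * ?v1 x + k^2 * ?v0 x)"
      using p[of x y] by algebra
    show "(l * ?v1 x + k * ?v0 x) * (l^2 * ?v2 y + 2 * l * k * ?v1 y + k^2 * ?v0 y) = (l * ?v1 y + k * ?v0 y) * (l^2 * ?v2 x + 2 * l * k * ?v1 x + k^2 * ?v0 x)"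
      using p[of x y] by algebra
  qed
qed

lemma bad_scale: "bad \<mu> b \<Longrightarrow> bad (sm k \<mu>) b"
proof -
  assume b: "bad \<mu> b"
  have "M (sm k \<mu>) (sm k \<mu>) (sm k \<mu>) (sm k \<mu>) x = k^4 * M \<mu> \<mu> \<mu> \<mu> x"
    "M (sm k \<mu>) (sm k \<mu>) (sm k \<mu>) b x = k^3 * M \<mu> \<mu> \<mu> b x" "M (sm k \<mu>) (sm k \<mu>) b b x = k^2 * M \<mu> \<mu> b b x" for x
    by (simp_all add: M_lin eval_nat_numeral)
  then show ?thesis using b unfolding bad_def par_def by (simp add: algebra_simps)
qed

lemma good_or_bad_point:
  assumes D: "det3 e1 e2 e3 \<noteq> 0"
  shows "qrank 10 M \<or> (\<exists>x y. (x \<noteq> 0 \<or> y \<noteq> 0) \<and> (\<forall>s t. bad (sm x e1 + sm y e2) (sm s e1 + sm t e2)))"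
proof -
  have "\<exists>x y. (x \<noteq> 0 \<or> y \<noteq> 0) \<and> (\<forall>s t. bad (sm x e1 + sm y e2) (sm s e1 + sm t e2))"
    if d: "x * y' - x' * y \<noteq> 0" and b: "bad (sm x e1 + sm y e2) (sm x' e1 + sm y' e2)" for x y x' y'
  proof (rule exI[of _ x], rule exI[of _ y], intro conjI allI)
    show "x \<noteq> 0 \<or> y \<noteq> 0" using d by auto
    fix s t :: 'k
    define d where "d = x * y' - x' * y"
    define l where "l = (x * t - y * s) / d"
    define k where "k = (s * y' - t * x') / d"
    have d0: "d \<noteq> 0" using that by (simp add: d_def)
    have lk: "l * d = x * t - y * s" "k * d = s * y' - t * x'" using d0 by (simp_all add: l_def k_def)
    have "d * (l * x' + k * x) = d * s" "d * (l * y' + k * y) = d * t"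
      using lk unfolding d_def by algebra+
    then have st: "s = l * x' + k * x" "t = l * y' + k * y" using d0 by auto
    have "sm s e1 + sm t e2 = sm l (sm x' e1 + sm y' e2) + sm k (sm x e1 + sm y e2)"
      unfolding st by (cases e1; cases e2) (simp add: v3_defs algebra_simps)
    then show "bad (sm x e1 + sm y e2) (sm s e1 + sm t e2)" using bad_shift[OF b] by simp
  qed
  then show ?thesis using good_or_bad[OF D] by blast
qed

text \<open>If the gradient polar vanishes at \<mu>, the Hessian form has three isotropic directions
  modulo \<mu> and is zero. If not, b1 and b2 can be corrected by \<mu> so that their polars with
  \<mu>^3 vanish; badness then kills every moment of the cubic polar except the one at
  \<mu>^3.\<close>

lemma three_bad_directions:
  assumes D: "det3 \<mu> b1 b2 \<noteq> 0" and b: "bad \<mu> b1" "bad \<mu> b2" "bad \<mu> (sm x b1 + sm y b2)" and xy: "x \<noteq> 0" "y \<noteq> 0"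
  shows "alpha \<mu> \<or> (\<exists>c l. beta \<mu> c l)"
proof (cases "\<forall>x. M \<mu> \<mu> \<mu> \<mu> x = 0")
  case True
  then have T: "M \<mu> \<mu> \<mu> \<mu> x = 0" for x by blast
  have iso: "M \<mu> \<mu> \<mu> b b = 0" if "bad \<mu> b" for b
  proof -
    \<comment> \<open>Proportionality of the last two polars, evaluated at b and \<mu>: the left
      side is the square of the Hessian form at b, and the right side contains the vanishing
      gradient.\<close>
    have "M \<mu> \<mu> \<mu> b b * M \<mu> \<mu> b b \<mu> = M \<mu> \<mu> \<mu> b \<mu> * M \<mu> \<mu> b b b"
      using that unfolding bad_def by (auto dest: par_D)
    moreover have "M \<mu> \<mu> \<mu> b \<mu> = M \<mu> \<mu> \<mu> \<mu> b" "M \<mu> \<mu> b b \<mu> = M \<mu> \<mu> \<mu> b b" by (simp_all only: M_ac)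
    ultimately show ?thesis by (simp add: T)
  qed
  have "M \<mu> \<mu> \<mu> (sm x b1 + sm y b2) (sm x b1 + sm y b2) = x^2 * M \<mu> \<mu> \<mu> b1 b1 + 2 * x * y * M \<mu> \<mu> \<mu> b1 b2 + y^2 * M \<mu> \<mu> \<mu> b2 b2"
    by (simp add: M_lin sw45[of \<mu> \<mu> \<mu> b2 b1] algebra_simps power2_eq_square)
  then have b12: "M \<mu> \<mu> \<mu> b1 b2 = 0" using iso[OF b(1)] iso[OF b(2)] iso[OF b(3)] xy by simp
  have base: "M \<mu> \<mu> \<mu> u v = 0" if "u \<in> {\<mu>, b1, b2}" "v \<in> {\<mu>, b1, b2}" for u v
    using that by (elim insertE emptyE; hypsubst; simp add: T b12 iso[OF b(1)] iso[OF b(2)] sw45[of \<mu> \<mu> \<mu> b1 \<mu>] sw45[of \<mu> \<mu> \<mu> b2 \<mu>] sw45[of \<mu> \<mu> \<mu> b2 b1])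
  have base1: "M \<mu> \<mu> \<mu> u v = 0" if "v \<in> {\<mu>, b1, b2}" for u v
    by (rule basis_induct[OF D, of "\<lambda>u. M \<mu> \<mu> \<mu> u v = 0"]) (simp_all add: M_lin base[OF _ that])
  have "M \<mu> \<mu> \<mu> u v = 0" for u v
    by (rule basis_induct[OF D, of "\<lambda>v. M \<mu> \<mu> \<mu> u v = 0"]) (simp_all add: M_lin base1)
  then have "alpha \<mu>" unfolding alpha_def by blast
  then show ?thesis ..
next
  case False
  then obtain x0 where x0: "M \<mu> \<mu> \<mu> \<mu> x0 \<noteq> 0" by blast
  have mult: "\<exists>k. \<forall>y. f y = k * M \<mu> \<mu> \<mu> \<mu> y" if "par (M \<mu> \<mu> \<mu> \<mu>) f" for f
  proof (intro exI allI)
    fix y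
    have "M \<mu> \<mu> \<mu> \<mu> x0 * f y = M \<mu> \<mu> \<mu> \<mu> y * f x0" using par_D[OF that] .
    then show "f y = f x0 / M \<mu> \<mu> \<mu> \<mu> x0 * M \<mu> \<mu> \<mu> \<mu> y" using x0 by (simp add: field_simps)
  qed
  obtain k1 where k1: "\<And>y. M \<mu> \<mu> \<mu> b1 y = k1 * M \<mu> \<mu> \<mu> \<mu> y" using mult b(1) unfolding bad_def by blast
  obtain k2 where k2: "\<And>y. M \<mu> \<mu> \<mu> b2 y = k2 * M \<mu> \<mu> \<mu> \<mu> y" using mult b(2) unfolding bad_def by blast
  define a where "a = M \<mu> \<mu> \<mu> \<mu> \<mu>"
  define f1 where "f1 = sm 1 b1 + sm (- k1) \<mu>"
  define f2 where "f2 = sm 1 b2 + sm (- k2) \<mu>"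
  have f: "M \<mu> \<mu> \<mu> f1 y = 0" "M \<mu> \<mu> \<mu> f2 y = 0" for y by (simp_all add: f1_def f2_def M_lin k1 k2 del: sm_simps)
  have "bad \<mu> f1" "bad \<mu> f2" unfolding f1_def f2_def using b bad_shift by blast+
  then obtain l1 l2 where l: "\<And>y. M \<mu> \<mu> f1 f1 y = l1 * M \<mu> \<mu> \<mu> \<mu> y" "\<And>y. M \<mu> \<mu> f2 f2 y = l2 * M \<mu> \<mu> \<mu> \<mu> y"
    using mult[of "M \<mu> \<mu> f1 f1"] mult[of "M \<mu> \<mu> f2 f2"] unfolding bad_def by blast
  have v0f: "M \<mu> \<mu> \<mu> \<mu> f1 = 0" "M \<mu> \<mu> \<mu> \<mu> f2 = 0" using f[of \<mu>] by (simp_all only: sw45[of \<mu> \<mu> \<mu> \<mu>])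
  have "det3 \<mu> f1 f2 = det3 \<mu> b1 b2"
    unfolding f1_def f2_def by (cases \<mu>; cases b1; cases b2) (simp add: v3_defs algebra_simps)
  then have D': "det3 \<mu> f1 f2 \<noteq> 0" using D by simp
  have a0: "a \<noteq> 0"
  proof
    assume a: "a = 0"
    have "M \<mu> \<mu> \<mu> \<mu> x0 = 0"
      by (rule basis_induct[OF D', of "\<lambda>y. M \<mu> \<mu> \<mu> \<mu> y = 0"]) (simp_all add: M_lin v0f a a_def[symmetric])
    then show False using x0 by simp
  qed
  define L where "L y = M \<mu> \<mu> \<mu> \<mu> y / a" for y
  have Ll: "lin L" by (rule linI) (simp_all add: L_def M_lin add_divide_distrib)
  have L: "L \<mu> = 1" "L f1 = 0" "L f2 = 0" using a0 by (simp_all add: L_def a_def[symmetric] v0f)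
  have La: "L (x + y) = L x + L y" "L (sm k x) = k * L x" for x y k using Ll by (simp_all only: lin_def)
  have g: "M \<mu> \<mu> f1 f1 f1 = 0" "M \<mu> \<mu> f1 f1 f2 = 0" "M \<mu> \<mu> f2 f2 f2 = 0" "M \<mu> \<mu> f2 f2 f1 = 0"
    by (simp_all add: l v0f)
  have g1: "M \<mu> \<mu> f1 f2 f1 = 0" by (simp only: sw45[of \<mu> \<mu> f1 f2 f1] g)
  have g2: "M \<mu> \<mu> f2 f1 f1 = 0" by (simp only: sw34[of \<mu> \<mu> f2 f1 f1] g1)
  have g3: "M \<mu> \<mu> f2 f1 f2 = 0" by (simp only: sw45[of \<mu> \<mu> f2 f1 f2] g)
  have g4: "M \<mu> \<mu> f1 f2 f2 = 0" by (simp only: sw34[of \<mu> \<mu> f1 f2 f2] g3)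
  have f3: "M \<mu> \<mu> f1 \<mu> y = 0" "M \<mu> \<mu> f2 \<mu> y = 0" for y
    by (simp_all only: sw34[of \<mu> \<mu> f1 \<mu> y] sw34[of \<mu> \<mu> f2 \<mu> y] f)
  have f4: "M \<mu> \<mu> f1 y \<mu> = 0" "M \<mu> \<mu> f2 y \<mu> = 0" for y
    by (simp_all only: sw45[of \<mu> \<mu> f1 y \<mu>] sw45[of \<mu> \<mu> f2 y \<mu>] f3)
  have f5: "M \<mu> \<mu> \<mu> y f1 = 0" "M \<mu> \<mu> \<mu> y f2 = 0" for y
    by (simp_all only: sw45[of \<mu> \<mu> \<mu> y f1] sw45[of \<mu> \<mu> \<mu> y f2] f)
  let ?E = "{\<mu>, f1, f2}"
  have 0: "M \<mu> \<mu> x y w = a * L x * L y * L w" if "x \<in> ?E" "y \<in> ?E" "w \<in> ?E" for x y w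
    using that by (elim insertE emptyE; hypsubst; simp add: L f f3 f4 f5 g g1 g2 g3 g4 a_def[symmetric])
  have 1: "M \<mu> \<mu> x y w = a * L x * L y * L w" if "y \<in> ?E" "w \<in> ?E" for x y w
    by (rule basis_induct[OF D', of "\<lambda>x. M \<mu> \<mu> x y w = a * L x * L y * L w"]) (simp_all add: M_lin La algebra_simps 0[OF _ that])
  have 2: "M \<mu> \<mu> x y w = a * L x * L y * L w" if "w \<in> ?E" for x y w
    by (rule basis_induct[OF D', of "\<lambda>y. M \<mu> \<mu> x y w = a * L x * L y * L w"]) (simp_all add: M_lin La algebra_simps 1[OF _ that])
  have 3: "M \<mu> \<mu> x y w = a * L x * L y * L w" for x y w
    by (rule basis_induct[OF D', of "\<lambda>w. M \<mu> \<mu> x y w = a * L x * L y * L w"]) (simp_all add: M_lin La algebra_simps 2)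
  have "beta \<mu> a L" unfolding beta_def by (intro conjI allI Ll a0 L(1) 3)
  then show ?thesis by blast
qed

end

lemma lin_power_quintic_form:
  assumes "lin f"
  shows "quintic_form (\<lambda>a b c' d e. C * (f a * f b * f c' * f d * f e))"
proof -
  have f: "f (x + y) = f x + f y" "f (sm k x) = k * f x" for x y k using assms by (simp_all only: lin_def)
  show ?thesis by standard (simp_all add: f algebra_simps)
qed

lemma sm_eq_0_iff: "sm k (a :: 'k::field v3) = 0 \<longleftrightarrow> k = 0 \<or> a = 0"
  by (cases a) (auto simp: sm_def zero_prod_def)

lemma infinite_avoid:
  assumes "infinite A" "finite B"
  obtains x where "x \<in> A" "x \<notin> B"
  using assms by (meson finite_subset subsetI)

lemma four_vectors_dependent:
  fixes v0 :: "'k::field v3"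
  obtains q0 q1 q2 q3 where "\<not> (q0 = 0 \<and> q1 = 0 \<and> q2 = 0 \<and> q3 = 0)"
    "sm q0 v0 + sm q1 v1 + sm q2 v2 + sm q3 v3 = 0"
proof -
  obtain a0 b0 c0 a1 b1 c1 a2 b2 c2 a3 b3 c3 where v: "v0 = (a0, b0, c0)" "v1 = (a1, b1, c1)" "v2 = (a2, b2, c2)" "v3 = (a3, b3, c3)"
    by (cases v0; cases v1; cases v2; cases v3)
  from four_dependent[of a0 a1 a2 a3 b0 b1 b2 b3 c0 c1 c2 c3]
  obtain q0 q1 q2 q3 where "\<not> (q0 = 0 \<and> q1 = 0 \<and> q2 = 0 \<and> q3 = 0)"
    "q0 * a0 + q1 * a1 + q2 * a2 + q3 * a3 = 0" "q0 * b0 + q1 * b1 + q2 * b2 + q3 * b3 = 0"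
    "q0 * c0 + q1 * c1 + q2 * c2 + q3 * c3 = 0" by blast
  then show ?thesis using that[of q0 q1 q2 q3] by (simp add: v sm_def zero_prod_def)
qed

context quintic_form
begin

lemma M_rot: "M x y u v w = M u v w x y" "M x u v w y = M u v w x y" "M x u v y w = M u v x y w" "M x y u v w = M u v x y w"
  "M x y w u v = M u v x y w"
  by (simp_all only: M_ac)

text \<open>Four such points on a line are four zeros of every binary cubic M v v v x y, v on the
  line; these cubics vanish and f is a cube times a conic. Otherwise four points can be found with
  no three collinear, and then f is zero.\<close>

lemma qrank_alpha:
  assumes inf: "infinite A" and al: "\<And>t. t \<in> A \<Longrightarrow> alpha (pt t)"
    and cr: "\<And>s t. s \<in> A \<Longrightarrow> t \<in> A \<Longrightarrow> s \<noteq> t \<Longrightarrow> cross (pt s) (pt t) \<noteq> 0"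
  shows "qrank 10 M"
proof (cases "\<exists>i\<in>A. \<exists>j\<in>A. i \<noteq> j \<and> infinite {t \<in> A. det3 (pt i) (pt j) (pt t) = 0}")
  case True
  then obtain i j where ij: "i \<in> A" "j \<in> A" "i \<noteq> j" and infP: "infinite {t \<in> A. det3 (pt i) (pt j) (pt t) = 0}" by blast
  obtain k where k: "k \<in> A" "det3 (pt i) (pt j) (pt k) = 0" "k \<noteq> i" "k \<noteq> j"
    using infinite_avoid[OF infP, of "{i, j}"] by auto
  obtain l where l: "l \<in> A" "det3 (pt i) (pt j) (pt l) = 0" "l \<noteq> i" "l \<noteq> j" "l \<noteq> k"
    using infinite_avoid[OF infP, of "{i, j, k}"] by auto
  define a b where "a = pt i" and "b = pt j"
  have c: "cross a b \<noteq> 0" using cr[OF ij] by (simp add: a_def b_def)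
  obtain p q where pq: "pt k = sm p a + sm q b" using coplanar_combination[OF c, of "pt k"] k(2) unfolding a_def b_def by blast
  obtain p' q' where pq': "pt l = sm p' a + sm q' b" using coplanar_combination[OF c, of "pt l"] l(2) unfolding a_def b_def by blast
  have "cross a (pt k) = sm q (cross a b)" "cross a (pt l) = sm q' (cross a b)" by (simp_all add: pq pq' cross_scale)
  then have q: "q \<noteq> 0" "q' \<noteq> 0" using cr[OF ij(1) k(1)] cr[OF ij(1) l(1)] k l by (auto simp: a_def)
  have "cross (pt k) b = sm p (cross a b)" "cross (pt l) b = sm p' (cross a b)" by (simp_all add: pq pq' cross_scale)
  then have p: "p \<noteq> 0" "p' \<noteq> 0" using cr[OF k(1) ij(2)] cr[OF l(1) ij(2)] k l by (auto simp: b_def)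
  have "cross (pt k) (pt l) = sm (p * q' - q * p') (cross a b)"
    unfolding pq pq' by (cases a; cases b) (simp add: v3_defs algebra_simps)
  then have d: "p * q' - q * p' \<noteq> 0" using cr[OF k(1) l(1)] l by auto
  have za: "M a a a x y = 0" and zb: "M b b b x y = 0" and zk: "M (pt k) (pt k) (pt k) x y = 0" and zl: "M (pt l) (pt l) (pt l) x y = 0" for x y
    using al[OF ij(1)] al[OF ij(2)] al[OF k(1)] al[OF l(1)] unfolding alpha_def a_def b_def by blast+
  have ex: "M (sm p a + sm q b) (sm p a + sm q b) (sm p a + sm q b) x y = p^3 * M a a a x y + 3 * p * q * (p * M a a b x y + q * M a b b x y) + q^3 * M b b b x y" for p q x y
    by (simp add: M_lin M_ac algebra_simps eval_nat_numeral)
  have e1: "p * M a a b x y + q * M a b b x y = 0" for x y using zk[of x y] unfolding pq ex za zb using p q by simp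
  have e2: "p' * M a a b x y + q' * M a b b x y = 0" for x y using zl[of x y] unfolding pq' ex za zb using p q by simp
  have "(p * q' - q * p') * M a a b x y = 0" "(p * q' - q * p') * M a b b x y = 0" for x y
    using e1[of x y] e2[of x y] by algebra+
  then have "M a a b x y = 0" "M a b b x y = 0" for x y using d by auto
  then show ?thesis by (intro qrank_cube_times_conic[OF c] za zb)
next
  case False
  then have fin: "finite {t \<in> A. det3 (pt i) (pt j) (pt t) = 0}" if "i \<in> A" "j \<in> A" "i \<noteq> j" for i j using that by blast
  obtain i where i: "i \<in> A" using infinite_avoid[OF inf, of "{}"] by blast
  obtain j where j: "j \<in> A" "i \<noteq> j" using infinite_avoid[OF inf, of "{i}"] by auto
  obtain k where k: "k \<in> A" "det3 (pt i) (pt j) (pt k) \<noteq> 0" using infinite_avoid[OF inf fin[OF i j]] by blast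
  have "i \<noteq> k" "j \<noteq> k" using k(2) by (auto simp: det3_eq_0)
  have "finite ({t \<in> A. det3 (pt i) (pt j) (pt t) = 0} \<union> {t \<in> A. det3 (pt i) (pt k) (pt t) = 0} \<union> {t \<in> A. det3 (pt j) (pt k) (pt t) = 0})"
    using fin[OF i j] fin[OF i k(1) \<open>i \<noteq> k\<close>] fin[OF j(1) k(1) \<open>j \<noteq> k\<close>] by blast
  from infinite_avoid[OF inf this] obtain l where l: "l \<in> A" "det3 (pt i) (pt j) (pt l) \<noteq> 0" "det3 (pt i) (pt k) (pt l) \<noteq> 0" "det3 (pt j) (pt k) (pt l) \<noteq> 0"
    by blast
  define e1 e2 e3 where "e1 = pt i" and "e2 = pt j" and "e3 = pt k"
  have D: "det3 e1 e2 e3 \<noteq> 0" using k by (simp add: e1_def e2_def e3_def)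
  define p q r where "p = det3 (pt l) e2 e3 / det3 e1 e2 e3" and "q = det3 e1 (pt l) e3 / det3 e1 e2 e3"
    and "r = det3 e1 e2 (pt l) / det3 e1 e2 e3"
  have pl: "pt l = sm p e1 + sm q e2 + sm r e3" unfolding p_def q_def r_def by (rule cramer[OF D])
  have "det3 (pt l) e2 e3 = det3 (pt j) (pt k) (pt l)" "det3 e1 (pt l) e3 = - det3 (pt i) (pt k) (pt l)"
    unfolding e1_def e2_def e3_def by (cases "pt i"; cases "pt j"; cases "pt k"; cases "pt l"; simp add: v3_defs algebra_simps)+
  then have nz: "p \<noteq> 0" "q \<noteq> 0" "r \<noteq> 0" using l D by (auto simp: p_def q_def r_def e1_def e2_def e3_def)
  have z1: "M e1 e1 e1 x y = 0" and z2: "M e2 e2 e2 x y = 0" and z3: "M e3 e3 e3 x y = 0" and zl: "M (pt l) (pt l) (pt l) x y = 0" for x y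
    using al[OF i] al[OF j(1)] al[OF k(1)] al[OF l(1)] unfolding alpha_def e1_def e2_def e3_def by blast+
  have y: "M x y v v v = 0" "M x v v v y = 0" if "\<And>x y. M v v v x y = 0" for v x y
    unfolding M_rot(1)[of x y v v v] M_rot(2)[of x v v v y] by (rule that)+
  note y = y[OF z2] y[OF z3]
  \<comment> \<open>Three triple points at the basis vectors leave only the monomials with all
    exponents at most 2. The fourth point has nonzero coordinates and gives three independent linear
    equations for them.\<close>
  define X Y Z where "X = M e1 e1 e2 e2 e3" and "Y = M e1 e1 e2 e3 e3" and "Z = M e1 e2 e2 e3 e3"
  have zz: "M e1 e1 e1 e1 e1 = 0" "M e1 e1 e1 e1 e2 = 0" "M e1 e1 e1 e2 e2 = 0" "M e1 e1 e2 e2 e2 = 0" "M e1 e2 e2 e2 e2 = 0" "M e2 e2 e2 e2 e2 = 0"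
    "M e1 e1 e1 e1 e3 = 0" "M e1 e1 e1 e2 e3 = 0" "M e1 e2 e2 e2 e3 = 0" "M e2 e2 e2 e2 e3 = 0"
    "M e1 e1 e1 e3 e3 = 0" "M e2 e2 e2 e3 e3 = 0" "M e1 e1 e3 e3 e3 = 0" "M e1 e2 e3 e3 e3 = 0" "M e2 e2 e3 e3 e3 = 0"
    "M e1 e3 e3 e3 e3 = 0" "M e2 e3 e3 e3 e3 = 0" "M e3 e3 e3 e3 e3 = 0"
    by (simp_all only: z1 z2 z3 y)
  have "M (pt l) (pt l) (pt l) e1 e1 = 3 * q * r * (q * X + r * Y)" "M (pt l) (pt l) (pt l) e2 e2 = 3 * p * r * (p * X + r * Z)"
    "M (pt l) (pt l) (pt l) e3 e3 = 3 * p * q * (p * Y + q * Z)"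
    unfolding pl X_def Y_def Z_def by (simp_all add: M_lin M_ac zz algebra_simps)
  then have e: "q * X + r * Y = 0" "p * X + r * Z = 0" "p * Y + q * Z = 0" using zl nz by simp_all
  have "2 * p * q * X = p * (q * X + r * Y) + q * (p * X + r * Z) - r * (p * Y + q * Z)" by (simp add: algebra_simps)
  then have X: "X = 0" using e nz by simp
  then have Y: "Y = 0" and Z: "Z = 0" using e nz by auto
  have "M a b c d e = 0" for a b c d e
    by (rule zero_on_basis21[OF D]) (simp_all only: zz X[unfolded X_def] Y[unfolded Y_def] Z[unfolded Z_def])
  then show ?thesis by (rule qrank_0)
qed

text \<open>M at \<mu>^2 \<nu>^2 x can be read with either cubic polar, which equates a multiple of
  l with a multiple of k.\<close>

lemma beta_pair:
  assumes "beta \<mu> c l" "beta \<nu> d k"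
  shows "(l \<nu> = 0 \<and> k \<mu> = 0) \<or> (\<exists>\<theta>. \<theta> \<noteq> 0 \<and> (\<forall>x. k x = \<theta> * l x))"
proof -
  have l: "c \<noteq> 0" "l \<mu> = 1" "M \<mu> \<mu> x y w = c * l x * l y * l w" and k: "d \<noteq> 0" "k \<nu> = 1" "M \<nu> \<nu> x y w = d * k x * k y * k w" for x y w
    using assms unfolding beta_def by blast+
  have e: "c * l \<nu> * l \<nu> * l x = d * k \<mu> * k \<mu> * k x" for x
    unfolding l(3)[symmetric] k(3)[symmetric] by (simp only: M_ac)
  show ?thesis
  proof (cases "l \<nu> = 0")
    case True
    then have "d * k \<mu> * k \<mu> * k \<nu> = 0" using e[of \<nu>] by simp
    then show ?thesis using k True by simp
  next
    case False
    have "c * l \<nu> * l \<nu> * l \<nu> = d * k \<mu> * k \<mu>" using e[of \<nu>] k by simp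
    then have km: "k \<mu> \<noteq> 0" using False l by auto
    define \<theta> where "\<theta> = c * l \<nu> * l \<nu> / (d * k \<mu> * k \<mu>)"
    have "\<theta> \<noteq> 0" using False l k km by (simp add: \<theta>_def)
    moreover have "k x = \<theta> * l x" for x
    proof -
      have nz: "d * k \<mu> * k \<mu> \<noteq> 0" using k km by simp
      have "\<theta> * (d * k \<mu> * k \<mu>) = c * l \<nu> * l \<nu>" using nz by (simp add: \<theta>_def)
      then have "(d * k \<mu> * k \<mu>) * k x = (d * k \<mu> * k \<mu>) * (\<theta> * l x)" using e[of x] by algebra
      then show ?thesis using nz mult_left_cancel by blast
    qed
    ultimately show ?thesis by blast
  qed
qed

text \<open>Three of the points have proportional linear forms, say multiples of f. Subtracting a
  multiple of f^5 leaves a form N that is annihilated by the squares of all three points, and N is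
  zero or a cone.\<close>

lemma qrank_beta:
  assumes inf: "infinite A" and be: "\<And>t. t \<in> A \<Longrightarrow> beta (pt t) (c t) (l t)"
    and cr: "\<And>s t. s \<in> A \<Longrightarrow> t \<in> A \<Longrightarrow> s \<noteq> t \<Longrightarrow> cross (pt s) (pt t) \<noteq> 0"
  shows "qrank 10 M"
proof -
  define P where "P i j \<longleftrightarrow> (\<exists>\<theta>. \<theta> \<noteq> 0 \<and> (\<forall>x. l j x = \<theta> * l i x))" for i j
  have "\<exists>i\<in>A. \<exists>j\<in>A. \<exists>k\<in>A. i \<noteq> j \<and> i \<noteq> k \<and> j \<noteq> k \<and> P i j \<and> P i k"
  proof (rule ccontr)
    assume no: "\<not> ?thesis"
    have fin: "finite {j \<in> A. j \<noteq> i \<and> P i j}" if i: "i \<in> A" for i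
    proof (rule ccontr)
      assume inf': "infinite {j \<in> A. j \<noteq> i \<and> P i j}"
      obtain j where j: "j \<in> A" "j \<noteq> i" "P i j" using infinite_avoid[OF inf', of "{}"] by blast
      obtain k where k: "k \<in> A" "k \<noteq> i" "P i k" "k \<noteq> j" using infinite_avoid[OF inf', of "{j}"] by blast
      have "i \<noteq> j \<and> i \<noteq> k \<and> j \<noteq> k \<and> P i j \<and> P i k" using j k by auto
      with i j(1) k(1) have "\<exists>i\<in>A. \<exists>j\<in>A. \<exists>k\<in>A. i \<noteq> j \<and> i \<noteq> k \<and> j \<noteq> k \<and> P i j \<and> P i k"
        by (intro bexI)
      then show False using no by contradiction
    qed
    have orth: "l i (pt j) = 0" "l j (pt i) = 0" if "i \<in> A" "j \<in> A" "\<not> P i j" for i j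
      using beta_pair[OF be[OF that(1)] be[OF that(2)]] that(3) unfolding P_def by blast+
    \<comment> \<open>Four points with pairwise non-proportional forms would be dual to their forms
      by \<open>beta_pair\<close>, hence four independent vectors in a three-dimensional
      space.\<close>
    obtain i1 where i1: "i1 \<in> A" using infinite_avoid[OF inf, of "{}"] by blast
    have f1: "finite ({i1} \<union> {j \<in> A. j \<noteq> i1 \<and> P i1 j})" using fin[OF i1] by simp
    obtain i2 where i2: "i2 \<in> A" "\<not> P i1 i2" using infinite_avoid[OF inf f1] by blast
    have f2: "finite (({i1} \<union> {j \<in> A. j \<noteq> i1 \<and> P i1 j}) \<union> ({i2} \<union> {j \<in> A. j \<noteq> i2 \<and> P i2 j}))" using fin[OF i2(1)] f1 by simp
    obtain i3 where i3: "i3 \<in> A" "\<not> P i1 i3" "\<not> P i2 i3" using infinite_avoid[OF inf f2] by blast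
    have f3: "finite ((({i1} \<union> {j \<in> A. j \<noteq> i1 \<and> P i1 j}) \<union> ({i2} \<union> {j \<in> A. j \<noteq> i2 \<and> P i2 j})) \<union> ({i3} \<union> {j \<in> A. j \<noteq> i3 \<and> P i3 j}))"
      using fin[OF i3(1)] f2 by simp
    obtain i4 where i4: "i4 \<in> A" "\<not> P i1 i4" "\<not> P i2 i4" "\<not> P i3 i4" using infinite_avoid[OF inf f3] by blast
    obtain q0 q1 q2 q3 where q: "\<not> (q0 = 0 \<and> q1 = 0 \<and> q2 = 0 \<and> q3 = 0)"
      "sm q0 (pt i1) + sm q1 (pt i2) + sm q2 (pt i3) + sm q3 (pt i4) = 0" by (rule four_vectors_dependent)
    have one: "l i (pt i) = 1" and ll: "lin (l i)" if "i \<in> A" for i using be[OF that] unfolding beta_def by blast+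
    have app: "q0 * l i (pt i1) + q1 * l i (pt i2) + q2 * l i (pt i3) + q3 * l i (pt i4) = 0" if "i \<in> A" for i
    proof -
      have a: "l i (x + y) = l i x + l i y" and s: "l i (sm k x) = k * l i x" for x y k using ll[OF that] by (simp_all only: lin_def)
      have "l i (sm 0 0) = 0" unfolding s by simp
      then have z: "l i 0 = 0" by simp
      show ?thesis using arg_cong[OF q(2), of "l i"] unfolding a s z .
    qed
    have "q0 = 0" using app[OF i1] one[OF i1] orth[OF i1 i2] orth[OF i1 i3(1,2)] orth[OF i1 i4(1,2)] by simp
    moreover have "q1 = 0" using app[OF i2(1)] one[OF i2(1)] orth[OF i1 i2] orth[OF i2(1) i3(1,3)] orth[OF i2(1) i4(1,3)] by simp
    moreover have "q2 = 0" using app[OF i3(1)] one[OF i3(1)] orth[OF i1 i3(1,2)] orth[OF i2(1) i3(1,3)] orth[OF i3(1) i4(1,4)] by simp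
    moreover have "q3 = 0" using app[OF i4(1)] one[OF i4(1)] orth[OF i1 i4(1,2)] orth[OF i2(1) i4(1,3)] orth[OF i3(1) i4(1,4)] by simp
    ultimately show False using q(1) by simp
  qed
  then obtain i j k where ijk: "i \<in> A" "j \<in> A" "k \<in> A" "i \<noteq> j" "i \<noteq> k" "j \<noteq> k" "P i j" "P i k" by blast
  define f where "f = l i"
  define C where "C = c i"
  have f: "lin f" "f (pt i) = 1" and Mi: "M (pt i) (pt i) x y w = C * f x * f y * f w" for x y w
    using be[OF ijk(1)] unfolding beta_def f_def C_def by blast+
  have Mj: "M (pt j) (pt j) x y w = C * f (pt j) * f (pt j) * f x * f y * f w" if j: "j \<in> A" "P i j" for j x y w
  proof -
    obtain \<theta> where t: "\<theta> \<noteq> 0" "\<And>x. l j x = \<theta> * f x" using j(2) unfolding P_def f_def by blast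
    have m: "M (pt j) (pt j) x y w = c j * \<theta>^3 * f x * f y * f w" for x y w
    proof -
      have "M (pt j) (pt j) x y w = c j * l j x * l j y * l j w" using be[OF j(1)] unfolding beta_def by blast
      then show ?thesis unfolding t(2) by (simp add: eval_nat_numeral)
    qed
    \<comment> \<open>Comparing the two readings at this argument shows that the constant for j is C
      times the square of f at that point, so the same fifth power is subtracted at all three
      points.\<close>
    have "M (pt i) (pt i) (pt j) (pt j) (pt i) = M (pt j) (pt j) (pt i) (pt i) (pt i)" by (simp only: M_ac)
    then have "c j * \<theta>^3 = C * f (pt j) * f (pt j)" unfolding m Mi f(2) by simp
    then show ?thesis unfolding m by simp
  qed
  define N where "N a b c' d e = M a b c' d e - C * (f a * f b * f c' * f d * f e)" for a b c' d e
  interpret N: quintic_form N unfolding N_def by (rule diff_quintic_form[OF lin_power_quintic_form[OF f(1)]])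
  define a b r where "a = pt i" and "b = pt j" and "r = pt k"
  have na: "N a a x y w = 0" and nb: "N b b x y w = 0" and nr: "N r r x y w = 0" for x y w
    unfolding N_def a_def b_def r_def using Mi[of x y w] Mj[OF ijk(2,7), of x y w] Mj[OF ijk(3,8), of x y w] f(2) by simp_all
  have "qrank 5 N"
  proof (cases "det3 a b r = 0")
    case False
    \<comment> \<open>Five arguments out of three basis vectors always contain a square.\<close>
    have n: "N x v v y w = 0" "N x y v v w = 0" "N x y w v v = 0" if "\<And>x y w. N v v x y w = 0" for v x y w
      unfolding N.M_rot(3)[of x v v y w] N.M_rot(4)[of x y v v w] N.M_rot(5)[of x y w v v] by (rule that)+
    have "N x y w u v = 0" for x y w u v
      by (rule N.zero_on_basis21[OF False]) (simp_all only: na nb nr n[OF na] n[OF nb] n[OF nr])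
    then show ?thesis by (rule qrank_0)
  next
    case True
    have cab: "cross a b \<noteq> 0" using cr[OF ijk(1,2,4)] by (simp add: a_def b_def)
    obtain p q where pq: "r = sm p a + sm q b" using coplanar_combination[OF cab True] by blast
    have "cross a r = sm q (cross a b)" "cross r b = sm p (cross a b)" by (simp_all add: pq cross_scale)
    then have nz: "q \<noteq> 0" "p \<noteq> 0" using cr[OF ijk(1,3,5)] cr[OF ijk(3,2)] ijk(6) by (auto simp: a_def b_def r_def)
    \<comment> \<open>The square of the third collinear point yields the mixed product, so N is at
      most linear in the plane of a and b, and some v in that plane is a vertex of N.\<close>
    have nab: "N a b x y w = 0" for x y w
    proof -
      have "N r r x y w = p^2 * N a a x y w + 2 * p * q * N a b x y w + q^2 * N b b x y w"
        unfolding pq by (simp add: N.M_lin N.sw12[of b a] algebra_simps power2_eq_square)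
      then show ?thesis using na nb nr nz by simp
    qed
    have nba: "N b a x y w = 0" for x y w using nab[of x y w] by (simp only: N.sw12[of b a])
    obtain e where e: "det3 e a b \<noteq> 0" using ex_det3[OF cab] by blast
    have "\<exists>v. v \<noteq> 0 \<and> (\<forall>x y w. N v a x y w = 0 \<and> N v b x y w = 0) \<and> N v e e e e = 0"
    proof (cases "N a e e e e = 0")
      case True
      moreover have "a \<noteq> 0" using cab by (cases b) (auto simp: v3_defs)
      ultimately show ?thesis using na nab by blast
    next
      case False
      define v where "v = sm (N b e e e e) a + sm (- N a e e e e) b"
      have "cross a v = sm (- N a e e e e) (cross a b)" by (simp add: v_def cross_scale)
      then have "cross a v \<noteq> 0" using False cab by (simp add: sm_eq_0_iff)
      then have "v \<noteq> 0" by (cases a) (auto simp: v3_defs)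
      moreover have "N v e e e e = 0" by (simp add: v_def N.M_lin)
      moreover have "N v a x y w = 0" "N v b x y w = 0" for x y w by (simp_all add: v_def N.M_lin na nb nab nba)
      ultimately show ?thesis by blast
    qed
    then obtain v where v: "v \<noteq> 0" "\<And>x y w. N v a x y w = 0" "\<And>x y w. N v b x y w = 0" "N v e e e e = 0" by blast
    have v': "N v x a y w = 0" "N v x b y w = 0" "N v x y a w = 0" "N v x y b w = 0" "N v x y w a = 0" "N v x y w b = 0" for x y w
    proof -
      have r: "N v x u y w = N v u x y w" "N v x y u w = N v u x y w" "N v x y w u = N v u x y w" for u by (simp_all only: N.M_ac)
      show "N v x a y w = 0" "N v x b y w = 0" "N v x y a w = 0" "N v x y b w = 0" "N v x y w a = 0" "N v x y w b = 0"
        by (simp_all only: r v(2,3))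
    qed
    have 1: "N v e e e x = 0" for x
      by (rule basis_induct[OF e, of "\<lambda>x. N v e e e x = 0"]) (simp_all add: N.M_lin v v')
    have 2: "N v e e x y = 0" for x y
      by (rule basis_induct[OF e, of "\<lambda>x. N v e e x y = 0"]) (simp_all add: N.M_lin v v' 1)
    have 3: "N v e x y w = 0" for x y w
      by (rule basis_induct[OF e, of "\<lambda>x. N v e x y w = 0"]) (simp_all add: N.M_lin v v' 2)
    have 4: "N v x y w u = 0" for x y w u
      by (rule basis_induct[OF e, of "\<lambda>x. N v x y w u = 0"]) (simp_all add: N.M_lin v v' 3)
    show ?thesis by (rule N.qrank_cone[OF v(1) 4])
  qed
  then have "qrank 6 M" using qrank_Suc[OF f(1), of 5 M C] by (simp add: N_def[abs_def])
  then show ?thesis by (rule qrank_mono) simp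
qed

lemma qrank_infinite_special:
  assumes inf: "infinite T" and ab: "\<And>t. t \<in> T \<Longrightarrow> alpha (pt t) \<or> (\<exists>c l. beta (pt t) c l)"
    and cr: "\<And>s t. s \<in> T \<Longrightarrow> t \<in> T \<Longrightarrow> s \<noteq> t \<Longrightarrow> cross (pt s) (pt t) \<noteq> 0"
  shows "qrank 10 M"
proof (cases "infinite {t \<in> T. alpha (pt t)}")
  case True
  then show ?thesis by (rule qrank_alpha[of _ pt]) (use cr in blast)+
next
  case False
  then have inf': "infinite (T - {t \<in> T. alpha (pt t)})" using inf by simp
  have "\<forall>t\<in>T - {t \<in> T. alpha (pt t)}. \<exists>cl. beta (pt t) (fst cl) (snd cl)" using ab by (metis (no_types, lifting) DiffE fst_conv mem_Collect_eq snd_conv)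
  then obtain cl where cl: "\<And>t. t \<in> T - {t \<in> T. alpha (pt t)} \<Longrightarrow> beta (pt t) (fst (cl t)) (snd (cl t))" by metis
  show ?thesis by (rule qrank_beta[OF inf', of pt "\<lambda>t. fst (cl t)" "\<lambda>t. snd (cl t)"]) (use cl cr in blast)+
qed

end

subsection \<open>Polynomial functions and elimination\<close>

text \<open>Abstracts over polynomial functions in one and in two variables, so that closure under M
  is proved once in \<open>M_falg\<close>.\<close>

definition falg :: "('i \<Rightarrow> 'k::comm_ring_1) set \<Rightarrow> bool"
  where "falg A \<longleftrightarrow> (\<forall>c. (\<lambda>_. c) \<in> A) \<and> (\<forall>f\<in>A. \<forall>g\<in>A. (\<lambda>i. f i + g i) \<in> A \<and> (\<lambda>i. f i * g i) \<in> A)"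

definition vin :: "('i \<Rightarrow> 'k::comm_ring_1) set \<Rightarrow> ('i \<Rightarrow> 'k v3) \<Rightarrow> bool"
  where "vin A v \<longleftrightarrow> (\<lambda>i. fst (v i)) \<in> A \<and> (\<lambda>i. fst (snd (v i))) \<in> A \<and> (\<lambda>i. snd (snd (v i))) \<in> A"

lemma falg_const: "falg A \<Longrightarrow> (\<lambda>_. c) \<in> A"
  and falg_add: "falg A \<Longrightarrow> f \<in> A \<Longrightarrow> g \<in> A \<Longrightarrow> (\<lambda>i. f i + g i) \<in> A"
  and falg_mult: "falg A \<Longrightarrow> f \<in> A \<Longrightarrow> g \<in> A \<Longrightarrow> (\<lambda>i. f i * g i) \<in> A"
  by (auto simp: falg_def)

lemma falg_diff: "falg A \<Longrightarrow> f \<in> A \<Longrightarrow> g \<in> A \<Longrightarrow> (\<lambda>i. f i - g i) \<in> A"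
  using falg_add[of A f "\<lambda>i. (- 1) * g i"] falg_mult[of A "\<lambda>_. - 1" g] falg_const[of A "- 1"] by simp

lemma vin_const: "falg A \<Longrightarrow> vin A (\<lambda>_. v)"
  by (simp add: vin_def falg_const)

lemma vin_affine: "falg A \<Longrightarrow> f \<in> A \<Longrightarrow> vin A (\<lambda>i. v + sm (f i) w)"
  by (cases v; cases w) (simp add: vin_def sm_def falg_add falg_mult falg_const)

lemma v3_expand: "x = sm (fst x) (1, 0, 0) + sm (fst (snd x)) (0, 1, 0) + sm (snd (snd x)) (0, 0, 1)"
  by (cases x) (simp add: sm_def)

definition pf :: "('k::comm_ring_1 \<Rightarrow> 'k) set"
  where "pf = {g. \<exists>p. \<forall>x. g x = poly p x}"

lemma falg_pf: "falg pf"
  unfolding falg_def pf_def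
proof (intro conjI allI ballI)
  fix c :: 'a show "(\<lambda>_. c) \<in> {g. \<exists>p. \<forall>x. g x = poly p x}" by (auto intro: exI[of _ "[:c:]"])
next
  fix f g :: "'a \<Rightarrow> 'a" assume "f \<in> {g. \<exists>p. \<forall>x. g x = poly p x}" "g \<in> {g. \<exists>p. \<forall>x. g x = poly p x}"
  then obtain p q where pq: "\<And>x. f x = poly p x" "\<And>x. g x = poly q x" by blast
  show "(\<lambda>i. f i + g i) \<in> {g. \<exists>p. \<forall>x. g x = poly p x}" using pq by (auto intro: exI[of _ "p + q"])
  show "(\<lambda>i. f i * g i) \<in> {g. \<exists>p. \<forall>x. g x = poly p x}" using pq by (auto intro: exI[of _ "p * q"])
qed

lemma pf_id: "(\<lambda>x. x) \<in> pf"
  unfolding pf_def by (auto intro: exI[of _ "[:0, 1:]"])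

lemma pf_finite_zeros:
  fixes g :: "'k::idom \<Rightarrow> 'k"
  assumes "g \<in> pf" "g a \<noteq> 0"
  shows "finite {x. g x = 0}"
proof -
  obtain p where p: "\<And>x. g x = poly p x" using assms(1) by (auto simp: pf_def)
  then have "p \<noteq> 0" using assms(2) by auto
  then show ?thesis unfolding p by (rule poly_roots_finite)
qed

text \<open>The outer variable is y and the coefficients are polynomials in x;
  \<open>elimination\<close> divides with respect to y.\<close>

definition ev2 :: "'k::comm_ring_1 poly poly \<Rightarrow> 'k \<Rightarrow> 'k \<Rightarrow> 'k"
  where "ev2 p x y = poly (poly p [:y:]) x"

definition pf2 :: "('k::comm_ring_1 \<times> 'k \<Rightarrow> 'k) set"
  where "pf2 = {g. \<exists>p. \<forall>x y. g (x, y) = ev2 p x y}"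

lemma falg_pf2: "falg pf2"
  unfolding falg_def pf2_def
proof (intro conjI allI ballI)
  fix c :: 'a show "(\<lambda>_. c) \<in> {g. \<exists>p. \<forall>x y. g (x, y) = ev2 p x y}"
    by (auto simp: ev2_def intro: exI[of _ "[:[:c:]:]"])
next
  fix f g :: "'a \<times> 'a \<Rightarrow> 'a"
  assume "f \<in> {g. \<exists>p. \<forall>x y. g (x, y) = ev2 p x y}" "g \<in> {g. \<exists>p. \<forall>x y. g (x, y) = ev2 p x y}"
  then obtain p q where pq: "\<And>x y. f (x, y) = ev2 p x y" "\<And>x y. g (x, y) = ev2 q x y" by blast
  show "(\<lambda>i. f i + g i) \<in> {g. \<exists>p. \<forall>x y. g (x, y) = ev2 p x y}" using pq by (auto simp: ev2_def intro: exI[of _ "p + q"])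
  show "(\<lambda>i. f i * g i) \<in> {g. \<exists>p. \<forall>x y. g (x, y) = ev2 p x y}" using pq by (auto simp: ev2_def intro: exI[of _ "p * q"])
qed

lemma pf2_fst: "fst \<in> pf2" and pf2_snd: "snd \<in> pf2"
  unfolding pf2_def by (auto simp: ev2_def intro: exI[of _ "[:[:0, 1:]:]"] exI[of _ "[:0, 1:]"])

lemma ev2_map_poly: "ev2 p x y = poly (map_poly (\<lambda>c. poly c x) p) y"
proof (induction p)
  case 0 then show ?case by (simp add: ev2_def)
next
  case (pCons a p) then show ?case by (simp add: ev2_def map_poly_pCons)
qed

text \<open>The projection of a plane algebraic set is finite or cofinite. A nonzero p of least
  degree in y vanishing on the set divides every equation up to powers of its leading coefficient,
  because the pseudo-remainder again vanishes on the set. Where that coefficient is nonzero, any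
  root of p in y solves all equations.\<close>

theorem elimination:
  fixes F :: "('k::{alg_closed_field, field_char_0} \<times> 'k \<Rightarrow> 'k) set"
  assumes F: "F \<subseteq> pf2" and inf: "infinite {x. \<exists>y. \<forall>g\<in>F. g (x, y) = 0}"
  shows "finite {x. \<not> (\<exists>y. \<forall>g\<in>F. g (x, y) = 0)}"
proof -
  define Z where "Z x y \<longleftrightarrow> (\<forall>g\<in>F. g (x, y) = 0)" for x y
  define J where "J = {p. \<forall>x y. Z x y \<longrightarrow> ev2 p x y = 0}"
  have rep: "\<exists>q\<in>J. \<forall>x y. g (x, y) = ev2 q x y" if "g \<in> F" for g
  proof -
    have "g \<in> pf2" using F that by blast
    then obtain q where q: "\<And>x y. g (x, y) = ev2 q x y" unfolding pf2_def by blast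
    have "ev2 q x y = 0" if "Z x y" for x y using that \<open>g \<in> F\<close> unfolding Z_def q[symmetric] by blast
    then have "q \<in> J" unfolding J_def by blast
    then show ?thesis using q by blast
  qed
  show ?thesis
  proof (cases "J = {0}")
    case True
    then have "g (x, y) = 0" if "g \<in> F" for g x y using rep[OF that] by (auto simp: ev2_def)
    then show ?thesis by simp
  next
    case False
    have "0 \<in> J" by (simp add: J_def ev2_def)
    then obtain p0 where "p0 \<in> J" "p0 \<noteq> 0" using False by blast
    then obtain p where p: "p \<in> J" "p \<noteq> 0" and min: "\<And>q. q \<in> J \<Longrightarrow> q \<noteq> 0 \<Longrightarrow> degree p \<le> degree q"
      using arg_min_natI[of "\<lambda>p. p \<in> J \<and> p \<noteq> 0" p0 degree] arg_min_nat_le[of "\<lambda>p. p \<in> J \<and> p \<noteq> 0" _ degree] by blast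
    \<comment> \<open>A polynomial in x alone would have infinitely many roots.\<close>
    have deg: "degree p > 0"
    proof (rule ccontr)
      assume "\<not> degree p > 0"
      then obtain c where c: "p = [:c:]" by (metis degree_eq_zeroE not_gr_zero)
      have "{x. \<exists>y. Z x y} \<subseteq> {x. poly c x = 0}" using p(1) by (auto simp: J_def c ev2_def)
      moreover have "finite {x. poly c x = 0}" using p(2) c by (intro poly_roots_finite) auto
      ultimately show False using inf unfolding Z_def by (meson finite_subset)
    qed
    have "{x. \<not> (\<exists>y. Z x y)} \<subseteq> {x. poly (lead_coeff p) x = 0}"
    proof (rule subsetI, rule ccontr)
      fix x assume x: "x \<in> {x. \<not> (\<exists>y. Z x y)}" "x \<notin> {x. poly (lead_coeff p) x = 0}"
      let ?q = "map_poly (\<lambda>c. poly c x) p"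
      have "coeff ?q (degree p) \<noteq> 0" using x(2) by (simp add: coeff_map_poly)
      then have "degree ?q > 0" using deg le_degree by fastforce
      then obtain y where "poly ?q y = 0" using alg_closed_imp_poly_has_root by blast
      then have y: "ev2 p x y = 0" by (simp add: ev2_map_poly)
      have "g (x, y) = 0" if gF: "g \<in> F" for g
      proof -
        obtain q where q: "q \<in> J" "\<And>x y. g (x, y) = ev2 q x y" using rep[OF gF] by blast
        obtain s r where sr: "pseudo_divmod q p = (s, r)" by fastforce
        let ?a = "coeff p (degree p) ^ (Suc (degree q) - degree p)"
        from pseudo_divmod[OF p(2) sr] have e: "smult ?a q = p * s + r" and d: "r = 0 \<or> degree r < degree p" by auto
        have ev: "poly ?a x' * ev2 q x' y' = ev2 p x' y' * ev2 s x' y' + ev2 r x' y'" for x' y'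
          using arg_cong[OF e, of "\<lambda>p. ev2 p x' y'"] by (simp add: ev2_def)
        have "r \<in> J" unfolding J_def
        proof (intro CollectI allI impI)
          fix x' y' assume "Z x' y'"
          then have "ev2 q x' y' = 0" "ev2 p x' y' = 0" using q(1) p(1) by (auto simp: J_def)
          then show "ev2 r x' y' = 0" using ev[of x' y'] by simp
        qed
        then have "r = 0" using min d by fastforce
        then have "poly ?a x * ev2 q x y = 0" using ev[of x y] y by (simp add: ev2_def)
        then show ?thesis using x(2) q(2) by (simp add: poly_power)
      qed
      then have "Z x y" by (simp add: Z_def)
      then show False using x(1) by blast
    qed
    moreover have "finite {x. poly (lead_coeff p) x = 0}" using p(2) by (intro poly_roots_finite) simp
    ultimately show ?thesis unfolding Z_def using finite_subset by blast
  qed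
qed

text \<open>Value and derivative at 0, read off the coefficients of a polynomial; this makes the
  product rule purely algebraic.\<close>

definition D1 :: "('k::comm_ring_1 \<Rightarrow> 'k) \<Rightarrow> 'k \<Rightarrow> 'k \<Rightarrow> bool"
  where "D1 g a b \<longleftrightarrow> (\<exists>p. (\<forall>x. g x = poly p x) \<and> coeff p 0 = a \<and> coeff p 1 = b)"

definition V1 :: "('k::comm_ring_1 \<Rightarrow> 'k v3) \<Rightarrow> 'k v3 \<Rightarrow> 'k v3 \<Rightarrow> bool"
  where "V1 v a b \<longleftrightarrow> D1 (\<lambda>x. fst (v x)) (fst a) (fst b) \<and> D1 (\<lambda>x. fst (snd (v x))) (fst (snd a)) (fst (snd b))
    \<and> D1 (\<lambda>x. snd (snd (v x))) (snd (snd a)) (snd (snd b))"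

lemma D1_const: "D1 (\<lambda>_. c) c 0"
  unfolding D1_def by (intro exI[of _ "[:c:]"]) simp

lemma D1_add: "D1 f a b \<Longrightarrow> D1 g a' b' \<Longrightarrow> D1 (\<lambda>x. f x + g x) (a + a') (b + b')"
  unfolding D1_def by (metis coeff_add poly_add)

lemma D1_mult:
  assumes "D1 f a b" "D1 g a' b'"
  shows "D1 (\<lambda>x. f x * g x) (a * a') (b * a' + a * b')"
proof -
  obtain p q where "\<And>x. f x = poly p x" "coeff p 0 = a" "coeff p 1 = b" "\<And>x. g x = poly q x" "coeff q 0 = a'" "coeff q 1 = b'"
    using assms unfolding D1_def by blast
  then show ?thesis unfolding D1_def by (intro exI[of _ "p * q"]) (simp add: coeff_mult)
qed

lemma D1_zero:
  fixes g :: "'k::field_char_0 \<Rightarrow> 'k"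
  assumes "D1 g a b" "\<And>x. g x = 0"
  shows "b = 0"
  using assms poly_coeff_zero unfolding D1_def by metis

lemma V1_exists:
  assumes "vin pf v"
  shows "\<exists>b. V1 v (v 0) b"
proof -
  have "\<exists>b. D1 g (g 0) b" if "g \<in> pf" for g :: "'a \<Rightarrow> 'a"
    using that unfolding pf_def D1_def by (auto simp: poly_0_coeff_0)
  then obtain b1 b2 b3 where "D1 (\<lambda>x. fst (v x)) (fst (v 0)) b1" "D1 (\<lambda>x. fst (snd (v x))) (fst (snd (v 0))) b2"
    "D1 (\<lambda>x. snd (snd (v x))) (snd (snd (v 0))) b3"
    using assms unfolding vin_def by meson
  then show ?thesis unfolding V1_def by (intro exI[of _ "(b1, b2, b3)"]) simp
qed

lemma V1_line: "V1 (\<lambda>x. v + sm x w) v w"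
proof -
  have "D1 (\<lambda>x. a + x * b) a b" for a b :: 'a unfolding D1_def by (intro exI[of _ "[:a, b:]"]) simp
  then show ?thesis unfolding V1_def by (cases v; cases w) (simp add: sm_def)
qed

lemma V1_const: "V1 (\<lambda>_. v) v 0"
  by (simp add: V1_def D1_const zero_prod_def)

context quintic_form
begin

lemma expand:
  "M x b c d e = fst x * M (1, 0, 0) b c d e + fst (snd x) * M (0, 1, 0) b c d e + snd (snd x) * M (0, 0, 1) b c d e"
  "M a x c d e = fst x * M a (1, 0, 0) c d e + fst (snd x) * M a (0, 1, 0) c d e + snd (snd x) * M a (0, 0, 1) c d e"
  "M a b x d e = fst x * M a b (1, 0, 0) d e + fst (snd x) * M a b (0, 1, 0) d e + snd (snd x) * M a b (0, 0, 1) d e"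
  "M a b c x e = fst x * M a b c (1, 0, 0) e + fst (snd x) * M a b c (0, 1, 0) e + snd (snd x) * M a b c (0, 0, 1) e"
  "M a b c d x = fst x * M a b c d (1, 0, 0) + fst (snd x) * M a b c d (0, 1, 0) + snd (snd x) * M a b c d (0, 0, 1)"
  by (subst v3_expand[of x], simp only: M_lin)+

lemma M_falg:
  assumes A: "falg A" and v: "vin A a" "vin A b" "vin A c" "vin A d" "vin A e"
  shows "(\<lambda>i. M (a i) (b i) (c i) (d i) (e i)) \<in> A"
proof -
  have step: "(\<lambda>i. fst (x i) * g1 i + fst (snd (x i)) * g2 i + snd (snd (x i)) * g3 i) \<in> A"
    if "vin A x" "g1 \<in> A" "g2 \<in> A" "g3 \<in> A" for x g1 g2 g3
    using that A unfolding vin_def by (intro falg_add falg_mult) auto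
  have 1: "(\<lambda>i. M (a i) x y z w) \<in> A" for x y z w
    by (subst expand(1)) (intro step v falg_const A)
  have 2: "(\<lambda>i. M (a i) (b i) y z w) \<in> A" for y z w
    by (subst expand(2)) (intro step v 1)
  have 3: "(\<lambda>i. M (a i) (b i) (c i) z w) \<in> A" for z w
    by (subst expand(3)) (intro step v 2)
  have 4: "(\<lambda>i. M (a i) (b i) (c i) (d i) w) \<in> A" for w
    by (subst expand(4)) (intro step v 3)
  show ?thesis by (subst expand(5)) (intro step v 4)
qed

lemma M_D1:
  assumes v: "V1 a a0 a1" "V1 b b0 b1" "V1 c c0 c1" "V1 d d0 d1" "V1 e e0 e1"
  shows "D1 (\<lambda>i. M (a i) (b i) (c i) (d i) (e i)) (M a0 b0 c0 d0 e0)
    (M a1 b0 c0 d0 e0 + M a0 b1 c0 d0 e0 + M a0 b0 c1 d0 e0 + M a0 b0 c0 d1 e0 + M a0 b0 c0 d0 e1)"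
proof -
  have step: "D1 (\<lambda>i. fst (x i) * g1 i + fst (snd (x i)) * g2 i + snd (snd (x i)) * g3 i)
      (fst x0 * p1 + fst (snd x0) * p2 + snd (snd x0) * p3)
      ((fst x1 * p1 + fst x0 * q1) + (fst (snd x1) * p2 + fst (snd x0) * q2) + (snd (snd x1) * p3 + snd (snd x0) * q3))"
    if "V1 x x0 x1" "D1 g1 p1 q1" "D1 g2 p2 q2" "D1 g3 p3 q3" for x x0 x1 g1 g2 g3 p1 p2 p3 q1 q2 q3
    using that unfolding V1_def by (intro D1_add D1_mult) auto
  have cong: "D1 f p' q'" if "D1 f p q" "p = p'" "q = q'" for f :: "'k \<Rightarrow> 'k" and p q p' q' using that by simp
  have 1: "D1 (\<lambda>i. M (a i) x y z w) (M a0 x y z w) (M a1 x y z w)" for x y z w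
    unfolding expand(1)[of "a _"] by (rule cong[OF step[OF v(1) D1_const D1_const D1_const]]) (simp_all add: expand(1)[of a0] expand(1)[of a1])
  have 2: "D1 (\<lambda>i. M (a i) (b i) y z w) (M a0 b0 y z w) (M a1 b0 y z w + M a0 b1 y z w)" for y z w
    unfolding expand(2)[of _ "b _"] by (rule cong[OF step[OF v(2) 1 1 1]]) (simp_all add: expand(2)[of _ b0] expand(2)[of _ b1] algebra_simps)
  have 3: "D1 (\<lambda>i. M (a i) (b i) (c i) z w) (M a0 b0 c0 z w) (M a1 b0 c0 z w + M a0 b1 c0 z w + M a0 b0 c1 z w)" for z w
    unfolding expand(3)[of _ _ "c _"] by (rule cong[OF step[OF v(3) 2 2 2]]) (simp_all add: expand(3)[of _ _ c0] expand(3)[of _ _ c1] algebra_simps)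
  have 4: "D1 (\<lambda>i. M (a i) (b i) (c i) (d i) w) (M a0 b0 c0 d0 w) (M a1 b0 c0 d0 w + M a0 b1 c0 d0 w + M a0 b0 c1 d0 w + M a0 b0 c0 d1 w)" for w
    unfolding expand(4)[of _ _ _ "d _"] by (rule cong[OF step[OF v(4) 3 3 3]]) (simp_all add: expand(4)[of _ _ _ d0] expand(4)[of _ _ _ d1] algebra_simps)
  show ?thesis
    unfolding expand(5)[of _ _ _ _ "e _"] by (rule cong[OF step[OF v(5) 4 4 4]]) (simp_all add: expand(5)[of _ _ _ _ e0] expand(5)[of _ _ _ _ e1] algebra_simps)
qed

end

subsection \<open>The Hessian\<close>

lemma det3_kernel:
  fixes w :: "'k::field v3"
  assumes "w \<noteq> 0" "dot r1 w = 0" "dot r2 w = 0" "dot r3 w = 0"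
  shows "det3 r1 r2 r3 = 0"
proof -
  have "sm (det3 r1 r2 r3) w = sm (dot r1 w) (cross r2 r3) + sm (dot r2 w) (cross r3 r1) + sm (dot r3 w) (cross r1 r2)"
    by (cases r1; cases r2; cases r3; cases w) (simp add: v3_defs algebra_simps)
  then show ?thesis using assms by (simp add: sm_eq_0_iff)
qed

lemma degree_det_le:
  fixes p :: "'k::comm_ring_1 poly"
  assumes "degree p \<le> 3" "degree q \<le> 3" "degree r \<le> 3" "degree s \<le> 3" "degree t \<le> 3"
  shows "degree (p * (q * r - s * t)) \<le> 9"
proof -
  have "degree (q * r) \<le> 6" "degree (s * t) \<le> 6"
    using assms degree_mult_le[of q r] degree_mult_le[of s t] by linarith+
  then have "degree (q * r - s * t) \<le> 6" by (rule degree_diff_le)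
  then show ?thesis using assms(1) degree_mult_le[of p "q * r - s * t"] by linarith
qed

lemma infinite_three:
  assumes "infinite A"
  obtains a b c where "a \<in> A" "b \<in> A" "c \<in> A" "a \<noteq> b" "a \<noteq> c" "b \<noteq> c"
proof -
  obtain B where B: "finite B" "card B = 3" "B \<subseteq> A" using infinite_arbitrarily_large[OF assms] by blast
  then obtain a b c where "B = {a, b, c}" "a \<noteq> b" "a \<noteq> c" "b \<noteq> c" by (metis card_3_iff)
  then show ?thesis using that[of a b c] B(3) by blast
qed

context quintic_form
begin

text \<open>The rows of the matrix of M \<mu>^3, which is the Hessian matrix of f at \<mu> up to a
  constant factor; its determinant has degree 9 in \<mu>.\<close>

definition hrow :: "'k v3 \<Rightarrow> 'k v3 \<Rightarrow> 'k v3"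
  where "hrow \<mu> v = (M \<mu> \<mu> \<mu> v (1, 0, 0), M \<mu> \<mu> \<mu> v (0, 1, 0), M \<mu> \<mu> \<mu> v (0, 0, 1))"

lemma dot_hrow: "dot (hrow \<mu> v) x = M \<mu> \<mu> \<mu> v x"
  by (subst expand(5)[of _ _ _ _ x], cases x) (simp add: hrow_def dot_def mult.commute)

definition hess :: "'k v3 \<Rightarrow> 'k"
  where "hess \<mu> = det3 (hrow \<mu> (1, 0, 0)) (hrow \<mu> (0, 1, 0)) (hrow \<mu> (0, 0, 1))"

lemma hess_zero_if_kernel:
  assumes "w \<noteq> 0" "\<And>y. M \<mu> \<mu> \<mu> w y = 0"
  shows "hess \<mu> = 0"
  unfolding hess_def
proof (rule det3_kernel[OF assms(1)])
  have "dot (hrow \<mu> v) w = 0" for v unfolding dot_hrow using assms(2)[of v] by (simp only: sw45[of \<mu> \<mu> \<mu> v w])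
  then show "dot (hrow \<mu> (1, 0, 0)) w = 0" "dot (hrow \<mu> (0, 1, 0)) w = 0" "dot (hrow \<mu> (0, 0, 1)) w = 0" by blast+
qed

text \<open>Proportional polars in the directions \<mu> and b give a nonzero combination w of \<mu>
  and b in the kernel of the Hessian matrix.\<close>

lemma hess_zero_if_bad:
  assumes b: "bad \<mu> b" and c: "cross \<mu> b \<noteq> 0"
  shows "hess \<mu> = 0"
proof (cases "\<forall>x. M \<mu> \<mu> \<mu> \<mu> x = 0")
  case True
  have "\<mu> \<noteq> 0" using c by (cases b) (auto simp: v3_defs)
  then show ?thesis using True by (intro hess_zero_if_kernel[of \<mu>]) blast+
next
  case False
  then obtain x where x: "M \<mu> \<mu> \<mu> \<mu> x \<noteq> 0" by blast
  define w where "w = sm (- M \<mu> \<mu> \<mu> b x) \<mu> + sm (M \<mu> \<mu> \<mu> \<mu> x) b"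
  have "cross \<mu> w = sm (M \<mu> \<mu> \<mu> \<mu> x) (cross \<mu> b)" by (simp add: w_def cross_scale)
  then have "cross \<mu> w \<noteq> 0" using x c by (simp add: sm_eq_0_iff)
  then have "w \<noteq> 0" by (cases \<mu>) (auto simp: v3_defs)
  moreover have "M \<mu> \<mu> \<mu> w y = 0" for y
  proof -
    have "M \<mu> \<mu> \<mu> \<mu> x * M \<mu> \<mu> \<mu> b y = M \<mu> \<mu> \<mu> \<mu> y * M \<mu> \<mu> \<mu> b x" using b unfolding bad_def by (blast dest: par_D)
    then show ?thesis by (simp add: w_def M_lin algebra_simps)
  qed
  ultimately show ?thesis by (rule hess_zero_if_kernel)
qed

lemma hess_scale: "hess (sm k \<mu>) = k ^ 9 * hess \<mu>"
proof -
  have a: "hrow (sm k \<mu>) v = sm (k ^ 3) (hrow \<mu> v)" for v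
    by (simp add: hrow_def M_lin) (simp add: sm_def eval_nat_numeral)
  have b: "det3 (sm c u) (sm c v) (sm c w) = c ^ 3 * det3 u v w" for c u v w
    by (cases u; cases v; cases w) (simp add: v3_defs algebra_simps eval_nat_numeral)
  show ?thesis unfolding hess_def a b by (simp add: power_mult[symmetric])
qed

lemma hess_poly: "\<exists>p. degree p \<le> 9 \<and> (\<forall>y. hess (a + sm y c) = poly p y)"
proof -
  have "\<exists>p. degree p \<le> 3 \<and> (\<forall>t. M (a + sm t c) (a + sm t c) (a + sm t c) x y = poly p t)" for x y
  proof (intro exI conjI allI)
    let ?p = "[:M a a a x y, 3 * M a a c x y, 3 * M a c c x y, M c c c x y:]"
    show "degree ?p \<le> 3" by simp
    show "M (a + sm t c) (a + sm t c) (a + sm t c) x y = poly ?p t" for t by (simp add: M_lin M_ac algebra_simps)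
  qed
  then obtain P where P: "\<And>x y. degree (P x y) \<le> 3" "\<And>x y t. M (a + sm t c) (a + sm t c) (a + sm t c) x y = poly (P x y) t"
    by metis
  let ?u = "(1, 0, 0)" and ?v = "(0, 1, 0)" and ?w = "(0, 0, 1)"
  let ?D = "P ?u ?u * (P ?v ?v * P ?w ?w - P ?v ?w * P ?w ?v) + P ?u ?v * (P ?v ?w * P ?w ?u - P ?v ?u * P ?w ?w)
    + P ?u ?w * (P ?v ?u * P ?w ?v - P ?v ?v * P ?w ?u)"
  have "degree ?D \<le> 9" by (intro degree_add_le degree_det_le P)
  moreover have "hess (a + sm y c) = poly ?D y" for y
    unfolding hess_def hrow_def P(2) by (simp add: v3_defs)
  ultimately show ?thesis by blast
qed

lemma hess_zeros:
  assumes "hess (a + sm y0 c) \<noteq> 0"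
  shows "finite {y. hess (a + sm y c) = 0}" "card {y. hess (a + sm y c) = 0} \<le> 9"
proof -
  obtain p where p: "degree p \<le> 9" "\<And>y. hess (a + sm y c) = poly p y" using hess_poly by blast
  then have "p \<noteq> 0" using assms by auto
  then show "finite {y. hess (a + sm y c) = 0}" "card {y. hess (a + sm y c) = 0} \<le> 9"
    unfolding p(2) using poly_roots_finite[of p] card_poly_roots_bound[of p] p(1) by auto
qed

text \<open>A curve of degree 9 contains all the bad points. Prescribing 19 directions, a general line
  through a suitable point meets this curve in at most 9 points, among which each of the
  directions has a bad point; so one of them is bad for three directions.\<close>

lemma qrank_if_hess:
  assumes h: "hess \<mu>0 \<noteq> 0"
    and all_bad: "\<And>e1 e2 e3. det3 e1 e2 e3 \<noteq> 0 \<Longrightarrow>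
      \<exists>x y. (x \<noteq> 0 \<or> y \<noteq> 0) \<and> (\<forall>s t. bad (sm x e1 + sm y e2) (sm s e1 + sm t e2))"
  shows "qrank 10 M"
proof -
  \<comment> \<open>Points at infinity of the chart with first coordinate 1; each serves both as a
    point and as a direction.\<close>
  define dir :: "'k \<Rightarrow> 'k v3" where "dir t = (0, 1, t)" for t
  define sp where "sp \<mu> \<longleftrightarrow> alpha \<mu> \<or> (\<exists>c l. beta \<mu> c l)" for \<mu>
  show ?thesis
  proof (cases "infinite {t. sp (dir t)}")
    case True
    show ?thesis
      by (rule qrank_infinite_special[OF True, of dir]) (auto simp: sp_def dir_def v3_defs)
  next
    case finT: False
    have three: "(c::'k) = (c - b) / (a - b) * a + (a - c) / (a - b) * b" "(1::'k) = (c - b) / (a - b) + (a - c) / (a - b)" if "a \<noteq> b" for a b c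
    proof -
      have "(c - b) / (a - b) * a + (a - c) / (a - b) * b = ((c - b) * a + (a - c) * b) / (a - b)" by (simp add: add_divide_distrib)
      also have "(c - b) * a + (a - c) * b = c * (a - b)" by (simp add: algebra_simps)
      finally show "c = (c - b) / (a - b) * a + (a - c) / (a - b) * b" using that by simp
      show "1 = (c - b) / (a - b) + (a - c) / (a - b)" using that by (simp add: add_divide_distrib[symmetric])
    qed
    have finS: "finite {s. bad (dir t) (1, 0, s)}" if t: "\<not> sp (dir t)" for t
    proof (rule ccontr)
      assume "infinite {s. bad (dir t) (1, 0, s)}"
      then obtain a b c where abc: "bad (dir t) (1, 0, a)" "bad (dir t) (1, 0, b)" "bad (dir t) (1, 0, c)" "a \<noteq> b" "a \<noteq> c" "b \<noteq> c"
        by (rule infinite_three) blast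
      have eq: "(1, 0, c) = sm ((c - b) / (a - b)) (1, 0, a) + sm ((a - c) / (a - b)) (1, 0, b)"
        using three[OF abc(4), of c] by (simp add: sm_def)
      then have "bad (dir t) (sm ((c - b) / (a - b)) (1, 0, a) + sm ((a - c) / (a - b)) (1, 0, b))" using abc(3) by (simp only: eq[symmetric])
      from three_bad_directions[OF _ abc(1,2) this] have "sp (dir t)"
        using abc(4-6) by (auto simp: sp_def dir_def v3_defs)
      then show False using t by blast
    qed
    \<comment> \<open>The line through (1, 0, s) and \<open>dir t\<close> contains a point that is
      bad for this line. It is affine unless it is \<open>dir t\<close> itself, which happens for
      finitely many s by \<open>finS\<close>.\<close>
    have fullS: "finite {s. \<not> (\<exists>y. bad (1, y, s + t * y) (dir t))}" if t: "\<not> sp (dir t)" for t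
    proof (rule finite_subset[OF _ finS[OF t]], rule subsetI, rule CollectI)
      fix s assume "s \<in> {s. \<not> (\<exists>y. bad (1, y, s + t * y) (dir t))}"
      then have no: "\<not> bad (1, y, s + t * y) (dir t)" for y by blast
      have "det3 (1, 0, s) (dir t) (0, 0, 1) \<noteq> 0" by (simp add: dir_def v3_defs)
      from all_bad[OF this] obtain x y where xy: "x \<noteq> 0 \<or> y \<noteq> 0"
        "\<And>p q. bad (sm x (1, 0, s) + sm y (dir t)) (sm p (1, 0, s) + sm q (dir t))" by blast
      have x: "x = 0"
      proof (rule ccontr)
        assume x: "x \<noteq> 0"
        have e1: "sm (1 / x) (sm x (1, 0, s) + sm y (dir t)) = (1, y / x, s + t * (y / x))"
          using x by (simp add: dir_def sm_def add_divide_distrib)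
        have e2: "sm 0 (1, 0, s) + sm 1 (dir t) = dir t" by (simp add: dir_def sm_def)
        have "bad (1, y / x, s + t * (y / x)) (dir t)" using bad_scale[OF xy(2)[of 0 1], of "1 / x"] unfolding e1 e2 .
        then show False using no by blast
      qed
      then have y: "y \<noteq> 0" using xy(1) by blast
      have e1: "sm (1 / y) (sm x (1, 0, s) + sm y (dir t)) = dir t" using x y by (simp add: dir_def sm_def)
      have e2: "sm 1 (1, 0, s) + sm 0 (dir t) = (1, 0, s)" by (simp add: dir_def sm_def)
      show "bad (dir t) (1, 0, s)" using bad_scale[OF xy(2)[of 1 0], of "1 / y"] unfolding e1 e2 .
    qed
    \<comment> \<open>19 is the least number exceeding 2 times 9, so sorting 19 directions among at
      most 9 points puts three on one point.\<close>
    have "infinite (UNIV - {t. sp (dir t)})" using finT infinite_UNIV_char_0 by (simp add: Diff_infinite_finite)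
    from infinite_arbitrarily_large[OF this, of 19]
    obtain \<Theta> where \<Theta>: "finite \<Theta>" "card \<Theta> = 19" "\<And>t. t \<in> \<Theta> \<Longrightarrow> \<not> sp (dir t)" by blast
    let ?X = "\<lambda>r t. {x. \<exists>y. bad (1, y, x + r * y) (dir t)}"
    \<comment> \<open>At most one slope r has a finite projection: two finite projections confine
      the affine bad set for \<open>dir t\<close> to finitely many points, contrary to
      \<open>fullS\<close>. A common r with infinite projections for all chosen t then exists, and
      elimination makes these projections cofinite.\<close>
    have finR: "finite {r. finite (?X r t)}" if t: "t \<in> \<Theta>" for t
    proof -
      have "r = r'" if r: "finite (?X r t)" "finite (?X r' t)" for r r'
      proof (rule ccontr)
        assume ne: "r \<noteq> r'"
        let ?Z = "{(y, z). bad (1, y, z) (dir t)}"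
        have inj: "inj_on (\<lambda>(y, z). (z - r * y, z - r' * y)) ?Z"
        proof (rule inj_onI, clarify)
          fix y z y' z' assume e: "z - r * y = z' - r * y'" "z - r' * y = z' - r' * y'"
          have "(r - r') * (y - y') = (z - r' * y - (z' - r' * y')) - (z - r * y - (z' - r * y'))" by (simp add: algebra_simps)
          then have "y = y'" using e ne by simp
          then show "y = y' \<and> z = z'" using e by simp
        qed
        have sub: "(\<lambda>(y, z). (z - r * y, z - r' * y)) ` ?Z \<subseteq> ?X r t \<times> ?X r' t"
        proof (clarify, intro conjI)
          fix y z assume b: "bad (1, y, z) (dir t)"
          show "z - r * y \<in> ?X r t" "z - r' * y \<in> ?X r' t" using b by (auto intro!: exI[of _ y])
        qed
        have "finite (?X r t \<times> ?X r' t)" using r by (rule finite_cartesian_product)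
        then have fZ: "finite ?Z" by (rule inj_on_finite[OF inj sub])
        have "{s. \<exists>y. bad (1, y, s + t * y) (dir t)} \<subseteq> (\<lambda>(y, z). z - t * y) ` ?Z"
        proof
          fix s assume "s \<in> {s. \<exists>y. bad (1, y, s + t * y) (dir t)}"
          then obtain y where "bad (1, y, s + t * y) (dir t)" by blast
          then show "s \<in> (\<lambda>(y, z). z - t * y) ` ?Z" by (intro image_eqI[of _ _ "(y, s + t * y)"]) auto
        qed
        then have "finite {s. \<exists>y. bad (1, y, s + t * y) (dir t)}" using fZ finite_subset by blast
        then have fU: "finite ({s. \<exists>y. bad (1, y, s + t * y) (dir t)} \<union> {s. \<not> (\<exists>y. bad (1, y, s + t * y) (dir t))})"
          using fullS[OF \<Theta>(3)[OF t]] by blast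
        have U: "{s. \<exists>y. bad (1, y, s + t * y) (dir t)} \<union> {s. \<not> (\<exists>y. bad (1, y, s + t * y) (dir t))} = UNIV" by blast
        show False using fU infinite_UNIV_char_0[where 'a = 'k] unfolding U by contradiction
      qed
      then have "{r. finite (?X r t)} = {} \<or> (\<exists>r. {r. finite (?X r t)} \<subseteq> {r})" by blast
      then show ?thesis using finite_subset by fastforce
    qed
    have "finite (\<Union>t\<in>\<Theta>. {r. finite (?X r t)})" using \<Theta>(1) finR by blast
    then have "finite {r. \<exists>t\<in>\<Theta>. finite (?X r t)}" by (rule rev_finite_subset) blast
    from ex_avoid[OF this] obtain r where r: "\<And>t. t \<in> \<Theta> \<Longrightarrow> infinite (?X r t)" by blast
    have cof: "finite {x. \<not> (\<exists>y. bad (1, y, x + r * y) (dir t))}" if t: "t \<in> \<Theta>" for t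
    proof -
      define \<mu> :: "'k \<times> 'k \<Rightarrow> 'k v3" where "\<mu> i = (1, snd i, fst i + r * snd i)" for i
      have v\<mu>: "vin pf2 \<mu>" unfolding vin_def \<mu>_def fst_conv snd_conv
        by (intro conjI falg_const falg_add falg_mult falg_pf2 pf2_fst pf2_snd)
      have vc: "vin pf2 (\<lambda>_. v)" for v by (rule vin_const[OF falg_pf2])
      let ?g = "\<lambda>f h a b i. f i a * h i b - f i b * h i a"
      let ?v0 = "\<lambda>i. M (\<mu> i) (\<mu> i) (\<mu> i) (\<mu> i)" and ?v1 = "\<lambda>i. M (\<mu> i) (\<mu> i) (\<mu> i) (dir t)" and ?v2 = "\<lambda>i. M (\<mu> i) (\<mu> i) (dir t) (dir t)"
      define F where "F = (\<Union>a b. {?g ?v0 ?v1 a b, ?g ?v0 ?v2 a b, ?g ?v1 ?v2 a b})"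
      have m: "(\<lambda>i. ?v0 i a) \<in> pf2" "(\<lambda>i. ?v1 i a) \<in> pf2" "(\<lambda>i. ?v2 i a) \<in> pf2" for a
        by (intro M_falg falg_pf2 v\<mu> vc)+
      have F: "F \<subseteq> pf2" unfolding F_def using m by (auto intro!: falg_diff falg_mult falg_pf2)
      have iff: "(\<forall>g\<in>F. g (x, y) = 0) \<longleftrightarrow> bad (1, y, x + r * y) (dir t)" for x y
        unfolding F_def bad_def par_def \<mu>_def by (simp only: UN_iff ball_UN ball_simps insert_iff empty_iff fst_conv snd_conv right_minus_eq eq_iff_diff_eq_0[symmetric]) blast
      have "infinite {x. \<exists>y. \<forall>g\<in>F. g (x, y) = 0}" unfolding iff using r[OF t] .
      from elimination[OF F this] show ?thesis unfolding iff .
    qed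
    \<comment> \<open>Moving the given point along the first axis reaches the affine chart without
      meeting the Hessian curve; homogeneity normalizes the first coordinate.\<close>
    obtain \<tau> \<sigma> where h1: "hess (1, \<tau>, \<sigma>) \<noteq> 0"
    proof -
      have "hess (\<mu>0 + sm 0 (1, 0, 0)) \<noteq> 0" using h by simp
      then have "finite {y. hess (\<mu>0 + sm y (1, 0, 0)) = 0}" by (rule hess_zeros)
      then have "finite ({y. hess (\<mu>0 + sm y (1, 0, 0)) = 0} \<union> {- fst \<mu>0})" by simp
      then have "finite {y. hess (\<mu>0 + sm y (1, 0, 0)) = 0 \<or> y = - fst \<mu>0}" by (simp add: Collect_disj_eq)
      from ex_avoid[OF this] obtain y where y: "hess (\<mu>0 + sm y (1, 0, 0)) \<noteq> 0" "y \<noteq> - fst \<mu>0" by blast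
      obtain a b c where \<mu>0: "\<mu>0 = (a, b, c)" by (cases \<mu>0)
      have n: "a + y \<noteq> 0" using y(2) by (simp add: \<mu>0 add_eq_0_iff)
      have "\<mu>0 + sm y (1, 0, 0) = sm (a + y) (1, b / (a + y), c / (a + y))" using n by (simp add: \<mu>0 sm_def)
      then have "hess (1, b / (a + y), c / (a + y)) \<noteq> 0" using y(1) by (auto simp: hess_scale)
      then show ?thesis using that by blast
    qed
    have hx: "finite {x. hess (1, \<tau>, x + r * \<tau>) = 0}"
    proof -
      have e: "(1, \<tau>, x + r * \<tau>) = (1, \<tau>, r * \<tau>) + sm x (0, 0, 1)" for x by (simp add: sm_def add.commute)
      have "hess ((1, \<tau>, r * \<tau>) + sm (\<sigma> - r * \<tau>) (0, 0, 1)) \<noteq> 0" using h1 by (simp add: sm_def)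
      from hess_zeros(1)[OF this] show ?thesis unfolding e .
    qed
    have "finite (\<Union>t\<in>\<Theta>. {x. \<not> (\<exists>y. bad (1, y, x + r * y) (dir t))})" using \<Theta>(1) cof by blast
    then have finB: "finite ((\<Union>t\<in>\<Theta>. {x. \<not> (\<exists>y. bad (1, y, x + r * y) (dir t))}) \<union> {x. hess (1, \<tau>, x + r * \<tau>) = 0})" (is "finite ?B")
      using hx by blast
    have spx: "\<exists>y. sp (1, y, x + r * y)" if x: "x \<notin> ?B" for x
    proof -
      have "\<forall>t\<in>\<Theta>. \<exists>y. bad (1, y, x + r * y) (dir t)" using x by blast
      then obtain Y where Y: "\<And>t. t \<in> \<Theta> \<Longrightarrow> bad (1, Y t, x + r * Y t) (dir t)" by metis
      let ?R = "{y. hess ((1, 0, x) + sm y (0, 1, r)) = 0}"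
      have e: "(1, y, x + r * y) = (1, 0, x) + sm y (0, 1, r)" for y by (simp add: sm_def mult.commute)
      have "hess ((1, 0, x) + sm \<tau> (0, 1, r)) \<noteq> 0" using x unfolding e[symmetric] by blast
      from hess_zeros[OF this] have R: "finite ?R" "card ?R \<le> 9" .
      have YR: "Y t \<in> ?R" if "t \<in> \<Theta>" for t
      proof -
        have "cross (1, Y t, x + r * Y t) (dir t) \<noteq> 0" by (simp add: v3_defs dir_def)
        from hess_zero_if_bad[OF Y[OF that] this] show ?thesis unfolding e by blast
      qed
      have "?R \<noteq> {}" using YR \<Theta>(2) by fastforce
      moreover have "Y \<in> \<Theta> \<rightarrow> ?R" using YR by blast
      ultimately obtain y where "card (Y -` {y} \<inter> \<Theta>) * card ?R \<ge> card \<Theta>"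
        using pigeonhole_card[of Y \<Theta> ?R] \<Theta>(1) R(1) by blast
      then have "19 \<le> card (Y -` {y} \<inter> \<Theta>) * card ?R" using \<Theta>(2) by simp
      also have "\<dots> \<le> card (Y -` {y} \<inter> \<Theta>) * 9" using R(2) by (rule mult_le_mono2)
      finally have "3 \<le> card (Y -` {y} \<inter> \<Theta>)" by linarith
      then obtain S where S: "S \<subseteq> Y -` {y} \<inter> \<Theta>" "card S = 3" by (meson obtain_subset_with_card_n)
      then obtain a b c where abc: "S = {a, b, c}" "a \<noteq> b" "a \<noteq> c" "b \<noteq> c" by (metis card_3_iff)
      have bad3: "bad (1, y, x + r * y) (dir t)" if "t \<in> S" for t using S(1) that Y[of t] by auto
      have "dir c = sm ((c - b) / (a - b)) (dir a) + sm ((a - c) / (a - b)) (dir b)"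
        using three[OF abc(2), of c] by (simp add: sm_def dir_def)
      then have "bad (1, y, x + r * y) (sm ((c - b) / (a - b)) (dir a) + sm ((a - c) / (a - b)) (dir b))" using bad3[of c] abc(1) by auto
      from three_bad_directions[OF _ bad3[of a] bad3[of b] this] have "sp (1, y, x + r * y)"
        using abc by (auto simp: sp_def dir_def v3_defs)
      then show ?thesis by blast
    qed
    \<comment> \<open>One special point on each of infinitely many parallel lines; distinct lines
      give non-proportional points.\<close>
    have "\<forall>x. \<exists>y. x \<notin> ?B \<longrightarrow> sp (1, y, x + r * y)" using spx by blast
    from choice[OF this] obtain W where W: "\<And>x. x \<notin> ?B \<Longrightarrow> sp (1, W x, x + r * W x)" by blast
    have "infinite (UNIV - ?B)" using finB infinite_UNIV_char_0 by (simp add: Diff_infinite_finite)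
    then show ?thesis
    proof (rule qrank_infinite_special[of _ "\<lambda>x. (1, W x, x + r * W x)"])
      fix x assume "x \<in> UNIV - ?B"
      then have "sp (1, W x, x + r * W x)" using W by blast
      then show "alpha (1, W x, x + r * W x) \<or> (\<exists>c l. beta (1, W x, x + r * W x) c l)" unfolding sp_def .
    next
      fix x x' :: 'k assume ne: "x \<noteq> x'"
      show "cross (1, W x, x + r * W x) (1, W x', x' + r * W x') \<noteq> 0"
      proof
        assume "cross (1, W x, x + r * W x) (1, W x', x' + r * W x') = 0"
        then have "W x' = W x" "x' + r * W x' = x + r * W x" by (auto simp: v3_defs)
        then show False using ne by simp
      qed
    qed
  qed
qed

end

section \<open>Identically vanishing Hessian\<close>

lemma det3_permute:
  fixes a b c :: "'k::comm_ring_1 v3"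
  assumes "det3 a b c = 0"
  shows "det3 a c b = 0" "det3 b a c = 0" "det3 b c a = 0" "det3 c a b = 0" "det3 c b a = 0"
proof -
  have "det3 a c b = - det3 a b c" by (cases a; cases b; cases c) (simp add: v3_defs algebra_simps)
  then show "det3 a c b = 0" using assms by simp
  then show "det3 b a c = 0" "det3 c b a = 0" using det3_cycle[of a c b] det3_cycle[of b a c] by simp_all
  show "det3 b c a = 0" "det3 c a b = 0" using assms det3_cycle[of a b c] det3_cycle[of b c a] by simp_all
qed

context quintic_form
begin

lemma M_line_pf: "(\<lambda>t. M (a + sm t b) (a + sm t b) (a + sm t b) x y) \<in> pf"
  "(\<lambda>t. M (a + sm t b) (a + sm t b) (a + sm t b) (a + sm t b) y) \<in> pf"
  by (intro M_falg falg_pf vin_affine pf_id vin_const)+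

text \<open>Differentiating the proportionality of M \<mu>^4 and M \<mu>^3 b along b cancels the
  symmetric terms and leaves that of M \<mu>^4 and M \<mu>^2 b^2. So where the gradient is nonzero,
  \<mu> is bad in every direction.\<close>

lemma special_if_hess_rank1:
  assumes par: "\<And>\<mu> a b. par (M \<mu> \<mu> \<mu> a) (M \<mu> \<mu> \<mu> b)" and nz: "M \<mu> \<mu> \<mu> \<mu> x0 \<noteq> 0"
  shows "alpha \<mu> \<or> (\<exists>c l. beta \<mu> c l)"
proof -
  have bad: "bad \<mu> b" for b
  proof -
    have 1: "par (M \<mu> \<mu> \<mu> \<mu>) (M \<mu> \<mu> \<mu> b)" using par .
    have 2: "M \<mu> \<mu> \<mu> \<mu> x * M \<mu> \<mu> b b y = M \<mu> \<mu> \<mu> \<mu> y * M \<mu> \<mu> b b x" for x y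
    proof -
      let ?m = "\<lambda>t. \<mu> + sm t b"
      have D4: "D1 (\<lambda>t. M (?m t) (?m t) (?m t) (?m t) z) (M \<mu> \<mu> \<mu> \<mu> z) (M b \<mu> \<mu> \<mu> z + M \<mu> b \<mu> \<mu> z + M \<mu> \<mu> b \<mu> z + M \<mu> \<mu> \<mu> b z + M \<mu> \<mu> \<mu> \<mu> 0)" for z
        by (rule M_D1[OF V1_line V1_line V1_line V1_line V1_const])
      have D3: "D1 (\<lambda>t. M (?m t) (?m t) (?m t) b z) (M \<mu> \<mu> \<mu> b z) (M b \<mu> \<mu> b z + M \<mu> b \<mu> b z + M \<mu> \<mu> b b z + M \<mu> \<mu> \<mu> 0 z + M \<mu> \<mu> \<mu> b 0)" for z
        by (rule M_D1[OF V1_line V1_line V1_line V1_const V1_const])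
      have z: "M \<mu> \<mu> \<mu> \<mu> 0 = 0" "M \<mu> \<mu> \<mu> 0 z = 0" "M \<mu> \<mu> \<mu> b 0 = 0" for z
        using sm5[of \<mu> \<mu> \<mu> \<mu> 0 0] sm4[of \<mu> \<mu> \<mu> 0 0 z] sm5[of \<mu> \<mu> \<mu> b 0 0] by simp_all
      have e: "M b \<mu> \<mu> \<mu> z = M \<mu> \<mu> \<mu> b z" "M \<mu> b \<mu> \<mu> z = M \<mu> \<mu> \<mu> b z" "M \<mu> \<mu> b \<mu> z = M \<mu> \<mu> \<mu> b z"
        "M b \<mu> \<mu> b z = M \<mu> \<mu> b b z" "M \<mu> b \<mu> b z = M \<mu> \<mu> b b z" for z
        by (simp_all only: M_ac)
      note D4 = D4[unfolded e z] and D3 = D3[unfolded e z]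
      have "D1 (\<lambda>t. M (?m t) (?m t) (?m t) (?m t) x * M (?m t) (?m t) (?m t) b y + (- 1) * (M (?m t) (?m t) (?m t) (?m t) y * M (?m t) (?m t) (?m t) b x))
        (M \<mu> \<mu> \<mu> \<mu> x * M \<mu> \<mu> \<mu> b y + (- 1) * (M \<mu> \<mu> \<mu> \<mu> y * M \<mu> \<mu> \<mu> b x))
        (((M \<mu> \<mu> \<mu> b x + M \<mu> \<mu> \<mu> b x + M \<mu> \<mu> \<mu> b x + M \<mu> \<mu> \<mu> b x + 0) * M \<mu> \<mu> \<mu> b y + M \<mu> \<mu> \<mu> \<mu> x * (M \<mu> \<mu> b b y + M \<mu> \<mu> b b y + M \<mu> \<mu> b b y + 0 + 0))
        + (0 * (M \<mu> \<mu> \<mu> \<mu> y * M \<mu> \<mu> \<mu> b x) + (- 1) * ((M \<mu> \<mu> \<mu> b y + M \<mu> \<mu> \<mu> b y + M \<mu> \<mu> \<mu> b y + M \<mu> \<mu> \<mu> b y + 0) * M \<mu> \<mu> \<mu> b x + M \<mu> \<mu> \<mu> \<mu> y * (M \<mu> \<mu> b b x + M \<mu> \<mu> b b x + M \<mu> \<mu> b b x + 0 + 0))))"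
        by (intro D1_add D1_mult D1_const D4 D3)
      from D1_zero[OF this] have "3 * (M \<mu> \<mu> \<mu> \<mu> x * M \<mu> \<mu> b b y) = 3 * (M \<mu> \<mu> \<mu> \<mu> y * M \<mu> \<mu> b b x)"
        using par_D[OF par] by (simp add: algebra_simps)
      then show ?thesis by simp
    qed
    have "\<exists>k. \<forall>y. g y = k * M \<mu> \<mu> \<mu> \<mu> y" if g: "\<And>x y. M \<mu> \<mu> \<mu> \<mu> x * g y = M \<mu> \<mu> \<mu> \<mu> y * g x" for g
      using g[of x0] nz by (intro exI[of _ "g x0 / M \<mu> \<mu> \<mu> \<mu> x0"]) (simp add: field_simps)
    then obtain k1 k2 where k: "\<And>y. M \<mu> \<mu> \<mu> b y = k1 * M \<mu> \<mu> \<mu> \<mu> y" "\<And>y. M \<mu> \<mu> b b y = k2 * M \<mu> \<mu> \<mu> \<mu> y"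
      using par_D[OF 1] 2 by meson
    show ?thesis by (rule badI[of _ 1 "M \<mu> \<mu> \<mu> \<mu>" _ k1 k2]) (simp_all add: k)
  qed
  have "\<mu> \<noteq> 0"
  proof
    assume "\<mu> = 0"
    then show False using nz sm1[of 0 0 \<mu> \<mu> \<mu> x0] by simp
  qed
  then obtain b where "cross \<mu> b \<noteq> 0" using ex_cross by blast
  then obtain e where "det3 e \<mu> b \<noteq> 0" using ex_det3 by blast
  then have "det3 \<mu> b e \<noteq> 0" using det3_cycle[of \<mu> b e] by simp
  from three_bad_directions[OF this bad bad bad, of 1 1] show ?thesis by simp
qed

lemma qrank_if_hess_rank1:
  assumes par: "\<And>\<mu> a b. par (M \<mu> \<mu> \<mu> a) (M \<mu> \<mu> \<mu> b)"
  shows "qrank 10 M"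
proof (cases "\<forall>\<mu> x. M \<mu> \<mu> \<mu> \<mu> x = 0")
  case True
  have "M a b c d e = 0" for a b c d e by (rule cone_if_polar4) (use True in blast)
  then show ?thesis by (rule qrank_0)
next
  case False
  then obtain \<mu> x where nz: "M \<mu> \<mu> \<mu> \<mu> x \<noteq> 0" by blast
  have "\<mu> \<noteq> 0"
  proof
    assume "\<mu> = 0"
    then show False using nz sm1[of 0 0 \<mu> \<mu> \<mu> x] by simp
  qed
  then obtain c where c: "cross \<mu> c \<noteq> 0" using ex_cross by blast
  let ?g = "\<lambda>t. M (\<mu> + sm t c) (\<mu> + sm t c) (\<mu> + sm t c) (\<mu> + sm t c) x"
  have "finite {t. ?g t = 0}" by (rule pf_finite_zeros[where a = 0, OF M_line_pf(2)]) (use nz in simp)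
  then have inf: "infinite (UNIV - {t. ?g t = 0})" using infinite_UNIV_char_0 by (simp add: Diff_infinite_finite)
  show ?thesis
  proof (rule qrank_infinite_special[OF inf, of "\<lambda>t. \<mu> + sm t c"])
    fix t assume "t \<in> UNIV - {t. ?g t = 0}"
    then have "?g t \<noteq> 0" by blast
    then show "alpha (\<mu> + sm t c) \<or> (\<exists>ca l. beta (\<mu> + sm t c) ca l)" by (rule special_if_hess_rank1[OF par])
  next
    fix s t :: 'k assume "s \<noteq> t"
    moreover have "cross (\<mu> + sm s c) (\<mu> + sm t c) = sm (t - s) (cross \<mu> c)"
      by (cases \<mu>; cases c) (simp add: v3_defs algebra_simps)
    ultimately show "cross (\<mu> + sm s c) (\<mu> + sm t c) \<noteq> 0" using c by (simp add: sm_eq_0_iff)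
  qed
qed

text \<open>The argument of Gordan and Noether in three variables: differentiating \<open>M \<mu>\<^sup>3 k(\<mu>) = 0\<close> shows
  that the gradient of the quintic is constant along the line through \<open>\<mu>\<close> and \<open>k(\<mu>)\<close>. Two such
  lines meet, so the direction \<open>k(\<mu>)\<close> is constant.\<close>

lemma qrank_if_kernel:
  fixes k :: "'k v3 \<Rightarrow> 'k v3"
  assumes kpf: "\<And>a b. vin pf (\<lambda>t. k (a + sm t b))" and k1: "\<And>\<mu> y. M \<mu> \<mu> \<mu> (k \<mu>) y = 0" and knz: "k \<mu>1 \<noteq> 0"
  shows "qrank 10 M"
proof -
  have der: "\<exists>k'. V1 (\<lambda>t. k (\<mu> + sm t c)) (k \<mu>) k'" for \<mu> c
    using V1_exists[OF kpf[of \<mu> c]] by simp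
  have zero: "M 0 b c d e = 0" "M a 0 c d e = 0" "M a b 0 d e = 0" "M a b c 0 e = 0" "M a b c d 0 = 0" for a b c d e
    using sm1[of 0 0 b c d e] sm2[of a 0 0 c d e] sm3[of a b 0 0 d e] sm4[of a b c 0 0 e] sm5[of a b c d 0 0] by simp_all
  \<comment> \<open>One argument is frozen at k(\<mu>) before differentiating. The unknown
    derivative of k then occurs only in terms that the previous identity kills; the same step gives
    \<open>k3\<close> and \<open>k4\<close>.\<close>
  have k2: "M \<mu> \<mu> (k \<mu>) (k \<mu>) c = 0" for \<mu> c
  proof -
    obtain k' where k': "V1 (\<lambda>t. k (\<mu> + sm t c)) (k \<mu>) k'" using der by blast
    from D1_zero[OF M_D1[OF V1_line V1_line V1_line k' V1_const] k1]
    have "M c \<mu> \<mu> (k \<mu>) (k \<mu>) + M \<mu> c \<mu> (k \<mu>) (k \<mu>) + M \<mu> \<mu> c (k \<mu>) (k \<mu>) + M \<mu> \<mu> \<mu> k' (k \<mu>) = 0" by (simp add: zero)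
    moreover have "M c \<mu> \<mu> (k \<mu>) (k \<mu>) = M \<mu> \<mu> (k \<mu>) (k \<mu>) c" "M \<mu> c \<mu> (k \<mu>) (k \<mu>) = M \<mu> \<mu> (k \<mu>) (k \<mu>) c"
      "M \<mu> \<mu> c (k \<mu>) (k \<mu>) = M \<mu> \<mu> (k \<mu>) (k \<mu>) c" "M \<mu> \<mu> \<mu> k' (k \<mu>) = M \<mu> \<mu> \<mu> (k \<mu>) k'" by (simp_all only: M_ac)
    ultimately have "3 * M \<mu> \<mu> (k \<mu>) (k \<mu>) c = 0" using k1 by simp
    then show ?thesis by simp
  qed
  have k3: "M \<mu> (k \<mu>) (k \<mu>) (k \<mu>) c = 0" for \<mu> c
  proof -
    obtain k' where k': "V1 (\<lambda>t. k (\<mu> + sm t c)) (k \<mu>) k'" using der by blast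
    from D1_zero[OF M_D1[OF V1_line V1_line k' k' V1_const] k2]
    have "M c \<mu> (k \<mu>) (k \<mu>) (k \<mu>) + M \<mu> c (k \<mu>) (k \<mu>) (k \<mu>) + M \<mu> \<mu> k' (k \<mu>) (k \<mu>) + M \<mu> \<mu> (k \<mu>) k' (k \<mu>) = 0" by (simp add: zero)
    moreover have "M c \<mu> (k \<mu>) (k \<mu>) (k \<mu>) = M \<mu> (k \<mu>) (k \<mu>) (k \<mu>) c" "M \<mu> c (k \<mu>) (k \<mu>) (k \<mu>) = M \<mu> (k \<mu>) (k \<mu>) (k \<mu>) c"
      "M \<mu> \<mu> k' (k \<mu>) (k \<mu>) = M \<mu> \<mu> (k \<mu>) (k \<mu>) k'" "M \<mu> \<mu> (k \<mu>) k' (k \<mu>) = M \<mu> \<mu> (k \<mu>) (k \<mu>) k'" by (simp_all only: M_ac)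
    ultimately have "2 * M \<mu> (k \<mu>) (k \<mu>) (k \<mu>) c = 0" using k2 by simp
    then show ?thesis by simp
  qed
  have k4: "M (k \<mu>) (k \<mu>) (k \<mu>) (k \<mu>) c = 0" for \<mu> c
  proof -
    obtain k' where k': "V1 (\<lambda>t. k (\<mu> + sm t c)) (k \<mu>) k'" using der by blast
    from D1_zero[OF M_D1[OF V1_line k' k' k' V1_const] k3]
    have "M c (k \<mu>) (k \<mu>) (k \<mu>) (k \<mu>) + M \<mu> k' (k \<mu>) (k \<mu>) (k \<mu>) + M \<mu> (k \<mu>) k' (k \<mu>) (k \<mu>) + M \<mu> (k \<mu>) (k \<mu>) k' (k \<mu>) = 0" by (simp add: zero)
    moreover have "M c (k \<mu>) (k \<mu>) (k \<mu>) (k \<mu>) = M (k \<mu>) (k \<mu>) (k \<mu>) (k \<mu>) c" "M \<mu> k' (k \<mu>) (k \<mu>) (k \<mu>) = M \<mu> (k \<mu>) (k \<mu>) (k \<mu>) k'"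
      "M \<mu> (k \<mu>) k' (k \<mu>) (k \<mu>) = M \<mu> (k \<mu>) (k \<mu>) (k \<mu>) k'" "M \<mu> (k \<mu>) (k \<mu>) k' (k \<mu>) = M \<mu> (k \<mu>) (k \<mu>) (k \<mu>) k'" by (simp_all only: M_ac)
    ultimately show ?thesis using k3 by simp
  qed
  have grad: "M (sm x \<mu> + sm y (k \<mu>)) (sm x \<mu> + sm y (k \<mu>)) (sm x \<mu> + sm y (k \<mu>)) (sm x \<mu> + sm y (k \<mu>)) z = x^4 * M \<mu> \<mu> \<mu> \<mu> z" for x y \<mu> z
  proof -
    have ex: "M (sm x a + sm y b) (sm x a + sm y b) (sm x a + sm y b) (sm x a + sm y b) z = x^4 * M a a a a z + 4 * x^3 * y * M a a a b z
      + 6 * x^2 * y^2 * M a a b b z + 4 * x * y^3 * M a b b b z + y^4 * M b b b b z" for a b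
      by (simp add: M_lin M_ac algebra_simps eval_nat_numeral)
    show ?thesis unfolding ex k1 k2 k3 k4 by simp
  qed
  \<comment> \<open>A dependence of the four vectors is a common point of the two lines. Its
    gradient would be a multiple of both gradients, so the coefficients of \<mu> and \<nu> vanish
    and the relation is between the two kernel vectors.\<close>
  have meet: "cross (k \<mu>) (k \<nu>) = 0" if np: "\<not> par (M \<mu> \<mu> \<mu> \<mu>) (M \<nu> \<nu> \<nu> \<nu>)" for \<mu> \<nu>
  proof -
    obtain q0 q1 q2 q3 where q: "\<not> (q0 = 0 \<and> q1 = 0 \<and> q2 = 0 \<and> q3 = 0)" "sm q0 \<mu> + sm q1 (k \<mu>) + sm q2 \<nu> + sm q3 (k \<nu>) = 0"
      by (rule four_vectors_dependent)
    have eq: "sm q0 \<mu> + sm q1 (k \<mu>) = sm (- q2) \<nu> + sm (- q3) (k \<nu>)"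
    proof -
      have neg: "sm (- q) v = - sm q v" for q :: 'k and v by (cases v) (simp add: sm_def)
      have "x + y + z + w = 0 \<Longrightarrow> x + y = - z + - w" for x y z w :: "'k v3"
        by (metis add.assoc eq_neg_iff_add_eq_0 minus_add_distrib)
      from this[OF q(2)] show ?thesis unfolding neg .
    qed
    have e4: "q0^4 * M \<mu> \<mu> \<mu> \<mu> z = q2^4 * M \<nu> \<nu> \<nu> \<nu> z" for z
      using grad[of q0 \<mu> q1 z] unfolding eq grad by simp
    have q0: "q0 = 0"
    proof (rule ccontr)
      assume "q0 \<noteq> 0"
      then have "M \<mu> \<mu> \<mu> \<mu> z = (q2^4 / q0^4) * M \<nu> \<nu> \<nu> \<nu> z" for z using e4[of z] by (simp add: field_simps)
      then have "par (M \<mu> \<mu> \<mu> \<mu>) (M \<nu> \<nu> \<nu> \<nu>)" unfolding par_def by (simp add: algebra_simps)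
      then show False using np by blast
    qed
    have q2: "q2 = 0"
    proof (rule ccontr)
      assume "q2 \<noteq> 0"
      then have "M \<nu> \<nu> \<nu> \<nu> z = 0" for z using e4[of z] q0 by simp
      then have "par (M \<mu> \<mu> \<mu> \<mu>) (M \<nu> \<nu> \<nu> \<nu>)" unfolding par_def by simp
      then show False using np by blast
    qed
    have q13: "sm q1 (k \<mu>) + sm q3 (k \<nu>) = 0" using q(2) q0 q2 by simp
    have "sm q3 (cross (k \<mu>) (k \<nu>)) = cross (k \<mu>) (sm q1 (k \<mu>) + sm q3 (k \<nu>))" "sm q1 (cross (k \<mu>) (k \<nu>)) = cross (sm q1 (k \<mu>) + sm q3 (k \<nu>)) (k \<nu>)"
      by (simp_all add: cross_scale)
    moreover have "cross v 0 = 0" "cross 0 v = 0" for v :: "'k v3" by (cases v; simp add: v3_defs)+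
    ultimately have "sm q3 (cross (k \<mu>) (k \<nu>)) = 0" "sm q1 (cross (k \<mu>) (k \<nu>)) = 0" unfolding q13 by simp_all
    then show ?thesis using q(1) q0 q2 by (auto simp: sm_eq_0_iff)
  qed
  show ?thesis
  proof (cases "\<forall>\<mu> x. M \<mu> \<mu> \<mu> \<mu> x = 0")
    case True
    have "M a b c d e = 0" for a b c d e by (rule cone_if_polar4) (use True in blast)
    then show ?thesis by (rule qrank_0)
  next
    case False
    then obtain \<mu>2 x0 where nz: "M \<mu>2 \<mu>2 \<mu>2 \<mu>2 x0 \<noteq> 0" by blast
    obtain l where l: "dot l (k \<mu>1) \<noteq> 0"
    proof -
      obtain a b c where abc: "k \<mu>1 = (a, b, c)" by (cases "k \<mu>1")
      then consider "a \<noteq> 0" | "b \<noteq> 0" | "c \<noteq> 0" using knz by (auto simp: zero_prod_def)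
      then show ?thesis
      proof cases
        case 1 then show ?thesis using that[of "(1, 0, 0)"] by (simp add: dot_def abc)
      next
        case 2 then show ?thesis using that[of "(0, 1, 0)"] by (simp add: dot_def abc)
      next
        case 3 then show ?thesis using that[of "(0, 0, 1)"] by (simp add: dot_def abc)
      qed
    qed
    \<comment> \<open>Generic points, with nonzero kernel vector and nonzero gradient. Polynomial
      identities that hold on them hold everywhere, by restriction to a line through one such
      point.\<close>
    define G where "G \<mu> \<longleftrightarrow> dot l (k \<mu>) \<noteq> 0 \<and> M \<mu> \<mu> \<mu> \<mu> x0 \<noteq> 0" for \<mu>
    have lk: "(\<lambda>t. dot l (k (a + sm t b))) \<in> pf" for a b
    proof -
      obtain p q r where l: "l = (p, q, r)" by (cases l)
      have "dot l v = p * fst v + q * fst (snd v) + r * snd (snd v)" for v by (cases v) (simp add: dot_def l)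
      then show ?thesis using kpf[of a b] unfolding vin_def
        by (simp only:) (intro falg_add falg_mult falg_const falg_pf; blast)
    qed
    obtain \<mu> where \<mu>: "G \<mu>"
    proof -
      define c where "c = \<mu>2 + sm (- 1) \<mu>1"
      have c1: "\<mu>1 + sm 0 c = \<mu>1" "\<mu>1 + sm 1 c = \<mu>2" unfolding c_def by (cases \<mu>1; cases \<mu>2; simp add: v3_defs)+
      have "finite {t. dot l (k (\<mu>1 + sm t c)) = 0}" by (rule pf_finite_zeros[where a = 0, OF lk]) (use l c1 in simp)
      moreover have "finite {t. M (\<mu>1 + sm t c) (\<mu>1 + sm t c) (\<mu>1 + sm t c) (\<mu>1 + sm t c) x0 = 0}"
        by (rule pf_finite_zeros[where a = 1, OF M_line_pf(2)]) (use nz c1 in simp)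
      ultimately have "finite {t. dot l (k (\<mu>1 + sm t c)) = 0 \<or> M (\<mu>1 + sm t c) (\<mu>1 + sm t c) (\<mu>1 + sm t c) (\<mu>1 + sm t c) x0 = 0}"
        by (simp add: Collect_disj_eq)
      from ex_avoid[OF this] show ?thesis using that unfolding G_def by blast
    qed
    have dense: "\<phi> \<nu> = 0" if \<phi>: "\<And>a b. (\<lambda>t. \<phi> (a + sm t b)) \<in> pf" and z: "\<And>\<nu>. G \<nu> \<Longrightarrow> \<phi> \<nu> = 0" for \<phi> :: "'k v3 \<Rightarrow> 'k" and \<nu>
    proof (rule ccontr)
      assume n: "\<phi> \<nu> \<noteq> 0"
      define c where "c = \<nu> + sm (- 1) \<mu>"
      have c1: "\<mu> + sm 0 c = \<mu>" "\<mu> + sm 1 c = \<nu>" unfolding c_def by (cases \<mu>; cases \<nu>; simp add: v3_defs)+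
      have "finite {t. dot l (k (\<mu> + sm t c)) = 0}" by (rule pf_finite_zeros[where a = 0, OF lk]) (use \<mu> c1 in \<open>simp add: G_def\<close>)
      moreover have "finite {t. M (\<mu> + sm t c) (\<mu> + sm t c) (\<mu> + sm t c) (\<mu> + sm t c) x0 = 0}"
        by (rule pf_finite_zeros[where a = 0, OF M_line_pf(2)]) (use \<mu> c1 in \<open>simp add: G_def\<close>)
      moreover have "finite {t. \<phi> (\<mu> + sm t c) = 0}" by (rule pf_finite_zeros[where a = 1, OF \<phi>]) (use n c1 in simp)
      ultimately have "finite {t. (dot l (k (\<mu> + sm t c)) = 0 \<or> M (\<mu> + sm t c) (\<mu> + sm t c) (\<mu> + sm t c) (\<mu> + sm t c) x0 = 0) \<or> \<phi> (\<mu> + sm t c) = 0}"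
        by (simp add: Collect_disj_eq)
      from ex_avoid[OF this] show False using z unfolding G_def by blast
    qed
    have "\<exists>x. x \<noteq> 0 \<and> (\<forall>\<nu>. M \<nu> \<nu> \<nu> \<nu> x = 0)"
    proof (cases "\<forall>\<nu>. G \<nu> \<longrightarrow> par (M \<mu> \<mu> \<mu> \<mu>) (M \<nu> \<nu> \<nu> \<nu>)")
      case True
      have m0: "M \<mu> \<mu> \<mu> \<mu> x0 \<noteq> 0" using \<mu> by (simp add: G_def)
      have "hrow \<mu> \<mu> \<noteq> 0" using m0 dot_hrow[of \<mu> \<mu> x0] by (cases x0) (auto simp: dot_def zero_prod_def)
      then obtain b where b: "cross (hrow \<mu> \<mu>) b \<noteq> 0" using ex_cross by blast
      \<comment> \<open>If all gradients are proportional to one covector, any nonzero x killed by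
        that covector is a vertex.\<close>
      define x where "x = cross (hrow \<mu> \<mu>) b"
      have "dot (hrow \<mu> \<mu>) x = 0" unfolding x_def det3_def[symmetric] by (rule det3_eq_0)
      then have x: "M \<mu> \<mu> \<mu> \<mu> x = 0" by (simp add: dot_hrow)
      have "M \<nu> \<nu> \<nu> \<nu> x = 0" for \<nu>
      proof (rule dense[of "\<lambda>\<nu>. M \<nu> \<nu> \<nu> \<nu> x"])
        show "(\<lambda>t. M (a + sm t b) (a + sm t b) (a + sm t b) (a + sm t b) x) \<in> pf" for a b by (rule M_line_pf(2))
      next
        fix \<nu> assume "G \<nu>"
        then have "par (M \<mu> \<mu> \<mu> \<mu>) (M \<nu> \<nu> \<nu> \<nu>)" using True by blast
        from par_D[OF this] have "M \<mu> \<mu> \<mu> \<mu> x0 * M \<nu> \<nu> \<nu> \<nu> x = M \<mu> \<mu> \<mu> \<mu> x * M \<nu> \<nu> \<nu> \<nu> x0" .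
        then show "M \<nu> \<nu> \<nu> \<nu> x = 0" using x m0 by simp
      qed
      then show ?thesis using b x_def by blast
    next
      case False
      then obtain \<nu> where \<nu>: "G \<nu>" "\<not> par (M \<mu> \<mu> \<mu> \<mu>) (M \<nu> \<nu> \<nu> \<nu>)" by blast
      have kn: "k \<rho> \<noteq> 0" if "G \<rho>" for \<rho> using that unfolding G_def by (cases l) (auto simp: dot_def zero_prod_def)
      have ck: "cross (k \<mu>) (k \<rho>) = 0" if \<rho>: "G \<rho>" for \<rho>
      proof (cases "par (M \<mu> \<mu> \<mu> \<mu>) (M \<rho> \<rho> \<rho> \<rho>)")
        case False then show ?thesis by (rule meet)
      next
        case True
        \<comment> \<open>When the gradients at \<mu> and \<rho> are proportional, the comparison
          goes through the third point \<nu>, whose gradient is proportional to neither.\<close>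
        have "\<not> par (M \<rho> \<rho> \<rho> \<rho>) (M \<nu> \<nu> \<nu> \<nu>)"
        proof
          assume p: "par (M \<rho> \<rho> \<rho> \<rho>) (M \<nu> \<nu> \<nu> \<nu>)"
          have r0: "M \<rho> \<rho> \<rho> \<rho> x0 \<noteq> 0" using \<rho> by (simp add: G_def)
          have "M \<mu> \<mu> \<mu> \<mu> x * M \<nu> \<nu> \<nu> \<nu> y = M \<mu> \<mu> \<mu> \<mu> y * M \<nu> \<nu> \<nu> \<nu> x" for x y
          proof -
            have 1: "M \<mu> \<mu> \<mu> \<mu> x * M \<rho> \<rho> \<rho> \<rho> x0 = M \<mu> \<mu> \<mu> \<mu> x0 * M \<rho> \<rho> \<rho> \<rho> x" "M \<mu> \<mu> \<mu> \<mu> y * M \<rho> \<rho> \<rho> \<rho> x0 = M \<mu> \<mu> \<mu> \<mu> x0 * M \<rho> \<rho> \<rho> \<rho> y"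
              by (rule par_D[OF True])+
            have 2: "M \<rho> \<rho> \<rho> \<rho> x * M \<nu> \<nu> \<nu> \<nu> y = M \<rho> \<rho> \<rho> \<rho> y * M \<nu> \<nu> \<nu> \<nu> x" by (rule par_D[OF p])
            have "M \<rho> \<rho> \<rho> \<rho> x0 * (M \<mu> \<mu> \<mu> \<mu> x * M \<nu> \<nu> \<nu> \<nu> y) = M \<rho> \<rho> \<rho> \<rho> x0 * (M \<mu> \<mu> \<mu> \<mu> y * M \<nu> \<nu> \<nu> \<nu> x)"
              using 1 2 by algebra
            then show ?thesis using r0 by simp
          qed
          then show False using \<nu>(2) unfolding par_def by blast
        qed
        then have c1: "cross (k \<rho>) (k \<nu>) = 0" by (rule meet)
        have c2: "cross (k \<mu>) (k \<nu>) = 0" using \<nu>(2) by (rule meet)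
        have "sm (dot l (k \<nu>)) (cross (k \<mu>) (k \<rho>)) = 0"
        proof -
          have tri: "sm (dot l c) (cross a b) = sm (dot l a) (cross c b) + sm (- dot l b) (cross c a) + sm (det3 a b c) l" for a b c :: "'k v3"
            by (cases a; cases b; cases c; cases l) (simp add: v3_defs algebra_simps)
          have "det3 (k \<mu>) (k \<rho>) (k \<nu>) = 0" unfolding det3_def c1 by (cases "k \<mu>") (simp add: dot_def zero_prod_def)
          moreover have "cross (k \<nu>) (k \<rho>) = sm (- 1) (cross (k \<rho>) (k \<nu>))" "cross (k \<nu>) (k \<mu>) = sm (- 1) (cross (k \<mu>) (k \<nu>))"
            by (cases "k \<nu>"; cases "k \<rho>"; cases "k \<mu>"; simp add: v3_defs)+
          ultimately show ?thesis unfolding tri[of "k \<nu>" "k \<mu>" "k \<rho>"] c1 c2 by simp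
        qed
        then show ?thesis using \<nu>(1) by (simp add: sm_eq_0_iff G_def)
      qed
      have "M \<rho> \<rho> \<rho> (k \<mu>) y = 0" for \<rho> y
      proof (rule dense[of "\<lambda>\<rho>. M \<rho> \<rho> \<rho> (k \<mu>) y"])
        show "(\<lambda>t. M (a + sm t b) (a + sm t b) (a + sm t b) (k \<mu>) y) \<in> pf" for a b by (rule M_line_pf(1))
      next
        fix \<rho> assume \<rho>: "G \<rho>"
        have n: "dot l (k \<rho>) \<noteq> 0" using \<rho> by (simp add: G_def)
        have "sm (dot l (k \<rho>)) (k \<mu>) = sm (dot l (k \<mu>)) (k \<rho>)"
        proof -
          obtain a b c a' b' c' p q r where v: "k \<mu> = (a, b, c)" "k \<rho> = (a', b', c')" "l = (p, q, r)" by (cases "k \<mu>"; cases "k \<rho>"; cases l)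
          have "b * c' = c * b'" "c * a' = a * c'" "a * b' = b * a'" using ck[OF \<rho>] by (simp_all add: v v3_defs)
          then show ?thesis by (simp add: v dot_def sm_def) (intro conjI; algebra)
        qed
        then have "M \<rho> \<rho> \<rho> (sm (dot l (k \<rho>)) (k \<mu>)) y = M \<rho> \<rho> \<rho> (sm (dot l (k \<mu>)) (k \<rho>)) y" by simp
        then have "dot l (k \<rho>) * M \<rho> \<rho> \<rho> (k \<mu>) y = 0" by (simp add: M_lin k1)
        then show "M \<rho> \<rho> \<rho> (k \<mu>) y = 0" using n by simp
      qed
      then have "M \<rho> \<rho> \<rho> \<rho> (k \<mu>) = 0" for \<rho> by (simp only: sw45[of \<rho> \<rho> \<rho> \<rho> "k \<mu>"])
      then show ?thesis using kn[OF \<mu>] by blast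
    qed
    then obtain x where x: "x \<noteq> 0" "\<And>\<nu>. M \<nu> \<nu> \<nu> \<nu> x = 0" by blast
    have "M a b c d x = 0" for a b c d using cone_if_polar4[OF x(2)] .
    then have "M x a b c d = 0" for a b c d by (simp only: M_ac)
    then have "qrank 5 M" by (rule qrank_cone[OF x(1)])
    then show ?thesis by (rule qrank_mono) simp
  qed
qed

theorem qrank_10: "qrank 10 M"
proof (rule ccontr)
  assume no: "\<not> qrank 10 M"
  have all_bad: "\<exists>x y. (x \<noteq> 0 \<or> y \<noteq> 0) \<and> (\<forall>s t. bad (sm x e1 + sm y e2) (sm s e1 + sm t e2))" if "det3 e1 e2 e3 \<noteq> 0" for e1 e2 e3
    using good_or_bad_point[OF that] no by blast
  have h: "hess \<mu> = 0" for \<mu>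
  proof (rule ccontr)
    assume "hess \<mu> \<noteq> 0"
    then have "qrank 10 M" by (rule qrank_if_hess) (rule all_bad)
    then show False using no by blast
  qed
  let ?u = "(1, 0, 0)" and ?v = "(0, 1, 0)" and ?w = "(0, 0, 1)"
  \<comment> \<open>Two independent rows of a singular Hessian matrix have a cross product in its
    kernel that depends polynomially on \<mu>, as \<open>qrank_if_kernel\<close> requires. Hence all
    rows are proportional and the matrix has rank at most 1.\<close>
  have row: "cross (hrow \<mu> a) (hrow \<mu> b) = 0" if ab: "a \<in> {?u, ?v, ?w}" "b \<in> {?u, ?v, ?w}" for \<mu> a b
  proof (rule ccontr)
    assume n: "cross (hrow \<mu> a) (hrow \<mu> b) \<noteq> 0"
    let ?k = "\<lambda>\<mu>. cross (hrow \<mu> a) (hrow \<mu> b)"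
    have "vin pf (\<lambda>t. ?k (c + sm t d))" for c d
      unfolding vin_def hrow_def cross_def by (simp, intro conjI falg_diff falg_mult falg_pf M_line_pf)
    moreover have "M \<mu> \<mu> \<mu> (?k \<mu>) y = 0" for \<mu> y
    proof -
      have d: "dot (hrow \<mu> c) (?k \<mu>) = 0" if c: "c \<in> {?u, ?v, ?w}" for c
      proof -
        have "det3 (hrow \<mu> c) (hrow \<mu> a) (hrow \<mu> b) = 0"
        proof -
          have "det3 (hrow \<mu> ?u) (hrow \<mu> ?v) (hrow \<mu> ?w) = 0" using h[of \<mu>] by (simp add: hess_def)
          note P = this det3_permute[OF this]
          show ?thesis using ab c by (elim insertE emptyE) (simp_all only: P det3_eq_0)
        qed
        then show ?thesis by (simp add: det3_def)
      qed
      have "M \<mu> \<mu> \<mu> (?k \<mu>) y = M \<mu> \<mu> \<mu> y (?k \<mu>)" by (rule sw45)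
      also have "\<dots> = 0" unfolding expand(4)[of _ _ _ y] using d[of ?u] d[of ?v] d[of ?w] unfolding dot_hrow by simp
      finally show ?thesis .
    qed
    ultimately have "qrank 10 M" by (rule qrank_if_kernel[of ?k, OF _ _ n])
    then show False using no by blast
  qed
  have "par (M \<mu> \<mu> \<mu> a) (M \<mu> \<mu> \<mu> b)" for \<mu> a b
  proof -
    have add: "hrow \<mu> (a + b) = hrow \<mu> a + hrow \<mu> b" and scale: "hrow \<mu> (sm t a) = sm t (hrow \<mu> a)" for a b t
      unfolding hrow_def M_lin by (simp_all add: sm_def)
    have D: "det3 ?u ?v ?w \<noteq> (0 :: 'k)" by (simp add: v3_defs)
    have 1: "cross (hrow \<mu> a) (hrow \<mu> b) = 0" if b: "b \<in> {?u, ?v, ?w}" for a b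
      by (rule basis_induct[OF D, of "\<lambda>a. cross (hrow \<mu> a) (hrow \<mu> b) = 0"])
        (simp_all only: add scale cross_scale sm_simps add_0 row[OF _ b] insert_iff simp_thms)
    have 2: "cross (hrow \<mu> a) (hrow \<mu> b) = 0" for a b
      by (rule basis_induct[OF D, of "\<lambda>b. cross (hrow \<mu> a) (hrow \<mu> b) = 0"])
        (simp_all only: add scale cross_scale sm_simps add_0 1 insert_iff simp_thms)
    have "dot p x * dot q y = dot p y * dot q x" if "cross p q = 0" for p q x y :: "'k v3"
    proof -
      have "dot p x * dot q y - dot p y * dot q x = dot (cross p q) (cross x y)"
        by (cases p; cases q; cases x; cases y) (simp add: v3_defs algebra_simps)
      also have "\<dots> = 0" unfolding that by (cases "cross x y") (simp add: v3_defs)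
      finally show ?thesis by simp
    qed
    from this[OF 2] show ?thesis unfolding par_def dot_hrow by blast
  qed
  then show False using qrank_if_hess_rank1 no by blast
qed

end

subsection \<open>The symmetric algebra\<close>

lemma const_add: "const (a + b) = const a + const b"
  by (simp add: const_def single_add)

lemma const_mult: "const (a * b) = const a * const b"
  by (simp add: const_def mult_single)

lemma const_0: "const 0 = 0" and const_1: "const 1 = 1"
  by (simp_all add: const_def)

lemma const_power: "const (a ^ n) = const a ^ n"
  by (induction n) (simp_all add: const_1 const_mult)

lemma const_of_nat: "const (of_nat n) = of_nat n"
  by (induction n) (simp_all add: const_0 const_1 const_add)

lemmas const_simps = const_add const_mult const_1 const_0 const_power const_of_nat

lemma const_sum: "const (\<Sum>x\<in>A. f x) = (\<Sum>x\<in>A. const (f x))" for f :: "'a \<Rightarrow> 'k::comm_ring_1"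
  by (induction A rule: infinite_finite_induct) (simp_all add: const_simps)

lemma sum_singles: "(\<Sum>x\<in>Poly_Mapping.keys p. Poly_Mapping.single x (Poly_Mapping.lookup p x)) = p"
  by (rule poly_mapping_eqI) (simp add: lookup_sum lookup_single when_def in_keys_iff sum.delta)

lemma monomial_eq_prod_list:
  "\<exists>vs. length vs = (\<Sum>v\<in>Poly_Mapping.keys m. Poly_Mapping.lookup m v) \<and>
    (Poly_Mapping.single m 1 :: ('v, 'k::comm_ring_1) free_alg) = prod_list (map gen vs)"
proof -
  have power: "Poly_Mapping.single (Poly_Mapping.single v n) 1 = (gen v ^ n :: ('v, 'k) free_alg)" for v n
  proof (induction n)
    case (Suc n)
    have "Poly_Mapping.single v (Suc n) = Poly_Mapping.single v 1 + Poly_Mapping.single v n" by (simp flip: single_add)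
    then show ?case unfolding power_Suc Suc.IH[symmetric] unfolding gen_def mult_single by simp
  qed simp
  have "\<exists>vs. length vs = sum n A \<and>
    (Poly_Mapping.single (\<Sum>v\<in>A. Poly_Mapping.single v (n v)) 1 :: ('v, 'k) free_alg) = prod_list (map gen vs)"
    if "finite A" for A and n :: "'v \<Rightarrow> nat"
    using that
  proof (induction A rule: finite_induct)
    case empty
    then show ?case by (intro exI[of _ "[]"]) simp
  next
    case (insert v A)
    then obtain vs where vs: "length vs = sum n A"
      "(Poly_Mapping.single (\<Sum>v\<in>A. Poly_Mapping.single v (n v)) 1 :: ('v, 'k) free_alg) = prod_list (map gen vs)" by blast
    have "Poly_Mapping.single (\<Sum>v\<in>insert v A. Poly_Mapping.single v (n v)) 1
      = Poly_Mapping.single (Poly_Mapping.single v (n v)) 1 * (Poly_Mapping.single (\<Sum>v\<in>A. Poly_Mapping.single v (n v)) 1 :: ('v, 'k) free_alg)"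
      using insert by (simp add: mult_single)
    also have "\<dots> = prod_list (map gen (replicate (n v) v @ vs))" unfolding power vs(2) by simp
    finally show ?case using insert vs(1) by (intro exI[of _ "replicate (n v) v @ vs"]) simp
  qed
  from this[of "Poly_Mapping.keys m" "Poly_Mapping.lookup m", OF finite_keys] show ?thesis unfolding sum_singles .
qed

lemma power5: "x ^ 5 = x * (x * (x * (x * x)))" for x :: "'a::comm_ring_1"
  by (simp add: numeral_eq_Suc)

locale symmetric_algebra = vector_space scale
  for scale :: "'k::{alg_closed_field, field_char_0} \<Rightarrow> 'v::ab_group_add \<Rightarrow> 'v"
begin

definition sym_eq :: "('v, 'k) free_alg \<Rightarrow> ('v, 'k) free_alg \<Rightarrow> bool" (infix "\<approx>" 50)
  where "p \<approx> q \<longleftrightarrow> p - q \<in> sym_ideal scale"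

sublocale ideal: module "(*) :: ('v, 'k) free_alg \<Rightarrow> _"
  by standard (simp_all add: algebra_simps)

lemma sym_eq_refl [simp]: "p \<approx> p"
  by (simp add: sym_eq_def sym_ideal_def ideal.span_zero)

lemma sym_eq_sym: "p \<approx> q \<Longrightarrow> q \<approx> p"
  using ideal.span_neg[of "p - q"] by (simp add: sym_eq_def sym_ideal_def)

lemma sym_eq_trans [trans]: "p \<approx> q \<Longrightarrow> q \<approx> r \<Longrightarrow> p \<approx> r"
  using ideal.span_add[of "p - q" _ "q - r"] by (simp add: sym_eq_def sym_ideal_def)

lemma sym_eq_add: "p \<approx> q \<Longrightarrow> p' \<approx> q' \<Longrightarrow> p + p' \<approx> q + q'"
  using ideal.span_add[of "p - q" _ "p' - q'"] by (simp add: sym_eq_def sym_ideal_def algebra_simps)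

lemma sym_eq_mult: "p \<approx> q \<Longrightarrow> p' \<approx> q' \<Longrightarrow> p * p' \<approx> q * q'"
  using ideal.span_add[OF ideal.span_scale[of "p - q" _ "p'"] ideal.span_scale[of "p' - q'" _ q]]
  by (simp add: sym_eq_def sym_ideal_def algebra_simps)

lemma sym_eq_power: "p \<approx> q \<Longrightarrow> p ^ n \<approx> q ^ n"
  by (induction n) (simp_all add: sym_eq_mult)

lemma sym_eq_sum_list: "(\<And>x. f x \<approx> g x) \<Longrightarrow> (\<Sum>x\<leftarrow>xs. f x) \<approx> (\<Sum>x\<leftarrow>xs. g x)"
  by (induction xs) (simp_all add: sym_eq_add)

lemma gen_add: "gen (u + v) \<approx> gen u + gen v"
  unfolding sym_eq_def sym_ideal_def sym_relations_def by (intro ideal.span_base) blast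

lemma gen_scale: "gen (scale c v) \<approx> const c * gen v"
  unfolding sym_eq_def sym_ideal_def sym_relations_def by (intro ideal.span_base) blast

lemma sym_class_eq: "p \<approx> q \<Longrightarrow> sym_class scale p = sym_class scale q"
  using sym_eq_trans sym_eq_sym unfolding sym_class_def sym_eq_def[symmetric] by blast

text \<open>Existence of some decomposition, of any length; it is what produces the multilinear form
  to be shortened.\<close>

definition power_sum :: "nat \<Rightarrow> ('v, 'k) free_alg \<Rightarrow> bool"
  where "power_sum d p \<longleftrightarrow> (\<exists>vs. p \<approx> (\<Sum>v\<leftarrow>vs. gen v ^ d))"

lemma power_sum_cong: "power_sum d q \<Longrightarrow> p \<approx> q \<Longrightarrow> power_sum d p"
  unfolding power_sum_def using sym_eq_trans by blast

lemma power_sum_add: "power_sum d p \<Longrightarrow> power_sum d q \<Longrightarrow> power_sum d (p + q)"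
  unfolding power_sum_def
proof (elim exE)
  fix us vs assume "p \<approx> (\<Sum>v\<leftarrow>us. gen v ^ d)" "q \<approx> (\<Sum>v\<leftarrow>vs. gen v ^ d)"
  then show "\<exists>vs. p + q \<approx> (\<Sum>v\<leftarrow>vs. gen v ^ d)" using sym_eq_add by (intro exI[of _ "us @ vs"]) simp
qed

lemma power_sum_0: "power_sum d 0"
  unfolding power_sum_def by (intro exI[of _ "[]"]) simp

lemma power_sum_sum: "(\<And>x. x \<in> A \<Longrightarrow> power_sum d (f x)) \<Longrightarrow> power_sum d (\<Sum>x\<in>A. f x)"
  by (induction A rule: infinite_finite_induct) (simp_all add: power_sum_0 power_sum_add)

lemma power_sum_const:
  assumes "d > 0" "power_sum d p"
  shows "power_sum d (const c * p)"
proof -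
  obtain r where r: "r ^ d = c" using nth_root_exists[OF assms(1)] by blast
  obtain vs where vs: "p \<approx> (\<Sum>v\<leftarrow>vs. gen v ^ d)" using assms(2) unfolding power_sum_def by blast
  have "const c * p \<approx> const c * (\<Sum>v\<leftarrow>vs. gen v ^ d)" using vs by (simp add: sym_eq_mult)
  also have "const c * (\<Sum>v\<leftarrow>vs. gen v ^ d) = (\<Sum>v\<leftarrow>vs. (const r * gen v) ^ d)"
    by (simp add: sum_list_const_mult power_mult_distrib const_simps flip: r)
  also have "\<dots> \<approx> (\<Sum>v\<leftarrow>vs. gen (scale r v) ^ d)" by (intro sym_eq_sum_list sym_eq_power sym_eq_sym[OF gen_scale])
  finally have "const c * p \<approx> (\<Sum>v\<leftarrow>map (scale r) vs. gen v ^ d)" by (simp add: o_def)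
  then show ?thesis unfolding power_sum_def by blast
qed

text \<open>Polarization: a linear combination of the powers \<open>(x + t y)\<^bsup>k+1\<^esup>\<close> extracts the term
  \<open>x\<^sup>k y\<close> that is linear in \<open>t\<close>.\<close>

lemma power_sum_polarize:
  assumes d: "d > 0" and p: "\<And>x. power_sum d (gen x ^ Suc k * q)"
  shows "power_sum d (gen x ^ k * (gen y * q))"
proof -
  obtain Z :: "'k set" where Z: "finite Z" "card Z = Suc (Suc k)"
    using infinite_arbitrarily_large[OF infinite_UNIV_char_0] by blast
  obtain c where c: "\<And>j. j < card Z \<Longrightarrow> (if j = 1 then 1 else 0) = (\<Sum>t\<in>Z. c t * t ^ j)"
    using vandermonde_solve[OF Z(1), of "\<lambda>j. if j = 1 then 1 else 0"] by blast
  let ?X = "gen x :: ('v, 'k) free_alg" and ?Y = "gen y :: ('v, 'k) free_alg"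
  have "power_sum d (const (c t) * ((const t * ?Y + ?X) ^ Suc k * q))" for t
  proof -
    have "gen (scale t y + x) \<approx> const t * ?Y + ?X" using gen_add gen_scale sym_eq_add sym_eq_refl sym_eq_trans by blast
    from sym_eq_mult[OF sym_eq_power[OF sym_eq_sym[OF this]] sym_eq_refl]
    have "(const t * ?Y + ?X) ^ Suc k * q \<approx> gen (scale t y + x) ^ Suc k * q" .
    then show ?thesis using power_sum_const[OF d] power_sum_cong[OF p] by blast
  qed
  then have "power_sum d (\<Sum>t\<in>Z. const (c t) * ((const t * ?Y + ?X) ^ Suc k * q))" by (rule power_sum_sum)
  also have "(\<Sum>t\<in>Z. const (c t) * ((const t * ?Y + ?X) ^ Suc k * q))
    = (\<Sum>t\<in>Z. \<Sum>j\<le>Suc k. const (c t * t ^ j) * (of_nat (Suc k choose j) * ?Y ^ j * ?X ^ (Suc k - j) * q))"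
    unfolding binomial_ring sum_distrib_left sum_distrib_right power_mult_distrib const_mult const_power by (simp only: mult_ac)
  also have "\<dots> = (\<Sum>j\<le>Suc k. const (\<Sum>t\<in>Z. c t * t ^ j) * (of_nat (Suc k choose j) * ?Y ^ j * ?X ^ (Suc k - j) * q))"
    by (subst sum.swap) (simp only: sum_distrib_right const_sum)
  also have "\<dots> = (\<Sum>j\<le>Suc k. if j = 1 then of_nat (Suc k) * ?Y * ?X ^ k * q else 0)"
  proof (rule sum.cong[OF refl])
    fix j assume "j \<in> {..Suc k}"
    then have "(\<Sum>t\<in>Z. c t * t ^ j) = (if j = 1 then 1 else 0)" using c[of j] Z(2) by simp
    then show "const (\<Sum>t\<in>Z. c t * t ^ j) * (of_nat (Suc k choose j) * ?Y ^ j * ?X ^ (Suc k - j) * q)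
      = (if j = 1 then of_nat (Suc k) * ?Y * ?X ^ k * q else 0)" by (simp add: const_simps)
  qed
  also have "\<dots> = of_nat (Suc k) * ?Y * ?X ^ k * q" by (simp del: sum.atMost_Suc)
  finally have "power_sum d (const (1 / of_nat (Suc k)) * (of_nat (Suc k) * ?Y * ?X ^ k * q))" by (rule power_sum_const[OF d])
  also have "const (1 / of_nat (Suc k)) * (of_nat (Suc k) * ?Y * ?X ^ k * q)
    = const (1 / of_nat (Suc k) * of_nat (Suc k)) * (?X ^ k * (?Y * q))"
    unfolding const_simps(2,6) by (simp only: mult_ac)
  also have "1 / of_nat (Suc k) * of_nat (Suc k) = (1 :: 'k)" by (simp del: of_nat_Suc)
  finally show ?thesis by (simp add: const_simps)
qed

text \<open>Starting from x^d, each polarization exchanges one factor x for the next generator. The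
  claim is kept for all x, since polarization needs a whole family of powers.\<close>

lemma power_sum_prod_list:
  assumes "length vs > 0"
  shows "power_sum (length vs) (prod_list (map gen vs))"
proof -
  have "power_sum (length vs) (gen x ^ (length vs - n) * prod_list (map gen us))"
    if "length us = n" "n \<le> length vs" for x us n
    using that
  proof (induction n arbitrary: x us)
    case 0
    then show ?case unfolding power_sum_def by (intro exI[of _ "[x]"]) simp
  next
    case (Suc n)
    then obtain y ys where us: "us = y # ys" "length ys = n" by (cases us) auto
    have "power_sum (length vs) (gen x ^ Suc (length vs - Suc n) * prod_list (map gen ys))" for x
      using Suc.IH[OF us(2), of x] Suc.prems(2) by (simp add: Suc_diff_Suc)
    from power_sum_polarize[OF assms this] show ?case by (simp add: us)
  qed
  from this[OF refl order_refl, of 0] show ?thesis by simp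
qed

lemma power_sum_if_homogeneous:
  assumes d: "d > 0" and h: "homogeneous d p"
  shows "power_sum d p"
proof -
  have "power_sum d (Poly_Mapping.single m (Poly_Mapping.lookup p m))" if "m \<in> Poly_Mapping.keys p" for m
  proof -
    have deg: "(\<Sum>v\<in>Poly_Mapping.keys m. Poly_Mapping.lookup m v) = d" using h that unfolding homogeneous_def by blast
    obtain vs where vs: "length vs = d" "(Poly_Mapping.single m 1 :: ('v, 'k) free_alg) = prod_list (map gen vs)"
      using monomial_eq_prod_list[of m] unfolding deg by blast
    have "Poly_Mapping.single m (Poly_Mapping.lookup p m) = const (Poly_Mapping.lookup p m) * prod_list (map gen vs)"
      unfolding vs(2)[symmetric] const_def mult_single by simp
    then show ?thesis using power_sum_const[OF d] power_sum_prod_list[of vs] vs(1) d by simp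
  qed
  then have "power_sum d (\<Sum>m\<in>Poly_Mapping.keys p. Poly_Mapping.single m (Poly_Mapping.lookup p m))"
    by (rule power_sum_sum)
  then show ?thesis unfolding sum_singles .
qed

section \<open>Coordinates and the passage from multilinear forms back to the symmetric
  algebra\<close>

definition lc :: "'v \<Rightarrow> 'v \<Rightarrow> 'v \<Rightarrow> 'k v3 \<Rightarrow> 'v"
  where "lc b1 b2 b3 l = (case l of (x, y, z) \<Rightarrow> scale x b1 + scale y b2 + scale z b3)"

lemma lc_surj:
  assumes "dim UNIV = 3"
  obtains b1 b2 b3 where "\<And>v. \<exists>l. v = lc b1 b2 b3 l"
proof -
  obtain B where B: "UNIV \<subseteq> span B" "card B = 3" using basis_exists[of UNIV] assms by metis
  then obtain b1 b2 b3 where b: "B = {b1, b2, b3}" by (metis card_3_iff)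
  have "\<exists>l. v = lc b1 b2 b3 l" for v
  proof -
    have "v \<in> span {b1, b2, b3}" using B(1) b by blast
    then obtain x y z where "v - scale x b1 - scale y b2 - scale z b3 = 0"
      by (auto simp: span_breakdown_eq)
    then have "v = lc b1 b2 b3 (x, y, z)" by (simp add: lc_def algebra_simps)
    then show ?thesis by blast
  qed
  then show ?thesis by (rule that)
qed

text \<open>Modulo the relations, each generator expands in those of the coordinate vectors, and the
  coefficients of the expanded power sum are its polarized values on the unit vectors.\<close>

lemma power_sum_5_eq:
  fixes ls ls' :: "'k v3 list"
  assumes eq: "\<And>a b c d e. (\<Sum>l\<leftarrow>ls. dot l a * dot l b * dot l c * dot l d * dot l e)
    = (\<Sum>l\<leftarrow>ls'. dot l a * dot l b * dot l c * dot l d * dot l e)"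
  shows "(\<Sum>l\<leftarrow>ls. gen (lc b1 b2 b3 l) ^ 5) \<approx> (\<Sum>l\<leftarrow>ls'. gen (lc b1 b2 b3 l) ^ 5)"
proof -
  define U :: "'k v3 set" where "U = {(1, 0, 0), (0, 1, 0), (0, 0, 1)}"
  define X :: "'k v3 \<Rightarrow> ('v, 'k) free_alg" where "X u = gen (lc b1 b2 b3 u)" for u
  have five: "(\<Sum>u\<in>U. g u) ^ 5 = (\<Sum>a\<in>U. \<Sum>b\<in>U. \<Sum>c\<in>U. \<Sum>d\<in>U. \<Sum>e\<in>U. g a * (g b * (g c * (g d * g e))))" for g :: "_ \<Rightarrow> ('v, 'k) free_alg"
    unfolding power5 sum_distrib_left[symmetric] sum_distrib_right[symmetric] ..
  have expand: "(\<Sum>l\<leftarrow>ls. gen (lc b1 b2 b3 l) ^ 5) \<approx> (\<Sum>a\<in>U. \<Sum>b\<in>U. \<Sum>c\<in>U. \<Sum>d\<in>U. \<Sum>e\<in>U.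
    const (\<Sum>l\<leftarrow>ls. dot l a * dot l b * dot l c * dot l d * dot l e) * (X a * (X b * (X c * (X d * X e)))))" for ls
  proof -
    have gen: "gen (lc b1 b2 b3 l) \<approx> (\<Sum>u\<in>U. const (dot l u) * X u)" for l
    proof -
      obtain x y z where l: "l = (x, y, z)" by (cases l)
      have "gen (scale x b1 + scale y b2 + scale z b3) \<approx> const x * gen b1 + const y * gen b2 + const z * gen b3"
        by (meson gen_add gen_scale sym_eq_add sym_eq_trans)
      then show ?thesis by (simp add: l U_def X_def lc_def dot_def add.assoc)
    qed
    have "(\<Sum>l\<leftarrow>ls. gen (lc b1 b2 b3 l) ^ 5) \<approx> (\<Sum>l\<leftarrow>ls. (\<Sum>u\<in>U. const (dot l u) * X u) ^ 5)"
      by (intro sym_eq_sum_list sym_eq_power gen)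
    also have "\<dots> = (\<Sum>l\<leftarrow>ls. \<Sum>a\<in>U. \<Sum>b\<in>U. \<Sum>c\<in>U. \<Sum>d\<in>U. \<Sum>e\<in>U.
      const (dot l a * dot l b * dot l c * dot l d * dot l e) * (X a * (X b * (X c * (X d * X e)))))"
      unfolding five const_simps by (simp only: mult_ac)
    also have "\<dots> = (\<Sum>a\<in>U. \<Sum>b\<in>U. \<Sum>c\<in>U. \<Sum>d\<in>U. \<Sum>e\<in>U.
      const (\<Sum>l\<leftarrow>ls. dot l a * dot l b * dot l c * dot l d * dot l e) * (X a * (X b * (X c * (X d * X e)))))"
      by (induction ls) (simp_all only: list.map sum_list.Nil sum_list.Cons const_simps(1,4) distrib_right sum.distrib mult_zero_left sum.neutral_const)
    finally show ?thesis .
  qed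
  show ?thesis by (rule sym_eq_trans[OF expand[of ls, unfolded eq] sym_eq_sym[OF expand[of ls']]])
qed

lemma waring_rank_le:
  assumes "p \<approx> (\<Sum>v\<leftarrow>vs. gen v ^ d)"
  shows "waring_rank scale d (sym_class scale p) \<le> enat (length vs)"
  unfolding waring_rank_def by (intro Inf_lower CollectI exI[of _ vs] conjI sym_class_eq[OF assms] refl)

end

text \<open>Any decomposition of f into fifth powers, however long, defines by its coordinates a
  symmetric 5-linear form on the dual space. A decomposition of that form with at most 10 terms has
  the same polarization, hence the same class.\<close>

theorem proposition5p2:
  fixes scale :: "'k::{alg_closed_field, field_char_0} \<Rightarrow> 'v::ab_group_add \<Rightarrow> 'v"
  assumes "vector_space scale"
    and "vector_space.dim scale UNIV = 3"
  shows "\<forall>f \<in> sym_power scale 5. waring_rank scale 5 f \<le> 10"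
proof
  interpret symmetric_algebra scale by (rule symmetric_algebra.intro[OF assms(1)])
  fix f assume "f \<in> sym_power scale 5"
  then obtain p where p: "f = sym_class scale p" "homogeneous 5 p" unfolding sym_power_def by blast
  obtain b1 b2 b3 where b: "\<And>v. \<exists>l. v = lc b1 b2 b3 l" using lc_surj[OF assms(2)] by blast
  then obtain co where co: "\<And>v. v = lc b1 b2 b3 (co v)" by metis
  obtain vs where vs: "p \<approx> (\<Sum>v\<leftarrow>vs. gen v ^ 5)" using power_sum_if_homogeneous[OF _ p(2)] unfolding power_sum_def by auto
  let ?ls = "map co vs"
  have "map (lc b1 b2 b3) ?ls = vs" by (simp add: o_def co[symmetric])
  then have "(\<Sum>v\<leftarrow>vs. gen v ^ 5) = (\<Sum>v\<leftarrow>map (lc b1 b2 b3) ?ls. gen v ^ 5 :: ('v, 'k) free_alg)" by simp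
  also have "\<dots> = (\<Sum>l\<leftarrow>?ls. gen (lc b1 b2 b3 l) ^ 5)" unfolding map_map comp_def ..
  finally have 1: "p \<approx> (\<Sum>l\<leftarrow>?ls. gen (lc b1 b2 b3 l) ^ 5)" using vs by (simp only:)
  interpret Q: quintic_form "\<lambda>a b c d e. \<Sum>l\<leftarrow>?ls. dot l a * dot l b * dot l c * dot l d * dot l e"
    by (rule power_sum_quintic_form)
  obtain ls where ls: "length ls \<le> 10"
    "\<And>a b c d e. (\<Sum>l\<leftarrow>?ls. dot l a * dot l b * dot l c * dot l d * dot l e) = (\<Sum>l\<leftarrow>ls. dot l a * dot l b * dot l c * dot l d * dot l e)"
    using Q.qrank_10 unfolding qrank_def by blast
  have "p \<approx> (\<Sum>v\<leftarrow>map (lc b1 b2 b3) ls. gen v ^ 5)"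
    using sym_eq_trans[OF 1 power_sum_5_eq[OF ls(2)]] by (simp add: o_def)
  from waring_rank_le[OF this] have "waring_rank scale 5 f \<le> enat (length ls)" unfolding p(1) by simp
  also have "\<dots> \<le> 10" using ls(1) by (simp add: numeral_eq_enat)
  finally show "waring_rank scale 5 f \<le> 10" .
qed

end
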